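(* Let $K\subset\mathbb{R}^n$ be an unconditional convex body, and let $H\subset\mathbb{R}^n$ be any Hanner polytope of the same dimension (centered at the origin). Then, for every $R>0$, $$\operatorname{Vol}_K(B_K(R))\ge\operatorname{Vol}_H(B_H(R)),$$ and equality holds if and only if $K$ is a Hanner polytope.
   Context: For a convex body $K\subset\mathbb{R}^n$ (compact, convex, nonempty interior) and $x\in\operatorname{int}K$, let $K^x:=(K-x)^\circ=\{\xi:\langle\xi,y-x\rangle\le 1\ \text{for all } y\in K\}$. The forward Funk metric ball of radius $R>0$ centered at $x\in\operatorname{int} K$ is $B_K(x,R):=x+(1-e^{-R})(K-x)$, and $B_K(R):=B_K(0,R)$. The Holmes--Thompson volume of the Funk geometry on $K$ is $\operatorname{Vol}_K(U):=\frac{1}{\omega_n}\int_U|K^x|\,dx$ for Borel $U\subset\operatorname{int}K$, where $|\cdot|$ is Lebesgue measure and $\omega_n$ is the volume of the Euclidean unit ball in $\mathbb{R}^n$. A convex body is unconditional if it is symmetric under reflections in all coordinate hyperplanes. A Hanner polytope is any polytope that can be constructed from (origin-symmetric) line segments by taking Cartesian products and polar bodies. *)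

theory Defs
  imports "HOL-Analysis.Analysis"
begin

definition convex_body :: "(real ^ 'n) set \<Rightarrow> bool" where
  "convex_body K \<longleftrightarrow> compact K \<and> convex K \<and> interior K \<noteq> {}"

definition polar :: "(real ^ 'n) set \<Rightarrow> (real ^ 'n) set" where
  "polar K = {\<xi>. \<forall>y\<in>K. \<xi> \<bullet> y \<le> 1}"

definition polar_at :: "(real ^ 'n) set \<Rightarrow> real ^ 'n \<Rightarrow> (real ^ 'n) set" where
  "polar_at K x = polar ((\<lambda>y. y - x) ` K)"

definition funk_ball :: "(real ^ 'n) set \<Rightarrow> real ^ 'n \<Rightarrow> real \<Rightarrow> (real ^ 'n) set" where
  "funk_ball K x R = (\<lambda>y. x + (1 - exp (- R)) *\<^sub>R (y - x)) ` K"

(* Meaningful for Borel sets U contained in the interior of K. *)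
definition funk_vol :: "(real ^ 'n) set \<Rightarrow> (real ^ 'n) set \<Rightarrow> ennreal" where
  "funk_vol K U =
     (\<integral>\<^sup>+x\<in>U. emeasure lborel (polar_at K x) \<partial>lborel) / emeasure lborel (ball (0 :: real ^ 'n) 1)"

definition reflect_coord :: "'n \<Rightarrow> real ^ 'n \<Rightarrow> real ^ 'n" where
  "reflect_coord i x = (\<chi> j. if j = i then - x $ j else x $ j)"

definition unconditional :: "(real ^ 'n) set \<Rightarrow> bool" where
  "unconditional K \<longleftrightarrow> (\<forall>i. reflect_coord i ` K = K)"

(* The coordinate subspace of the vectors supported on I, playing the role of the
   Euclidean space with index set I. *)
definition coord_subspace :: "'n set \<Rightarrow> (real ^ 'n) set" where
  "coord_subspace I = {x. \<forall>i. i \<notin> I \<longrightarrow> x $ i = 0}"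

(* hanner_on I A: A is a Hanner polytope in coord_subspace I.  Spaces of different
   dimensions are all realised as coordinate subspaces of one ambient space, so the Cartesian
   product of bodies with disjoint index sets is their Minkowski sum, and the polar is taken
   inside the coordinate subspace. The index sets need not be blocks of consecutive
   coordinates: the order of the factors is immaterial. *)
inductive hanner_on :: "'n set \<Rightarrow> (real ^ 'n) set \<Rightarrow> bool" where
  segment: "a > 0 \<Longrightarrow> hanner_on {i} (closed_segment (axis i (- a)) (axis i a))"
| product: "hanner_on I A \<Longrightarrow> hanner_on J B \<Longrightarrow> I \<inter> J = {} \<Longrightarrow>
            hanner_on (I \<union> J) {x + y | x y. x \<in> A \<and> y \<in> B}"
| polar: "hanner_on I A \<Longrightarrow> hanner_on I (polar A \<inter> coord_subspace I)"

definition hanner_polytope :: "(real ^ 'n) set \<Rightarrow> bool" where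
  "hanner_polytope H \<longleftrightarrow> hanner_on UNIV H"

end

theory Submission
  imports Defs
begin

text \<open>
Let \<open>p\<close> and \<open>q\<close> be the gauges of \<open>K\<close> and of its polar, and let \<open>\<rho> = 1 - exp (- R)\<close>. The polar body at
a point \<open>x\<close> has gauge \<open>q \<xi> - x \<bullet> \<xi>\<close>, so its volume is, up to \<open>n!\<close>, the integral of
\<open>exp (x \<bullet> \<xi> - q \<xi>)\<close> over \<open>\<xi>\<close>. As \<open>q\<close> is invariant under coordinate reflections, \<open>exp (x \<bullet> \<xi>)\<close> may be
replaced by the product of the \<open>cosh (x\<^sub>i \<xi>\<^sub>i)\<close>. Expanding this into a power series separates the
variables: the Funk volume of the ball of radius \<open>R\<close> becomes a series over exponents \<open>m\<close>, with
nonnegative coefficients depending on \<open>\<rho>\<close> and \<open>m\<close> only, of products of the \<open>m\<close>-th absolute moment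
of \<open>K\<close> and that of its polar (\<open>funk_integral_expansion\<close>). It therefore suffices to minimise each
product of moments separately.

Moments are written as iterated integrals of \<open>exp (- p)\<close> along coordinate rays, indexed by a list of
coordinates. Removing an entry from the list is differentiation in that direction. Since \<open>p\<close> is
subadditive, the directional derivative of \<open>exp (- p)\<close> along \<open>x\<close> is at least \<open>- exp (- p)\<close> if \<open>x\<close> is
in \<open>K\<close>. Hence the vector of quotients of the integrals with one entry removed by the full
integral belongs to the polar (\<open>laplace_derivative_bound\<close>, \<open>log_gradient_polar\<close>). This is a weighted
version of Meyer's proof of the Mahler inequality for unconditional bodies. Pairing the vector of \<open>K\<close>
with that of its polar bounds the product of integrals from below by the sum of the products with one
entry removed, and induction gives a multinomial coefficient as lower bound (\<open>laplace_product_ge\<close>).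
For Hanner polytopes the bound is attained, by induction on their construction
(\<open>hanner_polytope_extremal\<close>).

If the volumes agree, the bound is attained for all lists. Then there are points \<open>\<eta>\<close> of \<open>K\<close> and \<open>\<xi>\<close> of
the polar with \<open>p (y + h \<eta>) = p y + h\<close> and \<open>q (y + h \<xi>) = q y + h\<close> on the positive orthant, for which
the products \<open>\<eta>\<^sub>j \<xi>\<^sub>j\<close> are prescribed proportions (\<open>extremal_factorization\<close>). If almost all weight is put
on one coordinate, this shows that every coordinate plane cuts \<open>K\<close> in a rhombus or in a rectangle
(\<open>extremal_pair\<close>), and that \<open>p\<close> is a weighted \<open>\<ell>\<^sub>1\<close> norm on each set of coordinates that pairwise span
rhombi (\<open>extremal_clique_sum\<close>). Take these pairs as the edges of a graph. An induced path with four
vertices would allow too few products \<open>\<eta>\<^sub>j \<xi>\<^sub>j\<close> (\<open>extremal_no_path4\<close>). A graph without such paths is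
disconnected or has a disconnected complement (\<open>path4_free_split\<close>); correspondingly \<open>K\<close> splits as a
Cartesian product or as the polar of one, and induction shows that \<open>K\<close> is a Hanner polytope
(\<open>extremal_unit_ball_hanner\<close>).
\<close>

section \<open>Iterated integrals along coordinate rays\<close>

abbreviation unit_vec :: "'n \<Rightarrow> real ^ 'n" where
  "unit_vec i \<equiv> axis i 1"

text \<open>
The basic operator is \<open>ray_int i\<close>, integration along the \<open>i\<close>-th positive half axis, a right
inverse of minus the \<open>i\<close>-th partial derivative. Listing \<open>i\<close> exactly \<open>k + 1\<close> times amounts to
integrating against \<open>s ^ k / k!\<close>, and not listing it to restricting the function to the hyperplane
where that coordinate vanishes. So a list of coordinates encodes a moment together with a coordinate
section, and both can be lowered by the same operation, the removal of one entry.
\<close>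

definition ray_int :: "'n \<Rightarrow> (real ^ 'n \<Rightarrow> ennreal) \<Rightarrow> real ^ 'n \<Rightarrow> ennreal" where
  "ray_int i f y = (\<integral>\<^sup>+s. f (y + s *\<^sub>R unit_vec i) * indicator {0..} s \<partial>lborel)"

primrec ray_ints :: "'n list \<Rightarrow> (real ^ 'n \<Rightarrow> ennreal) \<Rightarrow> real ^ 'n \<Rightarrow> ennreal" where
  "ray_ints [] f = f"
| "ray_ints (i # is) f = ray_int i (ray_ints is f)"

lemma ray_int_measurable [measurable (raw)]:
  fixes f :: "real ^ 'n \<Rightarrow> ennreal"
  assumes [measurable]: "f \<in> borel_measurable borel" "g \<in> measurable M borel"
  shows "(\<lambda>x. ray_int i f (g x)) \<in> borel_measurable M"
  unfolding ray_int_def by measurable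

lemma ray_ints_measurable [measurable (raw)]:
  fixes f :: "real ^ 'n \<Rightarrow> ennreal"
  assumes f: "f \<in> borel_measurable borel" and g: "g \<in> measurable M borel"
  shows "(\<lambda>x. ray_ints cs f (g x)) \<in> borel_measurable M"
proof -
  have "ray_ints cs f \<in> borel_measurable borel"
  proof (induction cs)
    case (Cons c cs)
    then show ?case using ray_int_measurable[of "ray_ints cs f" "\<lambda>x. x" borel c] by simp
  qed (use f in auto)
  then show ?thesis using g by measurable
qed

text \<open>
By Tonelli's theorem only the multiset of the listed coordinates matters.
\<close>

lemma ray_int_commute:
  fixes f :: "real ^ 'n \<Rightarrow> ennreal"
  assumes [measurable]: "f \<in> borel_measurable borel"
  shows "ray_int i (ray_int j f) = ray_int j (ray_int i f)"
proof
  fix y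
  have "ray_int i (ray_int j f) y = (\<integral>\<^sup>+s. (\<integral>\<^sup>+t. f (y + s *\<^sub>R unit_vec i + t *\<^sub>R unit_vec j)
      * indicator {0..} t * indicator {0..} s \<partial>lborel) \<partial>lborel)"
    unfolding ray_int_def by (simp add: nn_integral_multc)
  also have "\<dots> = (\<integral>\<^sup>+t. (\<integral>\<^sup>+s. f (y + s *\<^sub>R unit_vec i + t *\<^sub>R unit_vec j)
      * indicator {0..} t * indicator {0..} s \<partial>lborel) \<partial>lborel)"
    by (rule lborel_pair.Fubini') measurable
  also have "\<dots> = (\<integral>\<^sup>+t. (\<integral>\<^sup>+s. f (y + t *\<^sub>R unit_vec j + s *\<^sub>R unit_vec i)
      * indicator {0..} s * indicator {0..} t \<partial>lborel) \<partial>lborel)"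
    by (simp add: ac_simps)
  also have "\<dots> = ray_int j (ray_int i f) y"
    unfolding ray_int_def by (simp add: nn_integral_multc)
  finally show "ray_int i (ray_int j f) y = ray_int j (ray_int i f) y" .
qed

lemma ray_ints_remove1:
  fixes f :: "real ^ 'n \<Rightarrow> ennreal"
  assumes [measurable]: "f \<in> borel_measurable borel" and "i \<in> set cs"
  shows "ray_ints cs f = ray_int i (ray_ints (remove1 i cs) f)"
  using assms(2) by (induction cs) (auto simp: ray_int_commute)

lemma ray_ints_append: "ray_ints (xs @ ys) f = ray_ints xs (ray_ints ys f)"
  by (induction xs) auto

text \<open>
The iterated integral at \<open>y\<close> samples \<open>f\<close> only at points reached from \<open>y\<close> along positive coordinate
directions in the list, hence only on any set closed under such steps.
\<close>

lemma ray_ints_mono_on: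
  fixes f :: "real ^ 'n \<Rightarrow> ennreal"
  assumes "\<And>y. y \<in> S \<Longrightarrow> f y \<le> g y"
    and "\<And>y i s. y \<in> S \<Longrightarrow> i \<in> set cs \<Longrightarrow> 0 \<le> s \<Longrightarrow> y + s *\<^sub>R unit_vec i \<in> S"
  shows "y \<in> S \<Longrightarrow> ray_ints cs f y \<le> ray_ints cs g y"
  using assms(2)
proof (induction cs arbitrary: y)
  case (Cons c cs)
  then show ?case
    unfolding ray_ints.simps ray_int_def
    by (intro nn_integral_mono) (auto simp: indicator_def)
qed (use assms(1) in auto)

lemma ray_ints_cong_on:
  fixes f :: "real ^ 'n \<Rightarrow> ennreal"
  assumes "\<And>y. y \<in> S \<Longrightarrow> f y = g y"
    and "\<And>y i s. y \<in> S \<Longrightarrow> i \<in> set cs \<Longrightarrow> 0 \<le> s \<Longrightarrow> y + s *\<^sub>R unit_vec i \<in> S"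
    and "y \<in> S"
  shows "ray_ints cs f y = ray_ints cs g y"
  using assms by (intro antisym ray_ints_mono_on[where S = S]) auto

lemma ray_ints_shift: "ray_ints cs (\<lambda>y. f (y + v)) y = ray_ints cs f (y + v)"
  by (induction cs arbitrary: y) (auto simp: ray_int_def ac_simps)

lemma ray_ints_cmult:
  fixes f :: "real ^ 'n \<Rightarrow> ennreal"
  assumes [measurable]: "f \<in> borel_measurable borel"
  shows "ray_ints cs (\<lambda>y. c * f y) y = c * ray_ints cs f y"
  by (induction cs arbitrary: y) (auto simp: ray_int_def nn_integral_cmult mult.assoc)

lemma ray_ints_add:
  fixes f :: "real ^ 'n \<Rightarrow> ennreal"
  assumes [measurable]: "f \<in> borel_measurable borel" "g \<in> borel_measurable borel"
  shows "ray_ints cs (\<lambda>y. f y + g y) y = ray_ints cs f y + ray_ints cs g y"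
  by (induction cs arbitrary: y) (auto simp: ray_int_def nn_integral_add distrib_right)

lemma ray_ints_scale:
  fixes f :: "real ^ 'n \<Rightarrow> ennreal"
  assumes [measurable]: "f \<in> borel_measurable borel" and "t > 0"
  shows "ray_ints cs f (t *\<^sub>R y) = ennreal (t ^ length cs) * ray_ints cs (\<lambda>y. f (t *\<^sub>R y)) y"
proof (induction cs arbitrary: y)
  case (Cons c cs)
  have "ray_ints (c # cs) f (t *\<^sub>R y) =
      ennreal \<bar>t\<bar> * (\<integral>\<^sup>+s. ray_ints cs f (t *\<^sub>R y + (0 + t * s) *\<^sub>R unit_vec c) * indicator {0..} (0 + t * s) \<partial>lborel)"
    unfolding ray_ints.simps ray_int_def
    by (subst nn_integral_real_affine[where c = t and t = 0]) (use \<open>t > 0\<close> in auto)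
  also have "\<dots> = ennreal t * (\<integral>\<^sup>+s. ray_ints cs f (t *\<^sub>R (y + s *\<^sub>R unit_vec c)) * indicator {0..} s \<partial>lborel)"
    using \<open>t > 0\<close> by (simp add: indicator_def zero_le_mult_iff algebra_simps cong: if_cong)
  also have "\<dots> = ennreal t * (\<integral>\<^sup>+s. ennreal (t ^ length cs) *
      (ray_ints cs (\<lambda>y. f (t *\<^sub>R y)) (y + s *\<^sub>R unit_vec c) * indicator {0..} s) \<partial>lborel)"
    by (simp add: Cons.IH mult.assoc)
  also have "\<dots> = ennreal (t ^ length (c # cs)) * ray_ints (c # cs) (\<lambda>y. f (t *\<^sub>R y)) y"
    using \<open>t > 0\<close>
    by (subst nn_integral_cmult) (auto simp: ray_int_def ennreal_mult mult.assoc)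
  finally show ?case .
qed auto

lemma ray_ints_nn_integral:
  fixes f :: "'b \<Rightarrow> real ^ 'n \<Rightarrow> ennreal"
  assumes "sigma_finite_measure M"
    and [measurable]: "(\<lambda>(t, y). f t y) \<in> borel_measurable (M \<Otimes>\<^sub>M borel)"
  shows "ray_ints cs (\<lambda>y. \<integral>\<^sup>+t. f t y \<partial>M) y = (\<integral>\<^sup>+t. ray_ints cs (f t) y \<partial>M)
    \<and> (\<lambda>(t, y). ray_ints cs (f t) y) \<in> borel_measurable (M \<Otimes>\<^sub>M borel)"
proof (induction cs arbitrary: y)
  case (Cons c cs)
  interpret M: sigma_finite_measure M by fact
  interpret pair_sigma_finite M "lborel :: real measure" ..
  have [measurable]: "(\<lambda>(t, y). ray_ints cs (f t) y) \<in> borel_measurable (M \<Otimes>\<^sub>M borel)"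
    using Cons by blast
  have "ray_ints (c # cs) (\<lambda>y. \<integral>\<^sup>+t. f t y \<partial>M) y =
     (\<integral>\<^sup>+s. (\<integral>\<^sup>+t. ray_ints cs (f t) (y + s *\<^sub>R unit_vec c) * indicator {0..} s \<partial>M) \<partial>lborel)"
    using Cons by (simp add: ray_int_def nn_integral_multc)
  also have "\<dots> = (\<integral>\<^sup>+t. (\<integral>\<^sup>+s. ray_ints cs (f t) (y + s *\<^sub>R unit_vec c) * indicator {0..} s \<partial>lborel) \<partial>M)"
    by (rule Fubini') measurable
  finally have 1: "ray_ints (c # cs) (\<lambda>y. \<integral>\<^sup>+t. f t y \<partial>M) y = (\<integral>\<^sup>+t. ray_ints (c # cs) (f t) y \<partial>M)"
    by (simp add: ray_int_def)
  have "(\<lambda>(t, y). ray_ints (c # cs) (f t) y) \<in> borel_measurable (M \<Otimes>\<^sub>M borel)"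
    unfolding ray_ints.simps ray_int_def by measurable
  with 1 show ?case by blast
qed auto

lemma ray_int_split:
  fixes f :: "real ^ 'n \<Rightarrow> ennreal"
  assumes [measurable]: "f \<in> borel_measurable borel" and "0 \<le> h"
  shows "ray_int i f y = (\<integral>\<^sup>+s. f (y + s *\<^sub>R unit_vec i) * indicator {0..<h} s \<partial>lborel)
     + ray_int i f (y + h *\<^sub>R unit_vec i)"
proof -
  have "ray_int i f (y + h *\<^sub>R unit_vec i) =
      (\<integral>\<^sup>+s. f (y + (h + 1 * s) *\<^sub>R unit_vec i) * indicator {h..} (h + 1 * s) \<partial>lborel)"
    unfolding ray_int_def by (intro nn_integral_cong) (auto simp: algebra_simps indicator_def)
  also have "\<dots> = (\<integral>\<^sup>+s. f (y + s *\<^sub>R unit_vec i) * indicator {h..} s \<partial>lborel)"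
    by (subst nn_integral_real_affine[where c = 1 and t = h]) auto
  finally have eq: "ray_int i f (y + h *\<^sub>R unit_vec i) = (\<integral>\<^sup>+s. f (y + s *\<^sub>R unit_vec i) * indicator {h..} s \<partial>lborel)" .
  have "ray_int i f y = (\<integral>\<^sup>+s. f (y + s *\<^sub>R unit_vec i) * indicator {0..<h} s
      + f (y + s *\<^sub>R unit_vec i) * indicator {h..} s \<partial>lborel)"
    unfolding ray_int_def using \<open>0 \<le> h\<close> by (intro nn_integral_cong) (auto simp: indicator_def)
  also have "\<dots> = (\<integral>\<^sup>+s. f (y + s *\<^sub>R unit_vec i) * indicator {0..<h} s \<partial>lborel)
     + ray_int i f (y + h *\<^sub>R unit_vec i)"
    unfolding eq by (rule nn_integral_add) measurable
  finally show ?thesis .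
qed

text \<open>
Positivity of an integrand is used in the robust form ``bounded below by a positive constant on a
ball'', because this form is inherited by \<open>ray_int i f\<close> at every point from which the ball can be
reached along the ray, whereas continuity of an improper integral needs domination.
\<close>

lemma ray_int_pos_near:
  fixes f :: "real ^ 'n \<Rightarrow> ennreal"
  assumes "\<delta> > 0" "r > 0" "s \<ge> 0" "\<And>y. dist y (p + s *\<^sub>R unit_vec i) < r \<Longrightarrow> f y \<ge> \<delta>"
  shows "\<exists>\<delta>'>0. \<exists>r'>0. \<forall>y. dist y p < r' \<longrightarrow> ray_int i f y \<ge> \<delta>'"
proof (intro exI conjI allI impI)
  show "\<delta> * ennreal (r / 2) > 0" using assms by (simp add: ennreal_zero_less_mult_iff)
  show "r / 2 > 0" using assms by simp
  fix y assume y: "dist y p < r / 2"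
  have "\<delta> * ennreal (r / 2) = (\<integral>\<^sup>+t. \<delta> * indicator {s..s + r / 2} t \<partial>lborel)"
    using assms by (simp add: nn_integral_cmult)
  also have "\<dots> \<le> ray_int i f y"
    unfolding ray_int_def
  proof (intro nn_integral_mono)
    fix t :: real
    have "f (y + t *\<^sub>R unit_vec i) \<ge> \<delta>" if "t \<in> {s..s + r / 2}"
    proof (rule assms(4))
      have "dist (y + t *\<^sub>R unit_vec i) (p + s *\<^sub>R unit_vec i) = norm ((y - p) + (t - s) *\<^sub>R unit_vec i)"
        by (simp add: dist_norm algebra_simps)
      also have "\<dots> \<le> norm (y - p) + norm ((t - s) *\<^sub>R (unit_vec i :: real ^ 'n))"
        by (rule norm_triangle_ineq)
      also have "\<dots> < r / 2 + r / 2"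
        using that y by (simp add: dist_norm norm_axis_1)
      finally show "dist (y + t *\<^sub>R unit_vec i) (p + s *\<^sub>R unit_vec i) < r" by simp
    qed
    then show "\<delta> * indicator {s..s + r / 2} t \<le> f (y + t *\<^sub>R unit_vec i) * indicator {0..} t"
      using \<open>s \<ge> 0\<close> by (auto simp: indicator_def)
  qed
  finally show "\<delta> * ennreal (r / 2) \<le> ray_int i f y" .
qed

lemma ray_ints_pos_near:
  fixes f :: "real ^ 'n \<Rightarrow> ennreal"
  assumes "\<exists>\<delta>>0. \<exists>r>0. \<forall>y. dist y (p + v) < r \<longrightarrow> f y \<ge> \<delta>"
    and "\<And>i. v $ i \<ge> 0" "\<And>i. i \<notin> set cs \<Longrightarrow> v $ i = 0"
  shows "\<exists>\<delta>>0. \<exists>r>0. \<forall>y. dist y p < r \<longrightarrow> ray_ints cs f y \<ge> \<delta>"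
  using assms
proof (induction cs arbitrary: p v)
  case Nil
  then have "v = 0" by (simp add: vec_eq_iff)
  with Nil show ?case by simp
next
  case (Cons c cs)
  \<comment> \<open>The whole displacement in a coordinate is assigned to its last occurrence in the list.\<close>
  define s where "s = (if c \<in> set cs then 0 else v $ c)"
  define w where "w = v - s *\<^sub>R unit_vec c"
  have "\<exists>\<delta>>0. \<exists>r>0. \<forall>y. dist y (p + s *\<^sub>R unit_vec c) < r \<longrightarrow> ray_ints cs f y \<ge> \<delta>"
  proof (rule Cons.IH)
    show "\<exists>\<delta>>0. \<exists>r>0. \<forall>y. dist y (p + s *\<^sub>R unit_vec c + w) < r \<longrightarrow> f y \<ge> \<delta>"
      using Cons.prems(1) by (simp add: w_def)
    show "w $ i \<ge> 0" for i
      using Cons.prems(2) by (auto simp: w_def s_def axis_def)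
    show "w $ i = 0" if "i \<notin> set cs" for i
      using Cons.prems(3) that by (auto simp: w_def s_def axis_def)
  qed
  then obtain \<delta> r where "\<delta> > 0" "r > 0" "\<And>y. dist y (p + s *\<^sub>R unit_vec c) < r \<Longrightarrow> ray_ints cs f y \<ge> \<delta>"
    by blast
  moreover have "s \<ge> 0" using Cons.prems(2) by (auto simp: s_def)
  ultimately show ?case
    using ray_int_pos_near[of \<delta> r s p c "ray_ints cs f"] by simp
qed

section \<open>Dual pairs of unconditional gauges\<close>

text \<open>
A body \<open>K\<close> in the coordinate subspace of \<open>I\<close> enters the argument only through its gauge \<open>p\<close> and the
gauge \<open>q\<close> of its polar. They are linked by the duality inequality and by its sharpness, which make
\<open>p\<close> the support function of the set where \<open>q \<le> 1\<close>. Homogeneity, subadditivity and, because of the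
reflection symmetry, monotonicity on the positive orthant all follow from this. Both are functions on
the whole space, so that bodies of different dimensions can be combined in one type.
\<close>

definition gauge_of_polar :: "'n set \<Rightarrow> (real ^ 'n \<Rightarrow> real) \<Rightarrow> (real ^ 'n \<Rightarrow> real) \<Rightarrow> bool" where
  "gauge_of_polar I p q \<longleftrightarrow> continuous_on UNIV p \<and> (\<forall>x. 0 \<le> p x) \<and> (\<forall>i x. p (reflect_coord i x) = p x)
     \<and> (\<forall>x\<in>coord_subspace I. (\<forall>\<xi>\<in>coord_subspace I. x \<bullet> \<xi> \<le> p x * q \<xi>)
          \<and> (\<exists>\<xi>\<in>coord_subspace I. q \<xi> \<le> 1 \<and> x \<bullet> \<xi> = p x))"

definition dual_pair :: "'n set \<Rightarrow> (real ^ 'n \<Rightarrow> real) \<Rightarrow> (real ^ 'n \<Rightarrow> real) \<Rightarrow> bool" where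
  "dual_pair I p q \<longleftrightarrow> gauge_of_polar I p q \<and> gauge_of_polar I q p"

lemma dual_pair_sym: "dual_pair I p q \<Longrightarrow> dual_pair I q p"
  by (simp add: dual_pair_def)

lemma coord_subspace_UNIV [simp]: "coord_subspace UNIV = UNIV"
  by (simp add: coord_subspace_def)

lemma coord_subspace_closed:
  "0 \<in> coord_subspace I"
  "x \<in> coord_subspace I \<Longrightarrow> y \<in> coord_subspace I \<Longrightarrow> x + y \<in> coord_subspace I"
  "x \<in> coord_subspace I \<Longrightarrow> c *\<^sub>R x \<in> coord_subspace I"
  "i \<in> I \<Longrightarrow> axis i c \<in> coord_subspace I"
  by (auto simp: coord_subspace_def axis_def)

definition proj_on :: "'n set \<Rightarrow> real ^ 'n \<Rightarrow> real ^ 'n" where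
  "proj_on I x = (\<chi> i. if i \<in> I then x $ i else 0)"

definition abs_vec :: "real ^ 'n \<Rightarrow> real ^ 'n" where
  "abs_vec x = (\<chi> i. \<bar>x $ i\<bar>)"

lemma proj_on_nth [simp]: "proj_on I x $ i = (if i \<in> I then x $ i else 0)"
  by (simp add: proj_on_def)

lemma abs_vec_nth [simp]: "abs_vec x $ i = \<bar>x $ i\<bar>"
  by (simp add: abs_vec_def)

lemma reflect_coord_nth [simp]: "reflect_coord i x $ j = (if j = i then - x $ j else x $ j)"
  by (simp add: reflect_coord_def)

lemma proj_on_coord [simp]: "proj_on I x \<in> coord_subspace I"
  by (simp add: coord_subspace_def)

lemma inner_proj_on: "x \<bullet> proj_on I y = proj_on I x \<bullet> proj_on I y"
  by (auto simp: inner_vec_def intro!: sum.cong)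

lemma invariant_abs_vec:
  fixes x :: "real ^ 'n"
  assumes inv: "\<And>i x. f (reflect_coord i x) = f x"
  shows "f (abs_vec x) = f x"
proof -
  have "f (\<chi> j. if j \<in> J then \<bar>x $ j\<bar> else x $ j) = f x" if "finite J" for J
    using that
  proof (induction J)
    case empty
    then show ?case by simp
  next
    case (insert k J)
    let ?y = "\<chi> j. if j \<in> J then \<bar>x $ j\<bar> else x $ j"
    have "(\<chi> j. if j \<in> insert k J then \<bar>x $ j\<bar> else x $ j) = (if x $ k \<ge> 0 then ?y else reflect_coord k ?y)"
      using insert by (auto simp: vec_eq_iff)
    then show ?case using insert inv by (auto split: if_splits)
  qed
  from this[of UNIV] show ?thesis by (simp add: abs_vec_def)
qed

lemma dual_pairD:
  assumes "dual_pair I p q"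
  shows "continuous_on UNIV p" "0 \<le> p x" "p (reflect_coord i x) = p x"
    "x \<in> coord_subspace I \<Longrightarrow> \<xi> \<in> coord_subspace I \<Longrightarrow> x \<bullet> \<xi> \<le> p x * q \<xi>"
    "x \<in> coord_subspace I \<Longrightarrow> \<exists>\<xi>\<in>coord_subspace I. q \<xi> \<le> 1 \<and> x \<bullet> \<xi> = p x"
    "p (abs_vec x) = p x"
proof -
  show "p (reflect_coord i x) = p x" for i x
    using assms by (simp add: dual_pair_def gauge_of_polar_def)
  then show "p (abs_vec x) = p x" by (rule invariant_abs_vec)
qed (use assms in \<open>simp_all add: dual_pair_def gauge_of_polar_def\<close>)

lemma dual_pair_le:
  assumes "dual_pair I p q" "x \<in> coord_subspace I" "\<xi> \<in> coord_subspace I" "q \<xi> \<le> 1"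
  shows "x \<bullet> \<xi> \<le> p x"
proof -
  have "x \<bullet> \<xi> \<le> p x * q \<xi>" using dual_pairD(4) assms by blast
  also have "\<dots> \<le> p x * 1" using dual_pairD(2)[OF assms(1)] assms(4) by (intro mult_left_mono)
  finally show ?thesis by simp
qed

lemma dual_pair_measurable:
  "dual_pair I p q \<Longrightarrow> p \<in> borel_measurable borel"
  using dual_pairD(1) borel_measurable_continuous_onI by blast

lemma dual_pair_scale:
  assumes pq: "dual_pair I p q" and x: "x \<in> coord_subspace I" and "0 \<le> t"
  shows "p (t *\<^sub>R x) = t * p x"
proof (rule antisym)
  have tx: "t *\<^sub>R x \<in> coord_subspace I" using x by (simp add: coord_subspace_closed)
  obtain \<xi> where "\<xi> \<in> coord_subspace I" "q \<xi> \<le> 1" "(t *\<^sub>R x) \<bullet> \<xi> = p (t *\<^sub>R x)"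
    using dual_pairD(5)[OF pq tx] by blast
  moreover from this have "x \<bullet> \<xi> \<le> p x"
    using dual_pair_le[OF pq] x by blast
  ultimately show "p (t *\<^sub>R x) \<le> t * p x"
    using \<open>0 \<le> t\<close> by (metis inner_scaleR_left mult_left_mono)
  obtain \<xi> where "\<xi> \<in> coord_subspace I" "q \<xi> \<le> 1" "x \<bullet> \<xi> = p x"
    using dual_pairD(5)[OF pq x] by blast
  moreover from this have "(t *\<^sub>R x) \<bullet> \<xi> \<le> p (t *\<^sub>R x)"
    using dual_pair_le[OF pq] tx by blast
  ultimately show "t * p x \<le> p (t *\<^sub>R x)" by simp
qed

lemma dual_pair_zero: "dual_pair I p q \<Longrightarrow> p 0 = 0"
  using dual_pair_scale[of I p q 0 0] by (simp add: coord_subspace_closed)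

lemma dual_pair_add:
  assumes pq: "dual_pair I p q" and x: "x \<in> coord_subspace I" "y \<in> coord_subspace I"
  shows "p (x + y) \<le> p x + p y"
proof -
  obtain \<xi> where xi: "\<xi> \<in> coord_subspace I" "q \<xi> \<le> 1" "(x + y) \<bullet> \<xi> = p (x + y)"
    using dual_pairD(5)[OF pq, of "x + y"] x by (auto simp: coord_subspace_closed)
  have "x \<bullet> \<xi> \<le> p x" "y \<bullet> \<xi> \<le> p y"
    using dual_pair_le[OF pq] x xi by blast+
  with xi(3) show ?thesis by (simp add: inner_add_left)
qed

text \<open>
Replacing a norming functional by its coordinatewise absolute value does not change its gauge, by
reflection invariance. So functionals may be assumed to have nonnegative coordinates.
\<close>

lemma dual_pair_mono:
  assumes pq: "dual_pair I p q" and x: "x \<in> coord_subspace I" "y \<in> coord_subspace I"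
    and le: "\<And>i. \<bar>x $ i\<bar> \<le> \<bar>y $ i\<bar>"
  shows "p x \<le> p y"
proof -
  obtain \<xi> where xi: "\<xi> \<in> coord_subspace I" "q \<xi> \<le> 1" "x \<bullet> \<xi> = p x"
    using dual_pairD(5)[OF pq x(1)] by blast
  have "x \<bullet> \<xi> \<le> abs_vec y \<bullet> abs_vec \<xi>"
    unfolding inner_vec_def
  proof (intro sum_mono)
    fix i
    have "x $ i * \<xi> $ i \<le> \<bar>x $ i\<bar> * \<bar>\<xi> $ i\<bar>" by (metis abs_ge_self abs_mult)
    also have "\<dots> \<le> \<bar>y $ i\<bar> * \<bar>\<xi> $ i\<bar>" using le by (intro mult_right_mono) auto
    finally show "x $ i \<bullet> \<xi> $ i \<le> abs_vec y $ i \<bullet> abs_vec \<xi> $ i" by simp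
  qed
  also have "\<dots> \<le> p (abs_vec y) * q (abs_vec \<xi>)"
    by (rule dual_pairD(4)[OF pq]) (use x xi in \<open>auto simp: coord_subspace_def\<close>)
  also have "\<dots> = p y * q \<xi>"
    using dual_pairD(6)[OF pq] dual_pairD(6)[OF dual_pair_sym[OF pq]] by simp
  also have "\<dots> \<le> p y * 1"
    using dual_pairD(2)[OF pq] xi by (intro mult_left_mono) auto
  finally show ?thesis using xi by simp
qed

lemma dual_pair_unit_pos:
  assumes pq: "dual_pair I p q" and "i \<in> I"
  shows "p (unit_vec i) > 0"
proof -
  have "1 \<le> p (unit_vec i) * q (unit_vec i)"
    using dual_pairD(4)[OF pq, of "unit_vec i" "unit_vec i"] \<open>i \<in> I\<close>
    by (simp add: coord_subspace_closed inner_axis_axis)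
  then show ?thesis
    using dual_pairD(2)[OF pq, of "unit_vec i"] by (cases "p (unit_vec i) = 0") auto
qed

text \<open>
For an unconditional body, section and projection by a coordinate subspace agree, so duality
survives the restriction to coordinates in \<open>I\<close>.
\<close>

lemma dual_pair_restrict:
  fixes p q :: "real ^ 'n \<Rightarrow> real"
  assumes pq: "dual_pair UNIV p q"
  shows "dual_pair I p q"
proof -
  have "gauge_of_polar I p q" if pq: "dual_pair UNIV p q" for p q :: "real ^ 'n \<Rightarrow> real"
    unfolding gauge_of_polar_def
  proof (intro conjI ballI allI)
    fix x :: "real ^ 'n" assume x: "x \<in> coord_subspace I"
    obtain \<xi> where xi: "q \<xi> \<le> 1" "x \<bullet> \<xi> = p x"
      using dual_pairD(5)[OF pq, of x] by auto
    have "q (proj_on I \<xi>) \<le> q \<xi>"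
      by (rule dual_pair_mono[OF dual_pair_sym[OF pq]]) auto
    moreover have "x \<bullet> proj_on I \<xi> = x \<bullet> \<xi>"
      using x by (auto simp: coord_subspace_def inner_vec_def intro!: sum.cong)
    ultimately show "\<exists>\<xi>\<in>coord_subspace I. q \<xi> \<le> 1 \<and> x \<bullet> \<xi> = p x"
      using xi by (intro bexI[of _ "proj_on I \<xi>"]) auto
  qed (use dual_pairD[OF pq] in auto)
  then show ?thesis
    using pq dual_pair_sym by (auto simp: dual_pair_def)
qed

section \<open>Laplace integrals of a gauge\<close>

text \<open>
At the origin this is, up to a factorial, a moment of the part of the unit ball of \<open>p\<close> in the
positive orthant of the coordinate subspace spanned by \<open>cs\<close> (see \<open>laplace_eq_unit_ball\<close>). The
exponential makes the moments of an \<open>\<ell>\<^sub>1\<close>-sum factorise and turns subadditivity of \<open>p\<close> into a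
differential inequality.
\<close>

definition laplace :: "'n list \<Rightarrow> (real ^ 'n \<Rightarrow> real) \<Rightarrow> real ^ 'n \<Rightarrow> ennreal" where
  "laplace cs p = ray_ints cs (\<lambda>y. ennreal (exp (- p y)))"

lemma nn_integral_exp_ray:
  assumes "c > 0"
  shows "(\<integral>\<^sup>+s. ennreal (exp (- c * s)) * indicator {0..} s \<partial>lborel) = ennreal (1 / c)"
proof -
  have "(\<integral>\<^sup>+s. ennreal (exp (- c * s)) * indicator {0..} s \<partial>lborel) = ennreal (0 - (- exp (- c * 0) / c))"
  proof (rule nn_integral_FTC_atLeast)
    have "((\<lambda>s. exp (- c * s)) \<longlongrightarrow> 0) at_top"
      by (rule filterlim_compose[OF exp_at_bot], rule filterlim_tendsto_neg_mult_at_bot[OF tendsto_const])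
        (use assms filterlim_ident in auto)
    from tendsto_divide[OF tendsto_minus[OF this] tendsto_const[of c]]
    show "((\<lambda>s. - exp (- c * s) / c) \<longlongrightarrow> 0) at_top"
      using assms by simp
  qed (use assms in \<open>auto intro!: derivative_eq_intros\<close>)
  then show ?thesis by simp
qed

text \<open>
The class of functions bounded by a decaying exponential of the coordinate sum is stable under ray
integration. This gives finiteness of all Laplace integrals at once.
\<close>

lemma ray_ints_exp_bound:
  fixes f :: "real ^ 'n \<Rightarrow> ennreal"
  assumes "c > 0" "B \<ge> 0" "set cs \<subseteq> I"
    and f: "\<And>y. y \<in> coord_subspace I \<Longrightarrow> (\<And>i. 0 \<le> y $ i) \<Longrightarrow> f y \<le> ennreal (B * exp (- c * (\<Sum>i\<in>UNIV. y $ i)))"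
    and "y \<in> coord_subspace I" "\<And>i. 0 \<le> y $ i"
  shows "ray_ints cs f y \<le> ennreal (B / c ^ length cs * exp (- c * (\<Sum>i\<in>UNIV. y $ i)))"
  using assms(3,5,6)
proof (induction cs arbitrary: y)
  case (Cons k cs)
  let ?B = "B / c ^ length cs"
  have B: "?B \<ge> 0" using assms by simp
  have "ray_ints (k # cs) f y \<le> (\<integral>\<^sup>+s. ennreal (?B * exp (- c * (\<Sum>i\<in>UNIV. y $ i))) * (ennreal (exp (- c * s)) * indicator {0..} s) \<partial>lborel)"
    unfolding ray_ints.simps ray_int_def
  proof (intro nn_integral_mono)
    fix s :: real
    have "ray_ints cs f (y + s *\<^sub>R unit_vec k) \<le> ennreal (?B * exp (- c * (\<Sum>i\<in>UNIV. y $ i)) * exp (- c * s))" if "s \<ge> 0"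
    proof -
      have "(\<Sum>i\<in>UNIV. (y + s *\<^sub>R unit_vec k) $ i) = (\<Sum>i\<in>UNIV. y $ i) + s"
      proof -
        have "(y + s *\<^sub>R unit_vec k) $ i = y $ i + (if i = k then s else 0)" for i
          by (simp add: axis_def)
        then show ?thesis by (simp add: sum.distrib)
      qed
      moreover have "ray_ints cs f (y + s *\<^sub>R unit_vec k) \<le> ennreal (?B * exp (- c * (\<Sum>i\<in>UNIV. (y + s *\<^sub>R unit_vec k) $ i)))"
        using Cons.prems that by (intro Cons.IH) (auto simp: coord_subspace_def axis_def)
      ultimately show ?thesis by (simp add: algebra_simps exp_add[symmetric])
    qed
    then show "ray_ints cs f (y + s *\<^sub>R unit_vec k) * indicator {0..} s
      \<le> ennreal (?B * exp (- c * (\<Sum>i\<in>UNIV. y $ i))) * (ennreal (exp (- c * s)) * indicator {0..} s)"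
      using assms(1,2) by (auto simp: indicator_def ennreal_mult[symmetric])
  qed
  also have "\<dots> = ennreal (?B * exp (- c * (\<Sum>i\<in>UNIV. y $ i))) * ennreal (1 / c)"
    by (subst nn_integral_cmult) (use nn_integral_exp_ray[OF \<open>c > 0\<close>] in auto)
  also have "\<dots> = ennreal (B / c ^ length (k # cs) * exp (- c * (\<Sum>i\<in>UNIV. y $ i)))"
    using B \<open>c > 0\<close> by (simp add: ennreal_mult[symmetric] field_simps)
  finally show ?case .
qed (use f in auto)

lemma laplace_finite:
  fixes p :: "real ^ 'n \<Rightarrow> real"
  assumes pq: "dual_pair I p q" and "set cs \<subseteq> I" "y \<in> coord_subspace I" "\<And>i. 0 \<le> y $ i"
  shows "laplace cs p y < \<infinity>"
proof -
  define Q where "Q = 1 + (\<Sum>i\<in>I. q (unit_vec i))"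
  have "Q > 0" using dual_pairD(2)[OF dual_pair_sym[OF pq]] by (simp add: Q_def add_pos_nonneg sum_nonneg)
  have "y $ i \<le> p y * q (unit_vec i)" if "y \<in> coord_subspace I" "i \<in> I" for y i
    using dual_pairD(4)[OF pq, of y "unit_vec i"] that by (simp add: coord_subspace_closed inner_axis)
  then have "(\<Sum>i\<in>UNIV. y $ i) \<le> p y * Q" if "y \<in> coord_subspace I" for y
  proof -
    have "(\<Sum>i\<in>UNIV. y $ i) = (\<Sum>i\<in>I. y $ i)"
      using that by (intro sum.mono_neutral_right) (auto simp: coord_subspace_def)
    also have "\<dots> \<le> (\<Sum>i\<in>I. p y * q (unit_vec i))"
      using that \<open>\<And>y i. _ \<Longrightarrow> _ \<Longrightarrow> y $ i \<le> p y * q (unit_vec i)\<close> by (intro sum_mono) auto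
    also have "\<dots> \<le> p y * Q"
      using dual_pairD(2)[OF pq, of y] by (simp add: Q_def sum_distrib_left algebra_simps)
    finally show ?thesis .
  qed
  then have bound: "(1 / Q) * (\<Sum>i\<in>UNIV. y $ i) \<le> p y" if "y \<in> coord_subspace I" for y
    using that \<open>Q > 0\<close> by (simp add: field_simps)
  have "laplace cs p y \<le> ennreal (1 / (1 / Q) ^ length cs * exp (- (1 / Q) * (\<Sum>i\<in>UNIV. y $ i)))"
    unfolding laplace_def
    by (rule ray_ints_exp_bound[where I = I]) (use assms bound \<open>Q > 0\<close> in \<open>auto intro!: ennreal_leI\<close>)
  also have "\<dots> < \<infinity>" by simp
  finally show ?thesis .
qed

section \<open>The derivative bound\<close>

text \<open>
This is the integrated form of \<open>\<phi>' \<le> - exp (- h) s\<close> for a function that need not be differentiable: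
the hypotheses give \<open>\<phi> 0 - \<phi> h \<ge> (1 - exp (- h)) s\<close>, which is compared with the lower bound
\<open>\<phi> h \<ge> exp (- h) \<phi> 0\<close>.
\<close>

lemma discrete_decay:
  fixes \<phi> :: "real \<Rightarrow> real"
  assumes lower: "\<And>h. h \<ge> 0 \<Longrightarrow> \<phi> h \<ge> exp (- h) * \<phi> 0"
    and step: "\<And>h \<epsilon>. h \<ge> 0 \<Longrightarrow> \<epsilon> \<ge> 0 \<Longrightarrow> \<phi> h \<ge> \<phi> (h + \<epsilon>) + \<epsilon> * exp (- (h + \<epsilon>)) * s"
    and s: "s \<ge> 0"
  shows "s \<le> \<phi> 0" and "s = \<phi> 0 \<Longrightarrow> h \<ge> 0 \<Longrightarrow> \<phi> h = exp (- h) * \<phi> 0"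
proof -
  have main: "\<phi> h - exp (- h) * s \<le> \<phi> 0 - s" if h: "h \<ge> 0" for h
  proof -
    \<comment> \<open>A step of length \<open>\<epsilon>\<close> costs an error of order \<open>\<epsilon>\<^sup>2\<close>, which disappears when \<open>h\<close> is cut into many steps.\<close>
    have bound: "\<phi> (real n * \<epsilon>) - exp (- (real n * \<epsilon>)) * s \<le> \<phi> 0 - s + real n * (s * \<epsilon>\<^sup>2)"
      if e: "0 \<le> \<epsilon>" "\<epsilon> \<le> 1" for n \<epsilon>
    proof (induction n)
      case (Suc n)
      let ?h = "real n * \<epsilon>"
      have eq: "exp (- ?h) = exp (- (?h + \<epsilon>)) * exp \<epsilon>" by (simp add: exp_add[symmetric])
      have "\<phi> (?h + \<epsilon>) - exp (- (?h + \<epsilon>)) * s \<le> \<phi> ?h - exp (- ?h) * s + s * (exp (- (?h + \<epsilon>)) * (exp \<epsilon> - 1 - \<epsilon>))"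
        using step[of ?h \<epsilon>] e unfolding eq by (simp add: algebra_simps)
      also have "exp (- (?h + \<epsilon>)) * (exp \<epsilon> - 1 - \<epsilon>) \<le> 1 * \<epsilon>\<^sup>2"
      proof (rule mult_mono)
        have "0 \<le> ?h + \<epsilon>" using e by (intro add_nonneg_nonneg mult_nonneg_nonneg) auto
        then show "exp (- (?h + \<epsilon>)) \<le> 1" unfolding exp_le_one_iff by linarith
        show "exp \<epsilon> - 1 - \<epsilon> \<le> \<epsilon>\<^sup>2" using exp_bound[OF e] by simp
        show "0 \<le> exp \<epsilon> - 1 - \<epsilon>" using exp_ge_add_one_self[of \<epsilon>] by linarith
      qed simp
      finally have "\<phi> (?h + \<epsilon>) - exp (- (?h + \<epsilon>)) * s \<le> \<phi> ?h - exp (- ?h) * s + s * (1 * \<epsilon>\<^sup>2)"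
        using s by (simp add: mult_left_mono)
      with Suc show ?case by (simp add: algebra_simps)
    qed simp
    have "(\<lambda>n. \<phi> 0 - s + s * h\<^sup>2 / real n) \<longlonglongrightarrow> \<phi> 0 - s + 0"
      by (intro tendsto_add tendsto_const lim_const_over_n)
    moreover have "eventually (\<lambda>n. \<phi> h - exp (- h) * s \<le> \<phi> 0 - s + s * h\<^sup>2 / real n) sequentially"
      using eventually_ge_at_top[of "nat \<lceil>h\<rceil> + 1"]
    proof eventually_elim
      case (elim n)
      then have n: "real n \<ge> h" "n > 0" by linarith+
      have "\<phi> (real n * (h / real n)) - exp (- (real n * (h / real n))) * s
          \<le> \<phi> 0 - s + real n * (s * (h / real n)\<^sup>2)"
        by (rule bound) (use h n in auto)
      then show ?case using n by (simp add: power2_eq_square field_simps)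
    qed
    ultimately show ?thesis
      using tendsto_lowerbound[of _ "\<phi> 0 - s + 0" sequentially] by simp
  qed
  have "exp (- 1) * \<phi> 0 - exp (- 1) * s \<le> \<phi> 0 - s"
    using main[of 1] lower[of 1] by simp
  then have "(1 - exp (- 1)) * s \<le> (1 - exp (- 1)) * \<phi> 0"
    by (simp add: algebra_simps)
  then show "s \<le> \<phi> 0"
    by (subst (asm) mult_le_cancel_left_pos) auto
  show "\<phi> h = exp (- h) * \<phi> 0" if "s = \<phi> 0" "h \<ge> 0"
    using main[OF that(2)] lower[OF that(2)] that(1) by simp
qed

definition pos_orthant :: "(real ^ 'n) set" where
  "pos_orthant = {y. \<forall>i. 0 \<le> y $ i}"

lemma pos_orthant_closed:
  "0 \<in> pos_orthant"
  "x \<in> pos_orthant \<Longrightarrow> y \<in> pos_orthant \<Longrightarrow> x + y \<in> pos_orthant"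
  "0 \<le> c \<Longrightarrow> x \<in> pos_orthant \<Longrightarrow> c *\<^sub>R x \<in> pos_orthant"
  "0 \<le> c \<Longrightarrow> axis i c \<in> pos_orthant"
  "(\<And>j. j \<in> J \<Longrightarrow> f j \<in> pos_orthant) \<Longrightarrow> sum f J \<in> pos_orthant"
  by (auto simp: pos_orthant_def axis_def sum_nonneg)

lemma pos_orthant_step: "y \<in> pos_orthant \<Longrightarrow> 0 \<le> s \<Longrightarrow> y + s *\<^sub>R unit_vec i \<in> pos_orthant"
  by (simp add: pos_orthant_closed)

lemma ray_ints_continuous_pos:
  fixes g :: "real ^ 'n \<Rightarrow> real"
  assumes "isCont g y" "g y > 0" "y \<in> pos_orthant" "y \<in> coord_subspace (set cs)"
  shows "ray_ints cs (\<lambda>y. ennreal (g y)) 0 > 0"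
proof -
  obtain r where r: "r > 0" "\<And>z. dist z y < r \<Longrightarrow> dist (g z) (g y) < g y / 2"
    using assms(1,2) unfolding continuous_at_eps_delta by (metis half_gt_zero)
  have "\<forall>z. dist z (0 + y) < r \<longrightarrow> ennreal (g z) \<ge> ennreal (g y / 2)"
  proof (intro allI impI ennreal_leI)
    fix z assume "dist z (0 + y) < r"
    then have "dist (g z) (g y) < g y / 2" using r(2) by simp
    then show "g y / 2 \<le> g z" unfolding dist_real_def by linarith
  qed
  then have "\<exists>\<delta>>0. \<exists>r>0. \<forall>z. dist z (0 + y) < r \<longrightarrow> ennreal (g z) \<ge> \<delta>"
    using r(1) assms(2) by (intro exI[of _ "ennreal (g y / 2)"]) auto
  then have "\<exists>\<delta>>0. \<exists>r>0. \<forall>z. dist z 0 < r \<longrightarrow> ray_ints cs (\<lambda>y. ennreal (g y)) z \<ge> \<delta>"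
    by (rule ray_ints_pos_near) (use assms in \<open>auto simp: pos_orthant_def coord_subspace_def\<close>)
  then show ?thesis using dist_self by (metis order_less_le_trans)
qed

text \<open>
Real-valued form of the Laplace integral at the origin; it loses nothing for dual pairs, whose
Laplace integrals are finite.
\<close>

definition laplace0 :: "(real ^ 'n \<Rightarrow> real) \<Rightarrow> 'n list \<Rightarrow> real" where
  "laplace0 p cs = enn2real (laplace cs p 0)"

context
  fixes p q :: "real ^ 'n \<Rightarrow> real"
  assumes pq: "dual_pair UNIV p q"
begin

lemma gauge_measurable: "p \<in> borel_measurable borel"
  by (rule dual_pair_measurable[OF pq])

lemma laplace_antimono:
  assumes "y \<in> pos_orthant" "v \<in> pos_orthant"
  shows "laplace cs p (y + v) \<le> laplace cs p y"
proof -
  have "laplace cs p (y + v) = ray_ints cs (\<lambda>y. ennreal (exp (- p (y + v)))) y"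
    unfolding laplace_def by (rule ray_ints_shift[symmetric])
  also have "\<dots> \<le> laplace cs p y"
    unfolding laplace_def
  proof (rule ray_ints_mono_on[where S = pos_orthant])
    fix z :: "real ^ 'n" assume "z \<in> pos_orthant"
    then have "p z \<le> p (z + v)"
      using assms(2) by (intro dual_pair_mono[OF pq]) (auto simp: pos_orthant_def)
    then show "ennreal (exp (- p (z + v))) \<le> ennreal (exp (- p z))" by (simp add: ennreal_leI)
  qed (use assms in \<open>auto intro: pos_orthant_step\<close>)
  finally show ?thesis .
qed

text \<open>
This is subadditivity of \<open>p\<close> in the form \<open>exp (- p (z + v)) \<ge> exp (- h) exp (- p z)\<close>, integrated.
\<close>

lemma laplace_shift_lower:
  assumes "p v \<le> h"
  shows "ennreal (exp (- h)) * laplace cs p y \<le> laplace cs p (y + v)"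
proof -
  note [measurable] = gauge_measurable
  have "ennreal (exp (- h)) * laplace cs p y = ray_ints cs (\<lambda>y. ennreal (exp (- h)) * ennreal (exp (- p y))) y"
    unfolding laplace_def by (subst ray_ints_cmult) auto
  also have "\<dots> \<le> ray_ints cs (\<lambda>y. ennreal (exp (- p (y + v)))) y"
  proof (rule ray_ints_mono_on[where S = UNIV])
    fix z :: "real ^ 'n"
    have "exp (- h) * exp (- p z) \<le> exp (- p (z + v))"
      using dual_pair_add[OF pq, of z v] assms by (simp add: exp_add[symmetric])
    then show "ennreal (exp (- h)) * ennreal (exp (- p z)) \<le> ennreal (exp (- p (z + v)))"
      by (simp add: ennreal_mult[symmetric] ennreal_leI)
  qed auto
  also have "\<dots> = laplace cs p (y + v)"
    unfolding laplace_def by (rule ray_ints_shift)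
  finally show ?thesis .
qed

text \<open>
Since \<open>laplace cs p\<close> is \<open>ray_int j\<close> of \<open>laplace (remove1 j cs) p\<close>, moving the base point by \<open>h\<close> in
direction \<open>j\<close> loses exactly the initial piece of the ray, whose integrand is decreasing.
\<close>

lemma laplace_step:
  assumes "j \<in> set cs" "y \<in> pos_orthant" "0 \<le> h"
  shows "laplace cs p (y + h *\<^sub>R unit_vec j) + ennreal h * laplace (remove1 j cs) p (y + h *\<^sub>R unit_vec j)
    \<le> laplace cs p y"
proof -
  note [measurable] = gauge_measurable
  let ?G = "laplace (remove1 j cs) p"
  have G: "laplace cs p = ray_int j ?G"
    unfolding laplace_def by (rule ray_ints_remove1) (use assms in auto)
  have [measurable]: "?G \<in> borel_measurable borel"
    unfolding laplace_def by measurable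
  have "ennreal h * ?G (y + h *\<^sub>R unit_vec j) = (\<integral>\<^sup>+s. ?G (y + h *\<^sub>R unit_vec j) * indicator {0..<h} s \<partial>lborel)"
    using \<open>0 \<le> h\<close> by (subst nn_integral_cmult_indicator) (auto simp: mult.commute)
  also have "\<dots> \<le> (\<integral>\<^sup>+s. ?G (y + s *\<^sub>R unit_vec j) * indicator {0..<h} s \<partial>lborel)"
  proof (intro nn_integral_mono)
    fix s
    have "?G (y + h *\<^sub>R unit_vec j) \<le> ?G (y + s *\<^sub>R unit_vec j)" if "0 \<le> s" "s < h"
    proof -
      have "?G ((y + s *\<^sub>R unit_vec j) + (h - s) *\<^sub>R unit_vec j) \<le> ?G (y + s *\<^sub>R unit_vec j)"
        by (rule laplace_antimono) (use that assms in \<open>auto intro!: pos_orthant_closed\<close>)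
      then show ?thesis by (simp add: algebra_simps)
    qed
    then show "?G (y + h *\<^sub>R unit_vec j) * indicator {0..<h} s \<le> ?G (y + s *\<^sub>R unit_vec j) * indicator {0..<h} s"
      by (auto simp: indicator_def)
  qed
  finally show ?thesis
    using ray_int_split[of ?G h j y] assms by (simp add: G add.commute add_right_mono)
qed

text \<open>
A general displacement \<open>v\<close> is made one coordinate at a time; monotonicity allows all the losses to be
evaluated at the final point.
\<close>

lemma laplace_telescope:
  assumes "y \<in> pos_orthant" "v \<in> pos_orthant" "v \<in> coord_subspace (set cs)"
  shows "laplace cs p (y + v) + (\<Sum>j\<in>set cs. ennreal (v $ j) * laplace (remove1 j cs) p (y + v)) \<le> laplace cs p y"
proof -
  let ?v = "\<lambda>J. \<Sum>j\<in>J. (v $ j) *\<^sub>R (unit_vec j :: real ^ 'n)"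
  have nonneg: "0 \<le> v $ j" for j using assms(2) by (simp add: pos_orthant_def)
  have "laplace cs p (y + ?v J) + (\<Sum>j\<in>J. ennreal (v $ j) * laplace (remove1 j cs) p (y + ?v J)) \<le> laplace cs p y"
    if "finite J" "J \<subseteq> set cs" for J
    using that
  proof (induction J)
    case (insert k J)
    have J: "y + ?v J \<in> pos_orthant"
      using assms(1) nonneg by (auto intro!: pos_orthant_closed)
    have eq: "y + ?v (insert k J) = y + ?v J + (v $ k) *\<^sub>R unit_vec k"
      using insert by (simp add: algebra_simps)
    have "laplace (remove1 j cs) p (y + ?v (insert k J)) \<le> laplace (remove1 j cs) p (y + ?v J)" for j
      unfolding eq by (rule laplace_antimono[OF J]) (use nonneg in \<open>auto intro!: pos_orthant_closed\<close>)
    then have "(\<Sum>j\<in>J. ennreal (v $ j) * laplace (remove1 j cs) p (y + ?v (insert k J)))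
      \<le> (\<Sum>j\<in>J. ennreal (v $ j) * laplace (remove1 j cs) p (y + ?v J))"
      by (intro sum_mono mult_left_mono) auto
    moreover have "laplace cs p (y + ?v (insert k J)) + ennreal (v $ k) * laplace (remove1 k cs) p (y + ?v (insert k J))
      \<le> laplace cs p (y + ?v J)"
      unfolding eq by (rule laplace_step) (use insert J nonneg in auto)
    ultimately have "laplace cs p (y + ?v (insert k J)) + ennreal (v $ k) * laplace (remove1 k cs) p (y + ?v (insert k J))
      + (\<Sum>j\<in>J. ennreal (v $ j) * laplace (remove1 j cs) p (y + ?v (insert k J))) \<le>
      laplace cs p (y + ?v J) + (\<Sum>j\<in>J. ennreal (v $ j) * laplace (remove1 j cs) p (y + ?v J))"
      by (rule add_mono[rotated])
    also have "\<dots> \<le> laplace cs p y" using insert by simp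
    finally show ?case using insert by (simp add: add.assoc)
  qed simp
  from this[of "set cs"] moreover have "?v (set cs) = v"
  proof -
    have "?v (set cs) $ i = (\<Sum>j\<in>set cs. if j = i then v $ i else 0)" for i
      unfolding sum_component by (rule sum.cong) (auto simp: axis_def)
    then show ?thesis
      using assms(3) by (auto simp: vec_eq_iff coord_subspace_def)
  qed
  ultimately show ?thesis by simp
qed

lemma laplace_fin: "y \<in> pos_orthant \<Longrightarrow> laplace cs p y < \<infinity>"
  by (rule laplace_finite[OF pq]) (auto simp: pos_orthant_def)

lemma laplace0_eq: "laplace cs p 0 = ennreal (laplace0 p cs)"
  using laplace_fin[OF pos_orthant_closed(1)] by (simp add: laplace0_def)

lemma laplace0_pos: "laplace0 p cs > 0"
proof -
  have "isCont p 0" using dual_pairD(1)[OF pq] by (simp add: continuous_on_eq_continuous_at)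
  then have "isCont (\<lambda>y. exp (- p y)) 0" by (intro continuous_intros)
  then have "laplace cs p 0 > 0"
    unfolding laplace_def
    by (rule ray_ints_continuous_pos) (simp_all add: pos_orthant_closed coord_subspace_closed)
  then show ?thesis by (simp add: laplace0_eq)
qed

text \<open>
This is the analytic core, a weighted form of Meyer's estimate of the volume of an unconditional body
by the cones from an interior point over its coordinate sections. Along the ray through \<open>x\<close> the
function \<open>laplace cs p\<close> decreases at rate at least the sum of \<open>x\<^sub>j\<close> times the integral with \<open>j\<close>
removed, while \<open>p x \<le> 1\<close> prevents it from decreasing faster than an exponential.

If the two rates agree, then \<open>exp (- p (y + h x))\<close> and \<open>exp (- h - p y)\<close> have the same integral. The
first is never smaller than the second, so by continuity they agree at every \<open>y\<close> that the integral
samples: \<open>p\<close> is additive with \<open>x\<close>.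
\<close>

lemma laplace_derivative_bound:
  assumes x: "x \<in> pos_orthant" "x \<in> coord_subspace (set cs)" "p x \<le> 1"
  defines "s \<equiv> \<Sum>j\<in>set cs. x $ j * laplace0 p (remove1 j cs)"
  shows "s \<le> laplace0 p cs"
    and "s = laplace0 p cs \<Longrightarrow> y \<in> pos_orthant \<Longrightarrow> y \<in> coord_subspace (set cs) \<Longrightarrow> 0 \<le> h
      \<Longrightarrow> p (y + h *\<^sub>R x) = p y + h"
proof -
  note [measurable] = gauge_measurable
  define \<phi> where "\<phi> h = enn2real (laplace cs p (h *\<^sub>R x))" for h
  have x_nonneg: "0 \<le> x $ j" for j using x by (simp add: pos_orthant_def)
  have hx: "h *\<^sub>R x \<in> pos_orthant" if "0 \<le> h" for h
    using x that by (simp add: pos_orthant_closed)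
  have \<phi>: "laplace cs p (h *\<^sub>R x) = ennreal (\<phi> h)" if "0 \<le> h" for h
    using laplace_fin[OF hx[OF that]] by (simp add: \<phi>_def)
  have \<phi>0: "\<phi> 0 = laplace0 p cs" by (simp add: \<phi>_def laplace0_def)
  have phx: "p (h *\<^sub>R x) \<le> h" if "0 \<le> h" for h
    using dual_pair_scale[OF pq, of x h] that x(3) by (simp add: mult_left_le)
  have \<phi>_nonneg: "0 \<le> \<phi> h" for h by (simp add: \<phi>_def)
  have lower: "\<phi> h \<ge> exp (- h) * \<phi> 0" if "h \<ge> 0" for h
    using laplace_shift_lower[OF phx[OF that], of cs 0] \<phi>[OF that] \<phi>[of 0] \<phi>_nonneg[of 0]
    by (simp add: ennreal_mult[symmetric] \<phi>_nonneg)
  have s0: "0 \<le> s"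
    unfolding s_def using x_nonneg laplace0_pos by (intro sum_nonneg mult_nonneg_nonneg) (auto intro: less_imp_le)
  have step: "\<phi> h \<ge> \<phi> (h + \<epsilon>) + \<epsilon> * exp (- (h + \<epsilon>)) * s" if "h \<ge> 0" "\<epsilon> \<ge> 0" for h \<epsilon>
  proof -
    let ?E = "exp (- (h + \<epsilon>))"
    have ge: "ennreal (\<epsilon> * ?E * (x $ j * laplace0 p (remove1 j cs))) \<le>
        ennreal ((\<epsilon> *\<^sub>R x) $ j) * laplace (remove1 j cs) p (h *\<^sub>R x + \<epsilon> *\<^sub>R x)" for j
    proof -
      have "ennreal ?E * laplace (remove1 j cs) p 0 \<le> laplace (remove1 j cs) p (0 + (h + \<epsilon>) *\<^sub>R x)"
        by (rule laplace_shift_lower) (use phx that in simp)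
      then have "ennreal (?E * laplace0 p (remove1 j cs)) \<le> laplace (remove1 j cs) p (h *\<^sub>R x + \<epsilon> *\<^sub>R x)"
        by (simp add: laplace0_eq ennreal_mult[symmetric] laplace0_pos[THEN less_imp_le] scaleR_add_left)
      then have "ennreal (\<epsilon> * x $ j) * ennreal (?E * laplace0 p (remove1 j cs)) \<le>
          ennreal (\<epsilon> * x $ j) * laplace (remove1 j cs) p (h *\<^sub>R x + \<epsilon> *\<^sub>R x)"
        by (rule mult_left_mono) simp
      then show ?thesis
        using that x_nonneg[of j] laplace0_pos[of "remove1 j cs"]
        by (simp add: ennreal_mult[symmetric] mult_ac)
    qed
    have "ennreal (\<phi> (h + \<epsilon>) + \<epsilon> * ?E * s) = ennreal (\<phi> (h + \<epsilon>)) + (\<Sum>j\<in>set cs. ennreal (\<epsilon> * ?E * (x $ j * laplace0 p (remove1 j cs))))"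
    proof -
      have nn: "0 \<le> \<epsilon> * ?E * (x $ j * laplace0 p (remove1 j cs))" for j
        using that x_nonneg laplace0_pos[THEN less_imp_le] by simp
      have "ennreal (\<phi> (h + \<epsilon>) + \<epsilon> * ?E * s) = ennreal (\<phi> (h + \<epsilon>)) + ennreal (\<Sum>j\<in>set cs. \<epsilon> * ?E * (x $ j * laplace0 p (remove1 j cs)))"
        unfolding s_def sum_distrib_left by (rule ennreal_plus[OF \<phi>_nonneg sum_nonneg[OF nn]])
      then show ?thesis using nn by (simp add: sum_ennreal)
    qed
    also have "\<dots> \<le> laplace cs p (h *\<^sub>R x + \<epsilon> *\<^sub>R x)
        + (\<Sum>j\<in>set cs. ennreal ((\<epsilon> *\<^sub>R x) $ j) * laplace (remove1 j cs) p (h *\<^sub>R x + \<epsilon> *\<^sub>R x))"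
    proof (intro add_mono sum_mono ge)
      show "ennreal (\<phi> (h + \<epsilon>)) \<le> laplace cs p (h *\<^sub>R x + \<epsilon> *\<^sub>R x)"
        using \<phi>[of "h + \<epsilon>"] that by (simp add: scaleR_add_left)
    qed
    also have "\<dots> \<le> laplace cs p (h *\<^sub>R x)"
      by (rule laplace_telescope) (use hx x that in \<open>auto simp: coord_subspace_closed\<close>)
    also have "\<dots> = ennreal (\<phi> h)" using \<phi> that by simp
    finally show ?thesis using \<phi>_nonneg by simp
  qed
  show "s \<le> laplace0 p cs" using discrete_decay(1)[of \<phi> s] lower step s0 \<phi>0 by auto
  show "p (y + h *\<^sub>R x) = p y + h"
    if eq: "s = laplace0 p cs" and y: "y \<in> pos_orthant" "y \<in> coord_subspace (set cs)" and h: "0 \<le> h"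
  proof (rule ccontr)
    assume ne: "p (y + h *\<^sub>R x) \<noteq> p y + h"
    define D where "D y = exp (- p (y + h *\<^sub>R x)) - exp (- h - p y)" for y
    have le: "p (y + h *\<^sub>R x) \<le> p y + h" for y
      using dual_pair_add[OF pq, of y "h *\<^sub>R x"] phx[OF h] by simp
    then have D0: "D y \<ge> 0" for y by (simp add: D_def algebra_simps)
    have "D y > 0" using le[of y] ne by (simp add: D_def)
    have contp: "continuous_on UNIV (\<lambda>y. p (g y))" if "continuous_on UNIV g" for g :: "real ^ 'n \<Rightarrow> real ^ 'n"
      using continuous_on_compose2[OF dual_pairD(1)[OF pq] that] by simp
    have contD: "continuous_on UNIV D"
      unfolding D_def by (intro continuous_intros contp)
    then have [measurable]: "D \<in> borel_measurable borel"
      by (rule borel_measurable_continuous_onI)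
    have "ray_ints cs (\<lambda>y. ennreal (exp (- p (y + h *\<^sub>R x)))) 0 =
        ray_ints cs (\<lambda>y. ennreal (D y) + ennreal (exp (- h)) * ennreal (exp (- p y))) 0"
    proof (intro arg_cong[where f = "\<lambda>f. ray_ints cs f 0"] ext)
      fix y
      show "ennreal (exp (- p (y + h *\<^sub>R x))) = ennreal (D y) + ennreal (exp (- h)) * ennreal (exp (- p y))"
        using D0[of y] by (simp add: ennreal_mult[symmetric] ennreal_plus[symmetric] D_def exp_diff exp_minus field_simps del: ennreal_plus)
    qed
    also have "\<dots> = ray_ints cs (\<lambda>y. ennreal (D y)) 0 + ennreal (exp (- h)) * laplace cs p 0"
      by (simp add: ray_ints_add ray_ints_cmult laplace_def)
    finally have "laplace cs p (h *\<^sub>R x) = ray_ints cs (\<lambda>y. ennreal (D y)) 0 + ennreal (exp (- h)) * laplace cs p 0"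
      using ray_ints_shift[of cs "\<lambda>y. ennreal (exp (- p y))" "h *\<^sub>R x" 0] by (simp add: laplace_def)
    moreover have "laplace cs p (h *\<^sub>R x) = ennreal (exp (- h)) * laplace cs p 0"
      using discrete_decay(2)[of \<phi> s h] lower step s0 \<phi>0 eq h \<phi>[OF h] laplace0_pos[of cs]
      by (simp add: laplace0_eq ennreal_mult[symmetric])
    ultimately have "ennreal (exp (- h) * laplace0 p cs) + ray_ints cs (\<lambda>y. ennreal (D y)) 0
        = ennreal (exp (- h) * laplace0 p cs) + 0"
      using laplace0_pos[of cs] by (simp add: laplace0_eq ennreal_mult add.commute)
    then have int0: "ray_ints cs (\<lambda>y. ennreal (D y)) 0 = 0"
      unfolding ennreal_add_left_cancel by simp
    have "isCont D y" using contD by (simp add: continuous_on_eq_continuous_at)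
    then have "ray_ints cs (\<lambda>y. ennreal (D y)) 0 > 0"
      using \<open>D y > 0\<close> y by (rule ray_ints_continuous_pos)
    with int0 show False by simp
  qed
qed

end

section \<open>Products of Laplace integrals of polar bodies\<close>

text \<open>
The number of distinct rearrangements of the list. Sorting these by their first entry gives the
recurrence below, which is the one satisfied, with inequality, by products of Laplace integrals.
\<close>

definition multinomial :: "'n::finite list \<Rightarrow> real" where
  "multinomial cs = fact (length cs) / (\<Prod>i\<in>UNIV. fact (count_list cs i))"

lemma count_list_remove1: "count_list (remove1 j cs) i = (if i = j then count_list cs i - 1 else count_list cs i)"
  by (induction cs) auto

lemma count_list_pos_iff: "0 < count_list cs i \<longleftrightarrow> i \<in> set cs"
  by (induction cs) auto

lemma multinomial_remove1:
  assumes "j \<in> set cs"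
  shows "multinomial (remove1 j cs) = multinomial cs * (real (count_list cs j) / real (length cs))"
proof -
  let ?R = "\<Prod>i\<in>UNIV - {j}. fact (count_list cs i) :: real"
  have pos: "count_list cs j > 0" "length cs > 0"
    using assms by (auto simp: count_list_pos_iff)
  have f: "fact k = real k * fact (k - 1)" if "k > 0" for k
    using that by (cases k) auto
  have "(\<Prod>i\<in>UNIV. fact (count_list cs i)) = fact (count_list cs j) * ?R"
    by (rule prod.remove) auto
  moreover have "(\<Prod>i\<in>UNIV. fact (count_list (remove1 j cs) i)) = fact (count_list cs j - 1) * ?R"
    by (subst prod.remove[of _ j]) (auto simp: count_list_remove1)
  moreover have "length (remove1 j cs) = length cs - 1"
    using assms by (simp add: length_remove1)
  moreover have "?R \<noteq> 0" by simp
  ultimately show ?thesis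
    using pos by (simp add: multinomial_def f[OF pos(1)] f[OF pos(2)] field_simps)
qed

lemma multinomial_pos: "multinomial cs > 0"
  by (auto simp: multinomial_def intro!: divide_pos_pos prod_pos)

lemma multinomial_recurrence:
  assumes "cs \<noteq> []"
  shows "(\<Sum>j\<in>set cs. multinomial (remove1 j cs)) = multinomial cs"
proof -
  have "(\<Sum>j\<in>set cs. multinomial (remove1 j cs)) =
      (\<Sum>j\<in>set cs. multinomial cs * (real (count_list cs j) / real (length cs)))"
    by (rule sum.cong) (auto simp: multinomial_remove1)
  also have "\<dots> = multinomial cs * (real (\<Sum>j\<in>set cs. count_list cs j) / real (length cs))"
    by (simp add: sum_distrib_left sum_divide_distrib)
  also have "(\<Sum>j\<in>set cs. count_list cs j) = length cs"
    by (rule sum_count_set) auto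
  finally show ?thesis using assms by simp
qed

text \<open>
Minus the gradient at the origin of \<open>ln (laplace cs p)\<close>, on the coordinates in \<open>cs\<close>.
\<close>

definition log_gradient :: "(real ^ 'n \<Rightarrow> real) \<Rightarrow> 'n list \<Rightarrow> real ^ 'n" where
  "log_gradient p cs = (\<chi> j. if j \<in> set cs then laplace0 p (remove1 j cs) / laplace0 p cs else 0)"

lemma log_gradient_coord: "log_gradient p cs \<in> coord_subspace (set cs)"
  by (simp add: log_gradient_def coord_subspace_def)

lemma log_gradient_orthant:
  "dual_pair UNIV p q \<Longrightarrow> log_gradient p cs \<in> pos_orthant"
  using laplace0_pos[THEN less_imp_le]
  by (auto simp: log_gradient_def pos_orthant_def intro!: divide_nonneg_nonneg)

lemma inner_log_gradient:
  assumes "dual_pair UNIV p q" "x \<in> coord_subspace (set cs)"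
  shows "x \<bullet> log_gradient p cs = (\<Sum>j\<in>set cs. x $ j * laplace0 p (remove1 j cs)) / laplace0 p cs"
proof -
  have "x \<bullet> log_gradient p cs = (\<Sum>j\<in>set cs. x $ j * (laplace0 p (remove1 j cs) / laplace0 p cs))"
    unfolding inner_vec_def log_gradient_def
    by (rule sum.mono_neutral_cong_right) auto
  then show ?thesis by (simp add: sum_divide_distrib)
qed

text \<open>
The derivative bound says precisely that pairing this vector with any point of the unit ball of \<open>p\<close>
gives at most 1; by symmetry only points of the positive orthant have to be tested.
\<close>

lemma log_gradient_polar:
  assumes pq: "dual_pair UNIV p q"
  shows "q (log_gradient p cs) \<le> 1"
proof -
  let ?z = "log_gradient p cs"
  obtain x where x: "p x \<le> 1" "?z \<bullet> x = q ?z"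
    using dual_pairD(5)[OF dual_pair_sym[OF pq], of ?z] by auto
  let ?x = "proj_on (set cs) (abs_vec x)"
  have "p ?x \<le> p x" by (rule dual_pair_mono[OF pq]) auto
  then have "?x \<bullet> ?z \<le> 1"
    using laplace_derivative_bound(1)[OF pq, of ?x cs] x(1) laplace0_pos[OF pq, of cs]
    by (simp add: inner_log_gradient[OF pq] pos_orthant_def)
  moreover have "?z \<bullet> x \<le> ?z \<bullet> ?x"
    unfolding inner_vec_def
  proof (intro sum_mono)
    fix i
    have "0 \<le> ?z $ i" using log_gradient_orthant[OF pq] by (auto simp: pos_orthant_def)
    then have "?z $ i * x $ i \<le> ?z $ i * \<bar>x $ i\<bar>" by (intro mult_left_mono) auto
    then show "?z $ i \<bullet> x $ i \<le> ?z $ i \<bullet> ?x $ i"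
      using log_gradient_coord[of p cs] by (auto simp: coord_subspace_def)
  qed
  ultimately show ?thesis using x(2) by (simp add: inner_commute)
qed

lemma inner_log_gradients:
  assumes pq: "dual_pair UNIV p q"
  shows "log_gradient p cs \<bullet> log_gradient q cs =
    (\<Sum>j\<in>set cs. laplace0 p (remove1 j cs) * laplace0 q (remove1 j cs)) / (laplace0 p cs * laplace0 q cs)"
  unfolding inner_log_gradient[OF dual_pair_sym[OF pq] log_gradient_coord]
  by (simp add: log_gradient_def sum_divide_distrib)

text \<open>
The log gradients of \<open>p\<close> and of \<open>q\<close> lie in polar bodies, so their inner product is at most 1.
\<close>

lemma laplace_product_recurrence:
  assumes pq: "dual_pair UNIV p q"
  shows "(\<Sum>j\<in>set cs. laplace0 p (remove1 j cs) * laplace0 q (remove1 j cs)) \<le> laplace0 p cs * laplace0 q cs"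
proof -
  have pos: "laplace0 p cs * laplace0 q cs > 0"
    using laplace0_pos[OF pq] laplace0_pos[OF dual_pair_sym[OF pq]] by simp
  have "log_gradient p cs \<bullet> log_gradient q cs \<le> p (log_gradient q cs)"
    using dual_pair_le[OF pq, of "log_gradient q cs" "log_gradient p cs"] log_gradient_polar[OF pq]
    by (simp add: inner_commute)
  also have "\<dots> \<le> 1" by (rule log_gradient_polar[OF dual_pair_sym[OF pq]])
  finally show ?thesis using pos by (simp add: inner_log_gradients[OF pq])
qed

theorem laplace_product_ge:
  assumes pq: "dual_pair UNIV p q"
  shows "multinomial cs \<le> laplace0 p cs * laplace0 q cs"
proof (induction "length cs" arbitrary: cs)
  case 0
  have "p 0 = 0" "q 0 = 0"
    using dual_pair_zero pq dual_pair_sym by blast+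
  with 0 show ?case by (simp add: laplace0_def laplace_def multinomial_def)
next
  case (Suc n)
  then have "cs \<noteq> []" by auto
  have "multinomial cs = (\<Sum>j\<in>set cs. multinomial (remove1 j cs))"
    using multinomial_recurrence[OF \<open>cs \<noteq> []\<close>] by simp
  also have "\<dots> \<le> (\<Sum>j\<in>set cs. laplace0 p (remove1 j cs) * laplace0 q (remove1 j cs))"
    by (intro sum_mono Suc(1)) (use Suc(2) in \<open>auto simp: length_remove1\<close>)
  also have "\<dots> \<le> laplace0 p cs * laplace0 q cs" by (rule laplace_product_recurrence[OF pq])
  finally show ?case .
qed

text \<open>
If the lower bound is attained for \<open>cs\<close>, every inequality in the induction is an equality: the bound
is attained for the lists with one entry removed, and the two log gradients have inner product 1, which is the case
of equality in the derivative bound.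
\<close>

context
  fixes p q :: "real ^ 'n \<Rightarrow> real" and cs :: "'n list"
  assumes pq: "dual_pair UNIV p q" and ne: "cs \<noteq> []"
    and eq: "laplace0 p cs * laplace0 q cs = multinomial cs"
begin

lemma laplace_product_eq_remove1:
  assumes "j \<in> set cs"
  shows "laplace0 p (remove1 j cs) * laplace0 q (remove1 j cs) = multinomial (remove1 j cs)"
proof -
  let ?P = "\<lambda>j. laplace0 p (remove1 j cs) * laplace0 q (remove1 j cs)"
  have ge: "?P j - multinomial (remove1 j cs) \<ge> 0" for j
    using laplace_product_ge[OF pq] by simp
  have "(\<Sum>j\<in>set cs. ?P j - multinomial (remove1 j cs)) \<le> 0"
    using laplace_product_recurrence[OF pq, of cs] multinomial_recurrence[OF ne] eq
    by (simp add: sum_subtractf)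
  then have "(\<Sum>j\<in>set cs. ?P j - multinomial (remove1 j cs)) = 0"
    using ge by (intro antisym sum_nonneg) auto
  then have "?P j - multinomial (remove1 j cs) = 0"
    using ge assms by (subst (asm) sum_nonneg_eq_0_iff) auto
  then show ?thesis by simp
qed

lemma log_gradient_mult:
  "log_gradient p cs $ j * log_gradient q cs $ j = real (count_list cs j) / real (length cs)"
proof (cases "j \<in> set cs")
  case True
  have "log_gradient p cs $ j * log_gradient q cs $ j = multinomial (remove1 j cs) / multinomial cs"
    using True laplace_product_eq_remove1[OF True] eq by (simp add: log_gradient_def)
  also have "\<dots> = real (count_list cs j) / real (length cs)"
    using multinomial_pos[of cs] by (simp add: multinomial_remove1[OF True])
  finally show ?thesis .
next
  case False
  then have "count_list cs j = 0" using count_list_pos_iff[of cs j] by simp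
  with False show ?thesis by (simp add: log_gradient_def)
qed

lemma log_gradient_additive:
  assumes "y \<in> pos_orthant" "y \<in> coord_subspace (set cs)" "0 \<le> h"
  shows "p (y + h *\<^sub>R log_gradient q cs) = p y + h"
proof (rule laplace_derivative_bound(2)[OF pq _ _ _ _ assms])
  let ?x = "log_gradient q cs"
  show "?x \<in> pos_orthant" "?x \<in> coord_subspace (set cs)" "p ?x \<le> 1"
    using log_gradient_orthant log_gradient_coord log_gradient_polar pq dual_pair_sym by blast+
  have "(\<Sum>j\<in>set cs. multinomial (remove1 j cs)) = laplace0 p cs * laplace0 q cs"
    using multinomial_recurrence[OF ne] eq by simp
  then have "(\<Sum>j\<in>set cs. laplace0 p (remove1 j cs) * laplace0 q (remove1 j cs)) = laplace0 p cs * laplace0 q cs"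
    using laplace_product_eq_remove1 by simp
  then have "?x \<bullet> log_gradient p cs = 1"
    using laplace0_pos[OF pq, of cs] laplace0_pos[OF dual_pair_sym[OF pq], of cs]
    by (simp add: inner_commute[of ?x] inner_log_gradients[OF pq])
  then show "(\<Sum>j\<in>set cs. ?x $ j * laplace0 p (remove1 j cs)) = laplace0 p cs"
    using laplace0_pos[OF pq, of cs] by (simp add: inner_log_gradient[OF pq log_gradient_coord] field_simps)
qed

end

section \<open>Additive points of extremal gauges\<close>

text \<open>
For a body of full dimension this turns out to characterise Hanner polytopes: they satisfy it by
\<open>hanner_polytope_extremal\<close>, and \<open>extremal_unit_ball_hanner\<close> is the converse.
\<close>

definition laplace_extremal :: "(real ^ 'n \<Rightarrow> real) \<Rightarrow> (real ^ 'n \<Rightarrow> real) \<Rightarrow> bool" where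
  "laplace_extremal p q \<longleftrightarrow> dual_pair UNIV p q \<and> (\<forall>cs. laplace0 p cs * laplace0 q cs = multinomial cs)"

text \<open>
For the \<open>\<ell>\<^sub>1\<close> norm every point of the simplex has this property; for the maximum norm only the
all-ones vector does.
\<close>

definition additive_point :: "(real ^ 'n \<Rightarrow> real) \<Rightarrow> 'n set \<Rightarrow> real ^ 'n \<Rightarrow> bool" where
  "additive_point p I \<eta> \<longleftrightarrow> \<eta> \<in> pos_orthant \<and> \<eta> \<in> coord_subspace I \<and>
     (\<forall>y\<in>pos_orthant \<inter> coord_subspace I. \<forall>h\<ge>0. p (y + h *\<^sub>R \<eta>) = p y + h)"

lemma laplace_extremal_sym: "laplace_extremal p q \<Longrightarrow> laplace_extremal q p"
  by (auto simp: laplace_extremal_def dual_pair_sym mult.commute)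

lemma laplace_extremal_dual_pair: "laplace_extremal p q \<Longrightarrow> dual_pair UNIV p q"
  by (simp add: laplace_extremal_def)

text \<open>
Additive points of \<open>p\<close> and \<open>q\<close> exist with any prescribed rational coordinatewise product of sum 1:
the log gradients have this property, and the proportions are those of the list. This abundance of
additive points is all that is kept of the analytic information.
\<close>

lemma extremal_factorization:
  assumes "laplace_extremal p q" "cs \<noteq> []"
  shows "\<exists>\<eta> \<xi>. additive_point p (set cs) \<eta> \<and> additive_point q (set cs) \<xi> \<and>
    (\<forall>j. \<eta> $ j * \<xi> $ j = real (count_list cs j) / real (length cs))"
proof (intro exI conjI allI)
  have pq: "dual_pair UNIV p q" and qp: "dual_pair UNIV q p"
    and eq: "laplace0 p cs * laplace0 q cs = multinomial cs"
    using assms(1) by (auto simp: laplace_extremal_def dual_pair_sym)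
  from eq have eq': "laplace0 q cs * laplace0 p cs = multinomial cs" by (simp add: mult.commute)
  show "additive_point p (set cs) (log_gradient q cs)"
    using log_gradient_additive[OF pq assms(2) eq] log_gradient_orthant[OF qp] log_gradient_coord
    by (auto simp: additive_point_def)
  show "additive_point q (set cs) (log_gradient p cs)"
    using log_gradient_additive[OF qp assms(2) eq'] log_gradient_orthant[OF pq] log_gradient_coord
    by (auto simp: additive_point_def)
  show "log_gradient q cs $ j * log_gradient p cs $ j = real (count_list cs j) / real (length cs)" for j
    using log_gradient_mult[OF pq assms(2) eq, of j] by (simp add: mult.commute)
qed

lemma additive_point_gauge_one:
  assumes "dual_pair UNIV p q" "additive_point p I \<eta>"
  shows "p \<eta> = 1"
proof -
  have "p (0 + 1 *\<^sub>R \<eta>) = p 0 + 1"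
    using assms(2) pos_orthant_closed(1) coord_subspace_closed(1)[of I]
    unfolding additive_point_def by (metis IntI zero_le_one)
  then show ?thesis using dual_pair_zero[OF assms(1)] by simp
qed

lemma additive_point_norm_le:
  fixes \<eta> :: "real ^ 'n"
  assumes pq: "dual_pair UNIV p q" and c: "additive_point p I \<eta>"
  shows "norm \<eta> \<le> (\<Sum>i\<in>UNIV. q (unit_vec i))"
proof -
  have "norm \<eta> \<le> (\<Sum>i\<in>UNIV. \<bar>\<eta> $ i\<bar>)" by (rule norm_le_l1_cart)
  also have "\<dots> \<le> (\<Sum>i\<in>UNIV. q (unit_vec i))"
  proof (rule sum_mono)
    fix i
    have "\<eta> $ i \<le> p \<eta> * q (unit_vec i)"
      using dual_pairD(4)[OF pq, of \<eta> "unit_vec i"] by (simp add: inner_axis)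
    then show "\<bar>\<eta> $ i\<bar> \<le> q (unit_vec i)"
      using additive_point_gauge_one[OF pq c] c by (simp add: additive_point_def pos_orthant_def)
  qed
  finally show ?thesis .
qed

lemma additive_point_limit:
  assumes pq: "dual_pair UNIV p q" and c: "\<And>n. additive_point p I (f n)" and lim: "f \<longlonglongrightarrow> \<eta>"
  shows "additive_point p I \<eta>"
  unfolding additive_point_def
proof (intro conjI ballI allI impI)
  have comp: "(\<lambda>n. f n $ i) \<longlonglongrightarrow> \<eta> $ i" for i
    using lim by (intro tendsto_intros)
  have "0 \<le> \<eta> $ i" for i
    by (rule LIMSEQ_le_const[OF comp]) (use c in \<open>auto simp: additive_point_def pos_orthant_def\<close>)
  then show "\<eta> \<in> pos_orthant" by (simp add: pos_orthant_def)
  have "\<eta> $ i = 0" if "i \<notin> I" for i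
  proof (rule LIMSEQ_unique[OF comp])
    have "(\<lambda>n. f n $ i) = (\<lambda>n. 0)" using c that by (auto simp: additive_point_def coord_subspace_def)
    then show "(\<lambda>n. f n $ i) \<longlonglongrightarrow> 0" by simp
  qed
  then show "\<eta> \<in> coord_subspace I" by (simp add: coord_subspace_def)
  fix y and h :: real assume y: "y \<in> pos_orthant \<inter> coord_subspace I" "0 \<le> h"
  have "(\<lambda>n. p (y + h *\<^sub>R f n)) \<longlonglongrightarrow> p (y + h *\<^sub>R \<eta>)"
    by (rule continuous_on_tendsto_compose[OF dual_pairD(1)[OF pq]]) (auto intro!: tendsto_intros lim)
  moreover have "(\<lambda>n. p (y + h *\<^sub>R f n)) = (\<lambda>n. p y + h)"
    using c y by (auto simp: additive_point_def)
  ultimately show "p (y + h *\<^sub>R \<eta>) = p y + h"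
    by (simp add: LIMSEQ_const_iff)
qed

text \<open>
Let the proportions in \<open>extremal_factorization\<close> concentrate at \<open>i\<close>. Additive points form a closed
bounded set, so a limit exists along a subsequence.
\<close>

lemma extremal_vertex_points:
  fixes p q :: "real ^ 'n \<Rightarrow> real"
  assumes ext: "laplace_extremal p q" and "i \<in> I"
  shows "\<exists>\<eta> \<xi>. additive_point p I \<eta> \<and> additive_point q I \<xi> \<and> \<eta> $ i * \<xi> $ i = 1 \<and> (\<forall>j. j \<noteq> i \<longrightarrow> \<eta> $ j * \<xi> $ j = 0)"
proof -
  have pq: "dual_pair UNIV p q" and qp: "dual_pair UNIV q p"
    using ext by (auto simp: laplace_extremal_def dual_pair_sym)
  obtain ds where ds: "set ds = I" "distinct ds"
    using finite_distinct_list[of I] by auto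
  \<comment> \<open>The \<open>n\<close> additional copies of \<open>i\<close> make its proportion tend to 1.\<close>
  define cs where "cs n = replicate n i @ ds" for n
  have set_cs: "set (cs n) = I" and ne: "cs n \<noteq> []" for n
    using ds \<open>i \<in> I\<close> by (auto simp: cs_def)
  have cnt: "count_list (cs n) j = (if j = i then n else 0) + count_list ds j" for n j
    by (induction n) (auto simp: cs_def)
  have len: "length (cs n) = n + length ds" for n by (simp add: cs_def)
  have "\<forall>n. \<exists>x. additive_point p I (fst x) \<and> additive_point q I (snd x) \<and>
    (\<forall>j. fst x $ j * snd x $ j = real (count_list (cs n) j) / real (length (cs n)))"
    using extremal_factorization[OF ext ne] unfolding set_cs by simp
  then obtain f where f: "\<And>n. additive_point p I (fst (f n))" "\<And>n. additive_point q I (snd (f n))"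
    "\<And>n j. fst (f n) $ j * snd (f n) $ j = real (count_list (cs n) j) / real (length (cs n))"
    by metis
  have "range f \<subseteq> cball 0 (\<Sum>i\<in>UNIV. q (unit_vec i)) \<times> cball 0 (\<Sum>i\<in>UNIV. p (unit_vec i))"
    using additive_point_norm_le[OF pq f(1)] additive_point_norm_le[OF qp f(2)] by (intro image_subsetI) (simp add: mem_Times_iff)
  then have "bounded (range f)"
    by (rule bounded_subset[OF bounded_Times[OF bounded_cball bounded_cball]])
  then obtain l r where r: "strict_mono r" "(f \<circ> r) \<longlonglongrightarrow> l"
    using bounded_imp_convergent_subsequence by blast
  have l1: "(\<lambda>n. fst (f (r n))) \<longlonglongrightarrow> fst l" and l2: "(\<lambda>n. snd (f (r n))) \<longlonglongrightarrow> snd l"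
    using tendsto_fst[OF r(2)] tendsto_snd[OF r(2)] by (simp_all add: o_def)
  have prod: "(\<lambda>n. fst (f (r n)) $ j * snd (f (r n)) $ j) \<longlonglongrightarrow> fst l $ j * snd l $ j" for j
    by (intro tendsto_intros l1 l2)
  have len_top: "filterlim (\<lambda>n. real n + real (length ds)) at_top sequentially"
    using filterlim_tendsto_add_at_top[OF tendsto_const filterlim_real_sequentially, of "real (length ds)"]
    by (simp add: add.commute)
  have zero: "(\<lambda>n. c / (real n + real (length ds))) \<longlonglongrightarrow> 0" for c
    by (rule real_tendsto_divide_at_top[OF tendsto_const len_top])
  have lens: "length ds > 0" using ds \<open>i \<in> I\<close> by auto
  have lim: "(\<lambda>n. real (count_list (cs n) j) / real (length (cs n))) \<longlonglongrightarrow> (if j = i then 1 else 0)" for j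
  proof (cases "j = i")
    case True
    have "real (count_list (cs n) j) / real (length (cs n)) =
        1 + (real (count_list ds j) - real (length ds)) / (real n + real (length ds))" for n
    proof -
      have "real n + real (length ds) > 0" using lens by linarith
      then show ?thesis using True by (simp add: cnt len field_simps)
    qed
    then show ?thesis using True tendsto_add[OF tendsto_const[of 1] zero] by simp
  next
    case False
    then show ?thesis using zero by (simp add: cnt len)
  qed
  have "fst l $ j * snd l $ j = (if j = i then 1 else 0)" for j
  proof (rule LIMSEQ_unique[OF prod])
    show "(\<lambda>n. fst (f (r n)) $ j * snd (f (r n)) $ j) \<longlonglongrightarrow> (if j = i then 1 else 0)"
      unfolding f(3) using LIMSEQ_subseq_LIMSEQ[OF lim r(1), of j] by (simp add: o_def)
  qed
  moreover have "additive_point p I (fst l)" "additive_point q I (snd l)"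
    using additive_point_limit[OF pq f(1) l1] additive_point_limit[OF qp f(2) l2] by auto
  ultimately show ?thesis by (intro exI[of _ "fst l"] exI[of _ "snd l"]) simp
qed

lemma dual_pair_unit_inverse:
  assumes pq: "dual_pair UNIV p q"
  shows "q (unit_vec i) = 1 / p (unit_vec i)"
proof -
  have qp: "dual_pair UNIV q p" using pq by (rule dual_pair_sym)
  have pos: "p (unit_vec i) > 0" by (rule dual_pair_unit_pos[OF pq]) auto
  have ge: "1 \<le> p (unit_vec i) * q (unit_vec i)"
    using dual_pairD(4)[OF pq, of "unit_vec i" "unit_vec i"] by (simp add: inner_axis_axis)
  obtain \<xi> where xi: "q \<xi> \<le> 1" "unit_vec i \<bullet> \<xi> = p (unit_vec i)"
    using dual_pairD(5)[OF pq, of "unit_vec i"] by auto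
  then have "\<xi> $ i = p (unit_vec i)" by (simp add: inner_axis')
  then have "p (unit_vec i) * q (unit_vec i) = q (\<xi> $ i *\<^sub>R unit_vec i)"
    using dual_pair_scale[OF qp, of "unit_vec i"] pos by simp
  also have "\<dots> \<le> q \<xi>" by (rule dual_pair_mono[OF qp]) (auto simp: axis_def)
  finally show ?thesis using ge xi pos by (simp add: field_simps)
qed

text \<open>
The section of the body by this coordinate plane is a rhombus with its vertices on the axes. These
pairs are the edges of the graph that describes the body.
\<close>

definition additive_pair :: "(real ^ 'n \<Rightarrow> real) \<Rightarrow> 'n \<Rightarrow> 'n \<Rightarrow> bool" where
  "additive_pair p i j \<longleftrightarrow> i \<noteq> j \<and> (\<forall>s\<ge>0. \<forall>t\<ge>0. p (s *\<^sub>R unit_vec i + t *\<^sub>R unit_vec j)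
     = s * p (unit_vec i) + t * p (unit_vec j))"

lemma additive_pair_sym: "additive_pair p i j \<longleftrightarrow> additive_pair p j i"
  unfolding additive_pair_def by (metis add.commute)

lemma axis_additive_point:
  assumes pq: "dual_pair UNIV p q" and c: "additive_point p I \<eta>" and "\<And>j. j \<noteq> i \<Longrightarrow> \<eta> $ j = 0"
    and y: "y \<in> pos_orthant" "y \<in> coord_subspace I" and "0 \<le> s"
  shows "p (y + s *\<^sub>R unit_vec i) = p y + s * p (unit_vec i)"
proof -
  have eta: "\<eta> = \<eta> $ i *\<^sub>R unit_vec i" using assms(3) by (auto simp: vec_eq_iff axis_def)
  have nonneg: "0 \<le> \<eta> $ i" using c by (simp add: additive_point_def pos_orthant_def)
  have pos: "p (unit_vec i) > 0" by (rule dual_pair_unit_pos[OF pq]) auto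
  have "p \<eta> = \<eta> $ i * p (unit_vec i)"
    using dual_pair_scale[OF pq, of "unit_vec i" "\<eta> $ i"] nonneg eta by simp
  then have one: "\<eta> $ i * p (unit_vec i) = 1" using additive_point_gauge_one[OF pq c] by simp
  have "p (y + (s * p (unit_vec i)) *\<^sub>R \<eta>) = p y + s * p (unit_vec i)"
    using c y \<open>0 \<le> s\<close> pos by (auto simp: additive_point_def)
  moreover have "(s * p (unit_vec i)) *\<^sub>R \<eta> = s *\<^sub>R unit_vec i"
    by (subst eta) (use one in \<open>simp add: mult.assoc mult.commute[of _ "\<eta> $ i"]\<close>)
  ultimately show ?thesis by simp
qed

text \<open>
One of the two additive points in the plane of \<open>i\<close> and \<open>j\<close> that concentrate at \<open>i\<close> has to be a multiple
of the unit vector, and additivity with a unit vector determines the gauge on the positive quadrant.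
So every coordinate plane cuts the body in a rhombus or, dually, in a rectangle.
\<close>

lemma extremal_pair:
  assumes ext: "laplace_extremal p q" and "i \<noteq> j"
  shows "additive_pair p i j \<or> additive_pair q i j"
proof -
  have *: "additive_pair p i j" if pq: "dual_pair UNIV p q" and c: "additive_point p {i, j} \<eta>" "\<eta> $ j = 0" for p q \<eta>
    unfolding additive_pair_def
  proof (intro conjI allI impI)
    fix s t :: real assume st: "0 \<le> s" "0 \<le> t"
    have "\<eta> $ k = 0" if "k \<noteq> i" for k
      using c that by (cases "k = j") (auto simp: additive_point_def coord_subspace_def)
    then have "p (t *\<^sub>R unit_vec j + s *\<^sub>R unit_vec i) = p (t *\<^sub>R unit_vec j) + s * p (unit_vec i)"
      using st by (intro axis_additive_point[OF pq c(1)]) (auto simp: pos_orthant_closed coord_subspace_closed)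
    also have "p (t *\<^sub>R unit_vec j) = t * p (unit_vec j)"
      using dual_pair_scale[OF pq] st by simp
    finally show "p (s *\<^sub>R unit_vec i + t *\<^sub>R unit_vec j) = s * p (unit_vec i) + t * p (unit_vec j)"
      by (simp add: add.commute)
  qed (use \<open>i \<noteq> j\<close> in simp)
  obtain \<eta> \<xi> where "additive_point p {i, j} \<eta>" "additive_point q {i, j} \<xi>" "\<eta> $ j * \<xi> $ j = 0"
    using extremal_vertex_points[OF ext, of i "{i, j}"] \<open>i \<noteq> j\<close> by auto
  then show ?thesis
    using * laplace_extremal_dual_pair ext laplace_extremal_sym by (metis mult_eq_0_iff)
qed

definition additive_clique :: "(real ^ 'n \<Rightarrow> real) \<Rightarrow> 'n set \<Rightarrow> bool" where
  "additive_clique p C \<longleftrightarrow> (\<forall>i\<in>C. \<forall>j\<in>C. i \<noteq> j \<longrightarrow> additive_pair p i j)"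

text \<open>
Inside a clique, an additive point with full weight at \<open>i\<close> has no room for another coordinate, since
\<open>p\<close> adds up on pairs. Hence all unit vectors of the clique give additive points.
\<close>

lemma extremal_clique_sum:
  fixes p q :: "real ^ 'n \<Rightarrow> real"
  assumes ext: "laplace_extremal p q" and C: "additive_clique p C"
    and x: "x \<in> pos_orthant" "x \<in> coord_subspace C"
  shows "p x = (\<Sum>i\<in>C. x $ i * p (unit_vec i))"
proof -
  have pq: "dual_pair UNIV p q" and qp: "dual_pair UNIV q p"
    using ext by (auto simp: laplace_extremal_def dual_pair_sym)
  have step: "p (y + s *\<^sub>R unit_vec i) = p y + s * p (unit_vec i)"
    if i: "i \<in> C" and y: "y \<in> pos_orthant" "y \<in> coord_subspace C" "0 \<le> s" for i y s
  proof -
    obtain \<eta> \<xi> where c: "additive_point p C \<eta>" "additive_point q C \<xi>" and one: "\<eta> $ i * \<xi> $ i = 1"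
      using extremal_vertex_points[OF ext i] by auto
    have nn: "0 \<le> \<eta> $ k" "0 \<le> \<xi> $ k" for k using c by (auto simp: additive_point_def pos_orthant_def)
    have pos: "p (unit_vec k) > 0" for k by (rule dual_pair_unit_pos[OF pq]) auto
    have "\<xi> $ i * q (unit_vec i) = q (\<xi> $ i *\<^sub>R unit_vec i)"
      using dual_pair_scale[OF qp] nn by simp
    also have "\<dots> \<le> q \<xi>" by (rule dual_pair_mono[OF qp]) (auto simp: axis_def)
    also have "\<dots> = 1" by (rule additive_point_gauge_one[OF qp c(2)])
    finally have "\<xi> $ i \<le> p (unit_vec i)"
      using pos[of i] by (simp add: dual_pair_unit_inverse[OF pq] field_simps)
    then have "1 \<le> \<eta> $ i * p (unit_vec i)"
      using one nn[of i] by (metis mult_left_mono)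
    moreover have "\<eta> $ i * p (unit_vec i) + \<eta> $ j * p (unit_vec j) \<le> 1" if "j \<noteq> i" "j \<in> C" for j
    proof -
      have "additive_pair p i j" using C i that by (auto simp: additive_clique_def)
      then have "\<eta> $ i * p (unit_vec i) + \<eta> $ j * p (unit_vec j) = p (\<eta> $ i *\<^sub>R unit_vec i + \<eta> $ j *\<^sub>R unit_vec j)"
        using nn by (simp add: additive_pair_def)
      also have "\<dots> \<le> p \<eta>"
        by (rule dual_pair_mono[OF pq]) (use that in \<open>auto simp: axis_def\<close>)
      finally show ?thesis using additive_point_gauge_one[OF pq c(1)] by simp
    qed
    ultimately have "\<eta> $ j * p (unit_vec j) \<le> 0" if "j \<noteq> i" "j \<in> C" for j
      using that by fastforce
    then have "\<eta> $ j = 0" if "j \<noteq> i" for j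
      using that nn[of j] pos[of j] c(1)
      by (cases "j \<in> C") (force simp: mult_le_0_iff additive_point_def coord_subspace_def)+
    then show ?thesis by (rule axis_additive_point[OF pq c(1)]) (use y in auto)
  qed
  have "p (\<Sum>i\<in>J. x $ i *\<^sub>R unit_vec i) = (\<Sum>i\<in>J. x $ i * p (unit_vec i))" if "finite J" "J \<subseteq> C" for J
    using that
  proof (induction J)
    case empty
    then show ?case using dual_pair_zero[OF pq] by simp
  next
    case (insert k J)
    have nn: "0 \<le> x $ i" for i using x by (simp add: pos_orthant_def)
    have "(\<Sum>i\<in>J. x $ i *\<^sub>R (unit_vec i :: real ^ 'n)) \<in> coord_subspace C"
      using insert by (auto simp: coord_subspace_def axis_def intro!: sum.neutral)
    then have "p ((\<Sum>i\<in>J. x $ i *\<^sub>R unit_vec i) + x $ k *\<^sub>R unit_vec k) = p (\<Sum>i\<in>J. x $ i *\<^sub>R unit_vec i) + x $ k * p (unit_vec k)"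
      using insert nn by (intro step) (auto intro!: pos_orthant_closed)
    with insert show ?case by (simp add: add.commute)
  qed
  from this[of C] moreover have "(\<Sum>i\<in>C. x $ i *\<^sub>R unit_vec i) = x"
  proof -
    have "(\<Sum>j\<in>C. x $ j *\<^sub>R (unit_vec j :: real ^ 'n)) $ i = (\<Sum>j\<in>C. if j = i then x $ i else 0)" for i
      unfolding sum_component by (rule sum.cong) (auto simp: axis_def)
    then show ?thesis using x by (auto simp: vec_eq_iff coord_subspace_def)
  qed
  ultimately show ?thesis by simp
qed

lemma extremal_clique_le:
  fixes p q :: "real ^ 'n \<Rightarrow> real"
  assumes ext: "laplace_extremal p q" and C: "additive_clique p C"
  shows "(\<Sum>i\<in>C. \<bar>x $ i\<bar> * p (unit_vec i)) \<le> p x"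
proof -
  have "(\<Sum>i\<in>C. \<bar>x $ i\<bar> * p (unit_vec i)) = p (proj_on C (abs_vec x))"
    by (subst extremal_clique_sum[OF ext C]) (auto simp: pos_orthant_def)
  also have "\<dots> \<le> p x"
    by (rule dual_pair_mono[OF laplace_extremal_dual_pair[OF ext]]) auto
  finally show ?thesis .
qed

section \<open>Exclusion of induced paths with four vertices\<close>

text \<open>
This is where the path with four vertices is perfect as a graph: its clique polytope and that of its
complement are polar to each other.
\<close>

lemma path_bilinear_bound:
  fixes xa xb xc xd ya yb yc yd M :: real
  assumes "xa + xb \<le> M" "xb + xc \<le> M" "xc + xd \<le> M" "0 \<le> xb" "0 \<le> xc"
    and "ya + yc \<le> 1" "ya + yd \<le> 1" "yb + yd \<le> 1" "0 \<le> ya" "0 \<le> yd" "0 \<le> M"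
  shows "xa * ya + xb * yb + xc * yc + xd * yd \<le> M"
proof -
  define u where "u = max (max (yb - ya) (yc - yd)) 0"
  have "xa * ya \<le> (M - xb) * ya" "xd * yd \<le> (M - xc) * yd"
    using assms by (auto intro!: mult_right_mono)
  moreover have "xb * (yb - ya) \<le> xb * u" "xc * (yc - yd) \<le> xc * u"
    using assms by (auto intro!: mult_left_mono simp: u_def)
  moreover have "(xb + xc) * u \<le> M * u"
    using assms by (intro mult_right_mono) (auto simp: u_def)
  moreover have "M * (ya + yd + u) \<le> M * 1"
    using assms by (intro mult_left_mono) (auto simp: u_def)
  ultimately show ?thesis by (simp add: algebra_simps)
qed

definition induced_path4 :: "('n \<Rightarrow> 'n \<Rightarrow> bool) \<Rightarrow> 'n \<Rightarrow> 'n \<Rightarrow> 'n \<Rightarrow> 'n \<Rightarrow> bool" where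
  "induced_path4 A a b c d \<longleftrightarrow> distinct [a, b, c, d] \<and>
     A a b \<and> A b c \<and> A c d \<and> \<not> A a c \<and> \<not> A a d \<and> \<not> A b d"

text \<open>
On the coordinates of an induced path the gauge is the maximum of the three edge sums. At a point where
only one edge attains the maximum, additivity forces the additive point to have weight 1 on that edge.
\<close>

lemma path4_edge_sums:
  fixes p q :: "real ^ 'n \<Rightarrow> real"
  assumes ext: "laplace_extremal p q" and dist: "distinct [a, b, c, d]"
    and A: "additive_pair p a b" "additive_pair p b c" "additive_pair p c d"
    and B: "additive_pair q a c" "additive_pair q a d" "additive_pair q b d"
    and c: "additive_point p {a, b, c, d} \<eta>"
  defines "w \<equiv> \<lambda>i. p (unit_vec i)"
  shows "\<eta> $ a * w a + \<eta> $ b * w b = 1" "\<eta> $ b * w b + \<eta> $ c * w c = 1" "\<eta> $ c * w c + \<eta> $ d * w d = 1"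
proof -
  have pq: "dual_pair UNIV p q" and qp: "dual_pair UNIV q p"
    using ext by (auto simp: laplace_extremal_def dual_pair_sym)
  have w: "w i > 0" for i unfolding w_def by (rule dual_pair_unit_pos[OF pq]) auto
  have qw: "q (unit_vec i) = 1 / w i" for i by (simp add: w_def dual_pair_unit_inverse[OF pq])
  have nn: "0 \<le> \<eta> $ i" for i using c by (simp add: additive_point_def pos_orthant_def)
  have pair: "\<bar>x $ i\<bar> * r (unit_vec i) + \<bar>x $ j\<bar> * r (unit_vec j) \<le> r x"
    if "laplace_extremal r s" "additive_pair r i j" for r s :: "real ^ 'n \<Rightarrow> real" and i j x
  proof -
    have "additive_clique r {i, j}" "i \<noteq> j"
      using that(2) by (auto simp: additive_clique_def additive_pair_sym[of r j i]) (simp add: additive_pair_def)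
    then show ?thesis using extremal_clique_le[OF that(1), of "{i, j}" x] by simp
  qed
  have upper: "p x \<le> M"
    if x: "x \<in> pos_orthant" "x \<in> coord_subspace {a, b, c, d}"
      and M: "x $ a * w a + x $ b * w b \<le> M" "x $ b * w b + x $ c * w c \<le> M" "x $ c * w c + x $ d * w d \<le> M"
    for x M
  proof -
    obtain \<xi> where xi: "q \<xi> \<le> 1" "x \<bullet> \<xi> = p x"
      using dual_pairD(5)[OF pq, of x] by auto
    have xn: "0 \<le> x $ i" for i using x by (simp add: pos_orthant_def)
    have "x \<bullet> \<xi> = (\<Sum>i\<in>{a, b, c, d}. x $ i * \<xi> $ i)"
      unfolding inner_vec_def inner_real_def
      by (rule sum.mono_neutral_right) (use x in \<open>auto simp: coord_subspace_def\<close>)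
    also have "\<dots> \<le> (\<Sum>i\<in>{a, b, c, d}. (x $ i * w i) * (\<bar>\<xi> $ i\<bar> / w i))"
      using w xn by (intro sum_mono) (auto simp: less_imp_neq[symmetric] intro!: mult_left_mono)
    also have "\<dots> = (x $ a * w a) * (\<bar>\<xi> $ a\<bar> / w a) + (x $ b * w b) * (\<bar>\<xi> $ b\<bar> / w b)
        + (x $ c * w c) * (\<bar>\<xi> $ c\<bar> / w c) + (x $ d * w d) * (\<bar>\<xi> $ d\<bar> / w d)"
      using dist by (simp add: add.assoc)
    also have "\<dots> \<le> M"
    proof (rule path_bilinear_bound)
      show "0 \<le> M" using M(1) xn[of a] xn[of b] w[of a] w[of b]
        by (meson add_nonneg_nonneg less_imp_le mult_nonneg_nonneg order_trans)
      note bnd = pair[OF laplace_extremal_sym[OF ext], THEN order_trans, OF _ xi(1), unfolded qw]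
      show "\<bar>\<xi> $ a\<bar> / w a + \<bar>\<xi> $ c\<bar> / w c \<le> 1" "\<bar>\<xi> $ a\<bar> / w a + \<bar>\<xi> $ d\<bar> / w d \<le> 1"
        "\<bar>\<xi> $ b\<bar> / w b + \<bar>\<xi> $ d\<bar> / w d \<le> 1"
        using bnd[OF B(1)] bnd[OF B(2)] bnd[OF B(3)] by simp_all
    qed (use M w xn in \<open>auto simp: less_imp_le\<close>)
    finally show ?thesis using xi(2) by simp
  qed
  have one: "\<eta> $ i * w i \<le> 1" for i
  proof -
    have "\<eta> $ i * w i = p (\<eta> $ i *\<^sub>R unit_vec i)" using dual_pair_scale[OF pq, of "unit_vec i"] nn by (simp add: w_def)
    also have "\<dots> \<le> p \<eta>" by (rule dual_pair_mono[OF pq]) (auto simp: axis_def)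
    finally show ?thesis using additive_point_gauge_one[OF pq c] by simp
  qed
  have main: "\<eta> $ i * w i + \<eta> $ j * w j = 1"
    if ij: "(i, j) \<in> {(a, b), (b, c), (c, d)}" for i j
  proof (rule antisym)
    have Aij: "additive_pair p i j" and ne: "i \<noteq> j" using ij A dist by auto
    show "\<eta> $ i * w i + \<eta> $ j * w j \<le> 1"
      using pair[OF ext Aij, of \<eta>] additive_point_gauge_one[OF pq c] nn by (simp add: w_def)
    let ?y = "(1 / w i) *\<^sub>R unit_vec i + (1 / w j) *\<^sub>R (unit_vec j :: real ^ 'n)"
    \<comment> \<open>A step this short keeps the edge \<open>i j\<close> maximal, since all weighted coordinates of \<open>\<eta>\<close> are at most 1.\<close>
    let ?h = "1 / 2 :: real"
    let ?x = "?y + ?h *\<^sub>R \<eta>"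
    let ?M = "2 + ?h * (\<eta> $ i * w i + \<eta> $ j * w j)"
    have y: "?y \<in> pos_orthant" "?y \<in> coord_subspace {a, b, c, d}"
      using w ij by (auto intro!: pos_orthant_closed coord_subspace_closed simp: less_imp_le)
    have pw: "p (unit_vec k) = w k" for k by (simp add: w_def)
    have "p ?y = (1 / w i) * w i + (1 / w j) * w j"
      using Aij w[of i] w[of j] by (simp add: additive_pair_def pw)
    also have "\<dots> = 2" using w[of i] w[of j] by simp
    finally have "p ?y = 2" .
    have yk: "?x $ k * w k = (if k = i \<or> k = j then 1 else 0) + ?h * (\<eta> $ k * w k)" for k
      using ne w[of k] by (auto simp: axis_def algebra_simps)
    have m: "0 \<le> \<eta> $ k * w k" for k using nn w by (simp add: less_imp_le)
    have "p ?x \<le> ?M"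
    proof (rule upper)
      show "?x \<in> pos_orthant" "?x \<in> coord_subspace {a, b, c, d}"
        using y c by (auto simp: additive_point_def intro!: pos_orthant_closed coord_subspace_closed)
      have le: "?x $ k * w k + ?x $ l * w l \<le> ?M" if kl: "(k, l) = (i, j) \<or> k \<notin> {i, j} \<or> l \<notin> {i, j}" for k l
      proof (cases "(k, l) = (i, j)")
        case True
        then show ?thesis unfolding yk by (simp add: distrib_left)
      next
        case False
        then have cnt: "(if k = i \<or> k = j then 1 else 0) + (if l = i \<or> l = j then 1 else 0) \<le> (1::real)"
          using kl by auto
        have "P + 1 / 2 * u + (Q + 1 / 2 * v) \<le> 2 + 1 / 2 * (r + t)"
          if "P + Q \<le> 1" "u \<le> 1" "v \<le> 1" "0 \<le> r" "0 \<le> t" for P Q u v r t :: real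
          using that by argo
        then show ?thesis unfolding yk using cnt one[of k] one[of l] m[of i] m[of j] by blast
      qed
      show "?x $ a * w a + ?x $ b * w b \<le> ?M" "?x $ b * w b + ?x $ c * w c \<le> ?M" "?x $ c * w c + ?x $ d * w d \<le> ?M"
        by (rule le; use ij dist in force)+
    qed
    moreover have "p ?x = p ?y + ?h" using c y by (auto simp: additive_point_def)
    ultimately show "1 \<le> \<eta> $ i * w i + \<eta> $ j * w j" using \<open>p ?y = 2\<close> by simp
  qed
  show "\<eta> $ a * w a + \<eta> $ b * w b = 1" "\<eta> $ b * w b + \<eta> $ c * w c = 1" "\<eta> $ c * w c + \<eta> $ d * w d = 1"
    using main by auto
qed

text \<open>
The additive points of the path have weighted coordinates \<open>(x, 1 - x, x, 1 - x)\<close>, and those of the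
complementary path \<open>c, a, d, b\<close> have weighted coordinates \<open>(y, y, 1 - y, 1 - y)\<close>. The coordinatewise
products then satisfy one algebraic relation, which the proportions 1 : 1 : 1 : 2 violate.
\<close>

lemma extremal_no_path4:
  fixes p q :: "real ^ 'n \<Rightarrow> real"
  assumes ext: "laplace_extremal p q"
  shows "\<not> induced_path4 (additive_pair p) a b c d"
proof
  assume path: "induced_path4 (additive_pair p) a b c d"
  then have dist: "distinct [a, b, c, d]"
    and A: "additive_pair p a b" "additive_pair p b c" "additive_pair p c d"
    and B: "additive_pair q a c" "additive_pair q a d" "additive_pair q b d"
    using extremal_pair[OF ext] by (auto simp: induced_path4_def)
  have pq: "dual_pair UNIV p q" using ext by (auto simp: laplace_extremal_def)
  define w where "w = (\<lambda>i. p (unit_vec i))"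
  have w: "w i > 0" for i unfolding w_def by (rule dual_pair_unit_pos[OF pq]) auto
  have qw: "q (unit_vec i) = 1 / w i" for i by (simp add: w_def dual_pair_unit_inverse[OF pq])
  obtain \<eta> \<xi> where c: "additive_point p {a, b, c, d} \<eta>" "additive_point q {a, b, c, d} \<xi>"
    and prod: "\<And>j. \<eta> $ j * \<xi> $ j = real (count_list [a, b, c, d, d] j) / 5"
    using extremal_factorization[OF ext, of "[a, b, c, d, d]"] by auto
  define x where "x i = \<eta> $ i * w i" for i
  define y where "y i = \<xi> $ i / w i" for i
  have xy: "x i * y i = real (count_list [a, b, c, d, d] i) / 5" for i
    using prod[of i] w[of i] by (simp add: x_def y_def)
  have "x a + x b = 1" "x b + x c = 1" "x c + x d = 1"
    using path4_edge_sums[OF ext dist A B c(1)] by (simp_all add: x_def w_def)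
  moreover have  "y c + y a = 1" "y a + y d = 1" "y d + y b = 1"
  proof -
    have "{c, a, d, b} = {a, b, c, d}" by auto
    then have "additive_point q {c, a, d, b} \<xi>" using c(2) by simp
    moreover have "distinct [c, a, d, b]" using dist by auto
    moreover have "additive_pair q c a" "additive_pair p c d" "additive_pair p c b" "additive_pair p a b" "additive_pair q d b"
      using A B additive_pair_sym by blast+
    ultimately show "y c + y a = 1" "y a + y d = 1" "y d + y b = 1"
      using path4_edge_sums[OF laplace_extremal_sym[OF ext], of c a d b \<xi>] B(2) qw
      by (simp_all add: y_def)
  qed
  ultimately have eqs: "x b = 1 - x a" "x c = x a" "x d = 1 - x a" "y c = 1 - y a" "y d = 1 - y a" "y b = y a"
    by linarith+
  have "x a * y a = 1 / 5" "(1 - x a) * y a = 1 / 5" "x a * (1 - y a) = 1 / 5" "(1 - x a) * (1 - y a) = 2 / 5"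
    using xy[of a] xy[of b] xy[of c] xy[of d] dist dist[THEN distinct_rev[THEN iffD2]] unfolding eqs by simp_all
  then show False by (simp add: algebra_simps)
qed

section \<open>Graphs without induced four-vertex paths\<close>

text \<open>
The graph or its complement is disconnected.
\<close>

definition graph_split :: "('n \<Rightarrow> 'n \<Rightarrow> bool) \<Rightarrow> 'n set \<Rightarrow> bool" where
  "graph_split A I \<longleftrightarrow> (\<exists>X Y. X \<noteq> {} \<and> Y \<noteq> {} \<and> X \<inter> Y = {} \<and> X \<union> Y = I \<and>
     ((\<forall>x\<in>X. \<forall>y\<in>Y. \<not> A x y) \<or> (\<forall>x\<in>X. \<forall>y\<in>Y. A x y)))"

lemma graph_splitI:
  "X \<noteq> {} \<Longrightarrow> Y \<noteq> {} \<Longrightarrow> X \<inter> Y = {} \<Longrightarrow> X \<union> Y = I \<Longrightarrow> (\<And>x y. x \<in> X \<Longrightarrow> y \<in> Y \<Longrightarrow> \<not> A x y) \<Longrightarrow> graph_split A I"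
  unfolding graph_split_def by (intro exI[of _ X] exI[of _ Y]) auto

lemma graph_split_complement: "graph_split (\<lambda>x y. \<not> A x y) I \<Longrightarrow> graph_split A I"
  by (simp add: graph_split_def disj_commute)

text \<open>
Let \<open>i\<close> have a non-neighbour \<open>v\<close> in \<open>X\<close> and a neighbour \<open>u\<close> in \<open>Y\<close>, and let \<open>D\<close> be the component of
\<open>v\<close> among the non-neighbours of \<open>i\<close> in \<open>X\<close>. An edge from \<open>x\<close> in \<open>D\<close> to \<open>y\<close> outside must end in a
neighbour of \<open>i\<close> in \<open>X\<close>, and then \<open>x, y, i, u\<close> is an induced path. So \<open>D\<close> is separated from the
rest. All other cases are immediate.
\<close>

lemma graph_split_insert:
  assumes sym: "\<And>x y. A x y = A y x"
    and free: "\<And>a b c d. {a, b, c, d} \<subseteq> insert i (X \<union> Y) \<Longrightarrow> \<not> induced_path4 A a b c d"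
    and XY: "X \<noteq> {}" "Y \<noteq> {}" "X \<inter> Y = {}" "i \<notin> X" "i \<notin> Y"
    and none: "\<And>x y. x \<in> X \<Longrightarrow> y \<in> Y \<Longrightarrow> \<not> A x y"
  shows "graph_split A (insert i (X \<union> Y))"
proof (cases "\<exists>v\<in>X \<union> Y. \<not> A i v")
  case False
  then show ?thesis
    unfolding graph_split_def using XY by (intro exI[of _ "{i}"] exI[of _ "X \<union> Y"]) auto
next
  case True
  have main: "graph_split A (insert i (X \<union> Y))"
    if free: "\<And>a b c d. {a, b, c, d} \<subseteq> insert i (X \<union> Y) \<Longrightarrow> \<not> induced_path4 A a b c d"
      and XY: "X \<noteq> {}" "Y \<noteq> {}" "X \<inter> Y = {}" "i \<notin> X" "i \<notin> Y"
      and none: "\<And>x y. x \<in> X \<Longrightarrow> y \<in> Y \<Longrightarrow> \<not> A x y"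
      and v: "v \<in> X" "\<not> A i v" for X Y v
  proof (cases "\<exists>u\<in>Y. A i u")
    case False
    have "\<not> A x y" if "x \<in> Y" "y \<in> insert i X" for x y
      using that False none[of y x] sym[of x y] by auto
    then show ?thesis
      by (intro graph_splitI[of Y "insert i X"]) (use XY in auto)
  next
    case True
    then obtain u where u: "u \<in> Y" "A i u" by blast
    define R where "R = {(x, y). x \<in> X \<and> y \<in> X \<and> \<not> A i x \<and> \<not> A i y \<and> A x y}"
    define D where "D = {x. (v, x) \<in> R\<^sup>*}"
    have D: "x \<in> X \<and> \<not> A i x" if "x \<in> D" for x
    proof -
      have "(v, x) \<in> R\<^sup>*" using that by (simp add: D_def)
      then show ?thesis by (induction rule: rtrancl_induct) (use v in \<open>auto simp: R_def\<close>)
    qed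
    show ?thesis
    proof (rule graph_splitI[of D "insert i (X \<union> Y) - D"])
      show "D \<noteq> {}" using v by (auto simp: D_def)
      show "insert i (X \<union> Y) - D \<noteq> {}" using D XY by blast
      fix x y assume x: "x \<in> D" and y: "y \<in> insert i (X \<union> Y) - D"
      show "\<not> A x y"
      proof
        assume xy: "A x y"
        have "y \<in> X" using D[OF x] y none xy sym by blast
        have "A i y"
        proof (rule ccontr)
          assume "\<not> A i y"
          then have "(x, y) \<in> R" using D[OF x] \<open>y \<in> X\<close> xy by (simp add: R_def)
          with x have "y \<in> D" unfolding D_def by (auto intro: rtrancl.rtrancl_into_rtrancl)
          with y show False by simp
        qed
        moreover have "x \<noteq> y" using x y by auto
        moreover have "\<not> A x u" "\<not> A y u" "\<not> A x i" "A y i = A i y"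
          using none[of x u] none[of y u] D[OF x] u \<open>y \<in> X\<close> sym[of x i] sym[of y i] by auto
        moreover have "u \<notin> X" using u XY by auto
        ultimately have "induced_path4 A x y i u"
          using D[OF x] \<open>y \<in> X\<close> u xy XY(4,5) unfolding induced_path4_def by auto
        then show False using free[of x y i u] D[OF x] \<open>y \<in> X\<close> u by auto
      qed
    qed (use D in auto)
  qed
  from True obtain v where v: "v \<in> X \<union> Y" "\<not> A i v" by blast
  show ?thesis
  proof (cases "v \<in> X")
    case True
    then show ?thesis using main[of X Y v] free XY none v by blast
  next
    case False
    have none': "\<not> A y x" if "y \<in> Y" "x \<in> X" for x y using none[of x y] that sym[of y x] by simp
    have "v \<in> Y" using False v by simp
    then have "graph_split A (insert i (Y \<union> X))"
      using main[of Y X v, OF free[unfolded Un_commute[of X Y]] XY(2,1) _ XY(5,4) none' _ v(2)] XY(3) by blast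
    then show ?thesis by (simp add: Un_commute)
  qed
qed

text \<open>
Seinsche's theorem, by adding one vertex at a time. The two kinds of splitting are exchanged by
complementation, which preserves the absence of induced four-vertex paths.
\<close>

theorem path4_free_split:
  assumes sym: "\<And>x y. A x y = A y x" and "finite I" and "card I \<ge> 2"
    and free: "\<And>a b c d. {a, b, c, d} \<subseteq> I \<Longrightarrow> \<not> induced_path4 A a b c d"
  shows "graph_split A I"
  using assms(2-)
proof (induction I)
  case (insert i J)
  show ?case
  proof (cases "card J \<ge> 2")
    case False
    then have "card J = 1" using insert by auto
    then obtain j where "J = {j}" using card_1_singletonE by blast
    then show ?thesis
      unfolding graph_split_def using insert by (intro exI[of _ "{i}"] exI[of _ "{j}"]) auto
  next
    case True
    then have "graph_split A J" using insert by blast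
    then obtain X Y where XY: "X \<noteq> {}" "Y \<noteq> {}" "X \<inter> Y = {}" "X \<union> Y = J"
      and c: "(\<forall>x\<in>X. \<forall>y\<in>Y. \<not> A x y) \<or> (\<forall>x\<in>X. \<forall>y\<in>Y. A x y)"
      unfolding graph_split_def by blast
    from c show ?thesis
    proof
      assume "\<forall>x\<in>X. \<forall>y\<in>Y. \<not> A x y"
      then show ?thesis
        using graph_split_insert[of A i X Y] sym insert XY by auto
    next
      assume all: "\<forall>x\<in>X. \<forall>y\<in>Y. A x y"
      have "graph_split (\<lambda>x y. \<not> A x y) (insert i (X \<union> Y))"
      proof (rule graph_split_insert)
        fix a b c d assume sub: "{a, b, c, d} \<subseteq> insert i (X \<union> Y)"
        show "\<not> induced_path4 (\<lambda>x y. \<not> A x y) a b c d"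
        proof
          assume "induced_path4 (\<lambda>x y. \<not> A x y) a b c d"
          then have "induced_path4 A c a d b" using sym by (auto simp: induced_path4_def)
          then show False using insert.prems(2)[of c a d b] sub XY by auto
        qed
      qed (use sym XY all insert in auto)
      then show ?thesis using XY by (auto intro: graph_split_complement)
    qed
  qed
qed simp

section \<open>Extremal unit balls are Hanner polytopes\<close>

lemma closed_segment_axis:
  fixes i :: "'n::finite"
  assumes "a > 0"
  shows "closed_segment (axis i (- a)) (axis i a) = {x \<in> coord_subspace {i}. \<bar>x $ i\<bar> \<le> a}"
proof (intro equalityI subsetI)
  fix x :: "real ^ 'n" assume x: "x \<in> {x \<in> coord_subspace {i}. \<bar>x $ i\<bar> \<le> a}"
  then have *: "- a \<le> x $ i" "x $ i \<le> a" by auto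
  let ?u = "(x $ i / a + 1) / 2"
  have "x = (1 - ?u) *\<^sub>R axis i (- a) + ?u *\<^sub>R axis i a"
    using x assms by (auto simp: vec_eq_iff coord_subspace_def axis_def field_simps)
  moreover have "0 \<le> ?u" "?u \<le> 1" using * assms by (auto simp: field_simps)
  ultimately show "x \<in> closed_segment (axis i (- a)) (axis i a)"
    unfolding closed_segment_def by blast
next
  fix x assume "x \<in> closed_segment (axis i (- a)) (axis i a)"
  then obtain u where u: "0 \<le> u" "u \<le> 1" "x = (1 - u) *\<^sub>R axis i (- a) + u *\<^sub>R axis i a"
    unfolding closed_segment_def by blast
  have "x $ i = (1 - u) * - a + u * a" unfolding u(3) by simp
  then have "x $ i = (2 * u - 1) * a" by (simp add: algebra_simps)
  then have "\<bar>x $ i\<bar> = \<bar>2 * u - 1\<bar> * a" using assms by (simp add: abs_mult)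
  also have "\<dots> \<le> 1 * a" using u assms by (intro mult_right_mono) auto
  finally show "x \<in> {x \<in> coord_subspace {i}. \<bar>x $ i\<bar> \<le> a}"
    using u(3) by (simp add: coord_subspace_closed)
qed

lemma proj_on_split:
  assumes "X \<inter> Y = {}" "x \<in> coord_subspace (X \<union> Y)"
  shows "x = proj_on X x + proj_on Y x"
  using assms by (auto simp: vec_eq_iff coord_subspace_def)

lemma proj_on_add:
  assumes "X \<inter> Y = {}" "x \<in> coord_subspace X" "y \<in> coord_subspace Y"
  shows "proj_on X (x + y) = x" "proj_on Y (x + y) = y" "x + y \<in> coord_subspace (X \<union> Y)"
  using assms by (auto simp: vec_eq_iff coord_subspace_def)

lemma inner_proj_split:
  assumes "I \<inter> J = {}" "x \<in> coord_subspace (I \<union> J)"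
  shows "x \<bullet> \<xi> = proj_on I x \<bullet> proj_on I \<xi> + proj_on J x \<bullet> proj_on J \<xi>"
proof -
  have "x \<bullet> \<xi> = \<xi> \<bullet> proj_on I x + \<xi> \<bullet> proj_on J x"
    by (metis assms inner_add_right inner_commute proj_on_split)
  then show ?thesis
    using inner_proj_on[of \<xi> I x] inner_proj_on[of \<xi> J x] by (simp add: inner_commute)
qed

lemma product_unit_balls:
  fixes f g :: "real ^ 'n \<Rightarrow> real"
  assumes "X \<inter> Y = {}"
  shows "{x + y | x y. x \<in> {x \<in> coord_subspace X. f x \<le> 1} \<and> y \<in> {x \<in> coord_subspace Y. g x \<le> 1}} =
    {x \<in> coord_subspace (X \<union> Y). max (f (proj_on X x)) (g (proj_on Y x)) \<le> 1}" (is "?L = ?R")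
proof (intro equalityI subsetI)
  fix z assume "z \<in> ?L"
  then obtain x y where "z = x + y" "x \<in> coord_subspace X" "f x \<le> 1" "y \<in> coord_subspace Y" "g y \<le> 1" by blast
  then show "z \<in> ?R" using proj_on_add[OF assms] by simp
next
  fix z assume z: "z \<in> ?R"
  then have "z = proj_on X z + proj_on Y z" using proj_on_split[OF assms] by blast
  moreover have "f (proj_on X z) \<le> 1" "g (proj_on Y z) \<le> 1" using z by auto
  ultimately show "z \<in> ?L" using proj_on_coord by blast
qed

lemma polar_unit_ball:
  assumes pq: "dual_pair I p q"
  shows "polar {x \<in> coord_subspace I. p x \<le> 1} \<inter> coord_subspace I = {\<xi> \<in> coord_subspace I. q \<xi> \<le> 1}"
proof (intro equalityI subsetI CollectI IntI conjI)
  fix \<xi> assume "\<xi> \<in> polar {x \<in> coord_subspace I. p x \<le> 1} \<inter> coord_subspace I"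
  then show "\<xi> \<in> coord_subspace I" "q \<xi> \<le> 1"
    using dual_pairD(5)[OF dual_pair_sym[OF pq], of \<xi>] by (auto simp: polar_def)
next
  fix \<xi> assume xi: "\<xi> \<in> {\<xi> \<in> coord_subspace I. q \<xi> \<le> 1}"
  then show "\<xi> \<in> coord_subspace I" by simp
  show "\<xi> \<in> polar {x \<in> coord_subspace I. p x \<le> 1}"
    unfolding polar_def
  proof (intro CollectI ballI)
    fix x assume "x \<in> {x \<in> coord_subspace I. p x \<le> 1}"
    then show "\<xi> \<bullet> x \<le> 1" using dual_pair_le[OF pq, of x \<xi>] xi by (simp add: inner_commute)
  qed
qed

text \<open>
Together with \<open>extremal_clique_le\<close> this says that the unit ball of \<open>p\<close> is the polytope cut out by the
clique inequalities of the graph of additive pairs.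
\<close>

definition clique_form :: "(real ^ 'n \<Rightarrow> real) \<Rightarrow> 'n set \<Rightarrow> bool" where
  "clique_form p I \<longleftrightarrow> (\<forall>x\<in>coord_subspace I. \<exists>C\<subseteq>I. additive_clique p C \<and>
     p x = (\<Sum>i\<in>C. \<bar>x $ i\<bar> * p (unit_vec i)))"

lemma clique_form_proj:
  "clique_form p I \<Longrightarrow> \<exists>C\<subseteq>I. additive_clique p C \<and>
     p (proj_on I x) = (\<Sum>i\<in>C. \<bar>x $ i\<bar> * p (unit_vec i))"
proof -
  assume "clique_form p I"
  then obtain C where "C \<subseteq> I" "additive_clique p C"
    "p (proj_on I x) = (\<Sum>i\<in>C. \<bar>proj_on I x $ i\<bar> * p (unit_vec i))"
    unfolding clique_form_def using proj_on_coord by blast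
  moreover from this have "(\<Sum>i\<in>C. \<bar>proj_on I x $ i\<bar> * p (unit_vec i)) = (\<Sum>i\<in>C. \<bar>x $ i\<bar> * p (unit_vec i))"
    by (intro sum.cong) auto
  ultimately show ?thesis by auto
qed

definition clique_hanner :: "(real ^ 'n \<Rightarrow> real) \<Rightarrow> (real ^ 'n \<Rightarrow> real) \<Rightarrow> 'n set \<Rightarrow> bool" where
  "clique_hanner p q I \<longleftrightarrow> hanner_on I {x \<in> coord_subspace I. p x \<le> 1} \<and> hanner_on I {x \<in> coord_subspace I. q x \<le> 1}
     \<and> clique_form p I \<and> clique_form q I"

lemma clique_hanner_sym: "clique_hanner p q I \<Longrightarrow> clique_hanner q p I"
  by (auto simp: clique_hanner_def)

lemma clique_hanner_singleton:
  fixes p q :: "real ^ 'n \<Rightarrow> real"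
  assumes pq: "dual_pair UNIV p q"
  shows "clique_hanner p q {i}"
proof -
  have "hanner_on {i} {x \<in> coord_subspace {i}. p x \<le> 1} \<and> clique_form p {i}"
    if pq: "dual_pair UNIV p q" for p q :: "real ^ 'n \<Rightarrow> real"
  proof -
    define w where "w = p (unit_vec i)"
    have w: "w > 0" unfolding w_def by (rule dual_pair_unit_pos[OF pq]) auto
    have p_eq: "p x = \<bar>x $ i\<bar> * w" if x: "x \<in> coord_subspace {i}" for x
    proof -
      have "p x = p (abs_vec x)" by (rule dual_pairD(6)[OF pq, symmetric])
      also have "abs_vec x = \<bar>x $ i\<bar> *\<^sub>R unit_vec i"
        using x by (auto simp: vec_eq_iff coord_subspace_def axis_def)
      also have "p \<dots> = \<bar>x $ i\<bar> * w" using dual_pair_scale[OF pq] by (simp add: w_def)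
      finally show ?thesis .
    qed
    have "{x \<in> coord_subspace {i}. p x \<le> 1} = {x \<in> coord_subspace {i}. \<bar>x $ i\<bar> \<le> 1 / w}"
      using p_eq w by (auto simp: field_simps)
    also have "\<dots> = closed_segment (axis i (- (1 / w))) (axis i (1 / w))"
      using closed_segment_axis[of "1 / w" i] w by simp
    finally have "{x \<in> coord_subspace {i}. p x \<le> 1} = closed_segment (axis i (- (1 / w))) (axis i (1 / w))" .
    then have "hanner_on {i} {x \<in> coord_subspace {i}. p x \<le> 1}"
      using hanner_on.segment[of "1 / w" i] w by simp
    moreover have "clique_form p {i}"
      unfolding clique_form_def
    proof
      fix x assume "x \<in> coord_subspace {i}"
      then show "\<exists>C\<subseteq>{i}. additive_clique p C \<and> p x = (\<Sum>i\<in>C. \<bar>x $ i\<bar> * p (unit_vec i))"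
        using p_eq by (intro exI[of _ "{i}"]) (auto simp: additive_clique_def w_def)
    qed
    ultimately show ?thesis ..
  qed
  from this[OF pq] this[OF dual_pair_sym[OF pq]] show ?thesis by (simp add: clique_hanner_def)
qed

text \<open>
The union of a clique of \<open>q\<close> in \<open>X\<close> and one in \<open>Y\<close> is again a clique. As \<open>q\<close> dominates every clique
sum, it is the sum of its restrictions to \<open>X\<close> and \<open>Y\<close>. Dually, \<open>p\<close> is the maximum of its restrictions,
so its unit ball is a Cartesian product.
\<close>

lemma clique_hanner_product:
  fixes p q :: "real ^ 'n \<Rightarrow> real"
  assumes ext: "laplace_extremal p q" and disj: "X \<inter> Y = {}"
    and add: "\<And>x y. x \<in> X \<Longrightarrow> y \<in> Y \<Longrightarrow> additive_pair q x y"
    and X: "clique_hanner p q X" and Y: "clique_hanner p q Y"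
  shows "clique_hanner p q (X \<union> Y)"
proof -
  let ?I = "X \<union> Y"
  have pq: "dual_pair UNIV p q" and qp: "dual_pair UNIV q p"
    using ext by (auto simp: laplace_extremal_def dual_pair_sym)
  have q_add: "\<exists>C\<subseteq>?I. additive_clique q C \<and> q x = (\<Sum>i\<in>C. \<bar>x $ i\<bar> * q (unit_vec i)) \<and>
      q x = q (proj_on X x) + q (proj_on Y x)" if x: "x \<in> coord_subspace ?I" for x
  proof -
    have forms: "clique_form q X" "clique_form q Y" using X Y by (simp_all add: clique_hanner_def)
    obtain C1 where C1: "C1 \<subseteq> X" "additive_clique q C1"
      "q (proj_on X x) = (\<Sum>i\<in>C1. \<bar>x $ i\<bar> * q (unit_vec i))"
      using clique_form_proj[OF forms(1), of x] by blast
    obtain C2 where C2: "C2 \<subseteq> Y" "additive_clique q C2"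
      "q (proj_on Y x) = (\<Sum>i\<in>C2. \<bar>x $ i\<bar> * q (unit_vec i))"
      using clique_form_proj[OF forms(2), of x] by blast
    have C: "additive_clique q (C1 \<union> C2)"
      unfolding additive_clique_def
    proof (intro ballI impI)
      fix i j assume "i \<in> C1 \<union> C2" "j \<in> C1 \<union> C2" "i \<noteq> j"
      moreover have "additive_pair q i j" if "i \<in> C1" "j \<in> C2" for i j
        using that C1(1) C2(1) add by blast
      ultimately show "additive_pair q i j"
        using C1(2) C2(2) additive_pair_sym[of q j i] unfolding additive_clique_def by auto
    qed
    have "(\<Sum>i\<in>C1 \<union> C2. \<bar>x $ i\<bar> * q (unit_vec i)) = (\<Sum>i\<in>C1. \<bar>x $ i\<bar> * q (unit_vec i)) + (\<Sum>i\<in>C2. \<bar>x $ i\<bar> * q (unit_vec i))"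
      by (rule sum.union_disjoint) (use C1 C2 disj in auto)
    also have "\<dots> = q (proj_on X x) + q (proj_on Y x)"
      unfolding C1(3) C2(3) ..
    finally have sum: "(\<Sum>i\<in>C1 \<union> C2. \<bar>x $ i\<bar> * q (unit_vec i)) = q (proj_on X x) + q (proj_on Y x)" .
    have "q x \<le> q (proj_on X x) + q (proj_on Y x)"
      using dual_pair_add[OF qp, of "proj_on X x" "proj_on Y x"] proj_on_split[OF disj x] by simp
    moreover have "(\<Sum>i\<in>C1 \<union> C2. \<bar>x $ i\<bar> * q (unit_vec i)) \<le> q x"
      by (rule extremal_clique_le[OF laplace_extremal_sym[OF ext] C])
    ultimately show ?thesis
      using C C1(1) C2(1) sum by (intro exI[of _ "C1 \<union> C2"]) auto
  qed
  have p_max: "p x = max (p (proj_on X x)) (p (proj_on Y x))" if x: "x \<in> coord_subspace ?I" for x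
  proof (rule antisym)
    have "p (proj_on X x) \<le> p x" "p (proj_on Y x) \<le> p x"
      by (rule dual_pair_mono[OF pq]; simp)+
    then show "max (p (proj_on X x)) (p (proj_on Y x)) \<le> p x" by simp
    let ?m = "max (p (proj_on X x)) (p (proj_on Y x))"
    obtain \<xi> where xi: "\<xi> \<in> coord_subspace ?I" "q \<xi> \<le> 1" "x \<bullet> \<xi> = p x"
      using dual_pairD(5)[OF dual_pair_restrict[OF pq] x] by blast
    have m0: "0 \<le> ?m" using dual_pairD(2)[OF pq] by (auto simp: max_def)
    have "x \<bullet> \<xi> = x \<bullet> proj_on X \<xi> + x \<bullet> proj_on Y \<xi>"
      by (metis inner_add_right proj_on_split[OF disj xi(1)])
    also have "\<dots> = proj_on X x \<bullet> proj_on X \<xi> + proj_on Y x \<bullet> proj_on Y \<xi>"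
      using inner_proj_on[of x X \<xi>] inner_proj_on[of x Y \<xi>] by simp
    also have "\<dots> \<le> p (proj_on X x) * q (proj_on X \<xi>) + p (proj_on Y x) * q (proj_on Y \<xi>)"
      using dual_pairD(4)[OF pq] by (intro add_mono) auto
    also have "\<dots> \<le> ?m * q (proj_on X \<xi>) + ?m * q (proj_on Y \<xi>)"
      using dual_pairD(2)[OF qp] by (intro add_mono mult_right_mono) auto
    also have "\<dots> = ?m * q \<xi>"
    proof -
      have "q \<xi> = q (proj_on X \<xi>) + q (proj_on Y \<xi>)" using q_add[OF xi(1)] by blast
      then show ?thesis by (simp add: distrib_left)
    qed
    also have "\<dots> \<le> ?m * 1" using xi m0 by (intro mult_left_mono) auto
    finally show "p x \<le> ?m" using xi by simp
  qed
  have "clique_form q ?I" using q_add unfolding clique_form_def by blast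
  moreover have "clique_form p ?I"
    unfolding clique_form_def
  proof
    fix x assume x: "x \<in> coord_subspace ?I"
    have "\<exists>C\<subseteq>?I. additive_clique p C \<and> p x = (\<Sum>i\<in>C. \<bar>x $ i\<bar> * p (unit_vec i))"
      if Z: "clique_hanner p q Z" "Z \<subseteq> ?I" "p x = p (proj_on Z x)" for Z
    proof -
      have "clique_form p Z" using Z(1) by (simp add: clique_hanner_def)
      from clique_form_proj[OF this, of x] show ?thesis using Z(2,3) by (metis order_trans)
    qed
    then show "\<exists>C\<subseteq>?I. additive_clique p C \<and> p x = (\<Sum>i\<in>C. \<bar>x $ i\<bar> * p (unit_vec i))"
      using p_max[OF x] X Y by (metis Un_upper1 Un_upper2 max_def)
  qed
  moreover have "hanner_on ?I {x \<in> coord_subspace ?I. p x \<le> 1}"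
  proof -
    have "{x \<in> coord_subspace ?I. p x \<le> 1} =
        {x + y | x y. x \<in> {x \<in> coord_subspace X. p x \<le> 1} \<and> y \<in> {x \<in> coord_subspace Y. p x \<le> 1}}"
      unfolding product_unit_balls[OF disj] using p_max by (intro Collect_cong) auto
    moreover have "hanner_on X {x \<in> coord_subspace X. p x \<le> 1}" "hanner_on Y {x \<in> coord_subspace Y. p x \<le> 1}"
      using X Y by (simp_all add: clique_hanner_def)
    ultimately show ?thesis
      using hanner_on.product[OF _ _ disj, of "{x \<in> coord_subspace X. p x \<le> 1}" "{x \<in> coord_subspace Y. p x \<le> 1}"]
      by simp
  qed
  moreover from hanner_on.polar[OF this] have "hanner_on ?I {x \<in> coord_subspace ?I. q x \<le> 1}"
    unfolding polar_unit_ball[OF dual_pair_restrict[OF pq]] .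
  ultimately show ?thesis by (simp add: clique_hanner_def)
qed

lemma extremal_clique_hanner:
  fixes p q :: "real ^ 'n \<Rightarrow> real"
  assumes ext: "laplace_extremal p q" and "I \<noteq> {}"
  shows "clique_hanner p q I"
  using \<open>I \<noteq> {}\<close>
proof (induction "card I" arbitrary: I rule: less_induct)
  case less
  show ?case
  proof (cases "card I \<ge> 2")
    case False
    moreover have "card I \<noteq> 0" using less.prems by simp
    ultimately have "card I = 1" by linarith
    then obtain i where "I = {i}" using card_1_singletonE by blast
    then show ?thesis using clique_hanner_singleton laplace_extremal_dual_pair[OF ext] by blast
  next
    case True
    have "graph_split (additive_pair p) I"
      by (rule path4_free_split[OF additive_pair_sym _ True extremal_no_path4[OF ext]]) simp
    then obtain X Y where XY: "X \<noteq> {}" "Y \<noteq> {}" "X \<inter> Y = {}" "X \<union> Y = I"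
      and c: "(\<forall>x\<in>X. \<forall>y\<in>Y. \<not> additive_pair p x y) \<or> (\<forall>x\<in>X. \<forall>y\<in>Y. additive_pair p x y)"
      unfolding graph_split_def by blast
    have "X \<subset> I" "Y \<subset> I" using XY by auto
    then have IH: "clique_hanner p q X" "clique_hanner p q Y"
      using less.hyps XY by (simp_all add: psubset_card_mono)
    from c show ?thesis
    proof
      assume "\<forall>x\<in>X. \<forall>y\<in>Y. \<not> additive_pair p x y"
      then have "additive_pair q x y" if "x \<in> X" "y \<in> Y" for x y
        using extremal_pair[OF ext, of x y] that XY by blast
      from clique_hanner_product[OF ext XY(3) this IH] show ?thesis using XY by simp
    next
      assume "\<forall>x\<in>X. \<forall>y\<in>Y. additive_pair p x y"
      then have "additive_pair p x y" if "x \<in> X" "y \<in> Y" for x y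
        using that by blast
      from clique_hanner_product[OF laplace_extremal_sym[OF ext] XY(3) this IH[THEN clique_hanner_sym]]
      have "clique_hanner q p (X \<union> Y)" .
      then show ?thesis using XY clique_hanner_sym by blast
    qed
  qed
qed

theorem extremal_unit_ball_hanner:
  fixes p q :: "real ^ 'n \<Rightarrow> real"
  assumes "laplace_extremal p q"
  shows "hanner_polytope {x. p x \<le> 1}"
  using extremal_clique_hanner[OF assms, of UNIV] by (simp add: clique_hanner_def hanner_polytope_def)

section \<open>Volumes and exponential integrals\<close>

lemma nn_integral_power_exp:
  "(\<integral>\<^sup>+t. ennreal (t ^ k * exp (- t)) * indicator {0..} t \<partial>lborel) = ennreal (fact k)"
proof -
  have "ennreal (Gamma (real (Suc k))) =
      (\<integral>\<^sup>+t. ennreal (indicator {0..} t * t powr (real (Suc k) - 1) / exp t) \<partial>lborel)"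
    by (rule Gamma_conv_nn_integral_real) simp
  also have "\<dots> = (\<integral>\<^sup>+t. ennreal (t ^ k * exp (- t)) * indicator {0..} t \<partial>lborel)"
  proof (rule nn_integral_cong_AE, use AE_lborel_singleton[of "0::real"] in eventually_elim)
    case (elim t)
    then show ?case by (auto simp: indicator_def powr_realpow exp_minus field_simps)
  qed
  finally show ?thesis by (simp add: Gamma_fact add.commute[of _ "1::real"])
qed

lemma exp_neg_layer:
  assumes "0 \<le> u"
  shows "ennreal (exp (- u)) = (\<integral>\<^sup>+t. ennreal (exp (- t)) * indicator {0..} t * indicator {t. u \<le> t} t \<partial>lborel)"
proof -
  have "((\<lambda>t. exp (- t)) \<longlongrightarrow> (0::real)) at_top"
    by (rule filterlim_compose[OF exp_at_bot filterlim_uminus_at_bot_at_top])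
  then have lim: "((\<lambda>t. - exp (- t)) \<longlongrightarrow> (0::real)) at_top"
    using tendsto_minus by fastforce
  have "(\<integral>\<^sup>+t. ennreal (exp (- t)) * indicator {u..} t \<partial>lborel) = ennreal (0 - (- exp (- u)))"
    by (rule nn_integral_FTC_atLeast[OF _ _ _ lim]) (auto intro!: derivative_eq_intros)
  also have "(\<integral>\<^sup>+t. ennreal (exp (- t)) * indicator {u..} t \<partial>lborel)
      = (\<integral>\<^sup>+t. ennreal (exp (- t)) * indicator {0..} t * indicator {t. u \<le> t} t \<partial>lborel)"
    using assms by (intro nn_integral_cong) (auto simp: indicator_def)
  finally show ?thesis by simp
qed

text \<open>
With \<open>exp_neg_layer\<close>, this converts integrals of \<open>exp (- r)\<close> for a homogeneous \<open>r\<close> into integrals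
over the set where \<open>r \<le> 1\<close>.
\<close>

lemma layer_homogeneous:
  fixes g :: "real \<Rightarrow> ennreal"
  assumes "\<And>t. t > 0 \<Longrightarrow> g t = ennreal (t ^ k) * g 1"
  shows "(\<integral>\<^sup>+t. ennreal (exp (- t)) * indicator {0..} t * g t \<partial>lborel) = ennreal (fact k) * g 1"
proof -
  have "(\<integral>\<^sup>+t. ennreal (exp (- t)) * indicator {0..} t * g t \<partial>lborel) =
      (\<integral>\<^sup>+t. ennreal (t ^ k * exp (- t)) * indicator {0..} t * g 1 \<partial>lborel)"
  proof (rule nn_integral_cong_AE, use AE_lborel_singleton[of "0::real"] in eventually_elim)
    case (elim t)
    show ?case
    proof (cases "t > 0")
      case True
      then show ?thesis using assms[of t] by (simp add: ennreal_mult mult_ac)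
    qed (use elim in auto)
  qed
  also have "\<dots> = ennreal (fact k) * g 1"
    by (subst nn_integral_multc) (auto simp: nn_integral_power_exp)
  finally show ?thesis .
qed

lemma laplace_eq_unit_ball:
  fixes p q :: "real ^ 'n \<Rightarrow> real"
  assumes pq: "dual_pair I p q" and cs: "set cs \<subseteq> I"
  shows "laplace cs p 0 = ennreal (fact (length cs)) * ray_ints cs (indicator {y. p y \<le> 1}) 0"
proof -
  have [measurable]: "p \<in> borel_measurable borel" using pq by (rule dual_pair_measurable)
  let ?f = "\<lambda>t y. ennreal (exp (- t)) * indicator {0..} t * indicator {y. p y \<le> t} y"
  have meas: "(\<lambda>(t, y). ?f t y) \<in> borel_measurable (lborel \<Otimes>\<^sub>M borel)"
    unfolding indicator_def by measurable
  have "laplace cs p 0 = ray_ints cs (\<lambda>y. \<integral>\<^sup>+t. ?f t y \<partial>lborel) 0"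
    unfolding laplace_def exp_neg_layer[OF dual_pairD(2)[OF pq]] by (simp add: indicator_def cong: if_cong)
  also have "\<dots> = (\<integral>\<^sup>+t. ray_ints cs (?f t) 0 \<partial>lborel)"
    using ray_ints_nn_integral[OF sigma_finite_lborel meas, of cs 0] by blast
  also have "\<dots> = (\<integral>\<^sup>+t. ennreal (exp (- t)) * indicator {0..} t * ray_ints cs (indicator {y. p y \<le> t}) 0 \<partial>lborel)"
    by (subst ray_ints_cmult) auto
  also have "\<dots> = ennreal (fact (length cs)) * ray_ints cs (indicator {y. p y \<le> 1}) 0"
  proof (rule layer_homogeneous)
    fix t :: real assume t: "t > 0"
    have "ray_ints cs (indicator {y. p y \<le> t}) (t *\<^sub>R 0) =
        ennreal (t ^ length cs) * ray_ints cs (\<lambda>y. indicator {y. p y \<le> t} (t *\<^sub>R y)) 0"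
      by (rule ray_ints_scale) (use t in auto)
    also have "ray_ints cs (\<lambda>y. indicator {y. p y \<le> t} (t *\<^sub>R y)) 0 = ray_ints cs (indicator {y. p y \<le> 1}) 0"
    proof (rule ray_ints_cong_on[where S = "coord_subspace I"])
      fix y :: "real ^ 'n" assume "y \<in> coord_subspace I"
      then have "p (t *\<^sub>R y) = t * p y" using dual_pair_scale[OF pq] t by simp
      then show "indicator {y. p y \<le> t} (t *\<^sub>R y) = (indicator {y. p y \<le> 1} y :: ennreal)"
        using t by (simp add: indicator_def)
    qed (use cs in \<open>auto simp: coord_subspace_closed\<close>)
    finally show "ray_ints cs (indicator {y. p y \<le> t}) 0 =
        ennreal (t ^ length cs) * ray_ints cs (indicator {y. p y \<le> 1}) 0" by simp
  qed
  finally show ?thesis .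
qed

text \<open>
Used for \<open>r \<xi> = q \<xi> - x \<bullet> \<xi>\<close>, the gauge of the polar body with respect to the point \<open>x\<close>, it replaces
the projective change of variables that relates this polar body to the polar at the origin.
\<close>

lemma volume_layer:
  fixes r :: "real ^ 'n \<Rightarrow> real"
  assumes [measurable]: "r \<in> borel_measurable borel" and nonneg: "\<And>x. 0 \<le> r x"
    and hom: "\<And>t x. 0 < t \<Longrightarrow> r (t *\<^sub>R x) = t * r x"
  shows "(\<integral>\<^sup>+x. ennreal (exp (- r x)) \<partial>lborel) = ennreal (fact CARD('n)) * emeasure lborel {x. r x \<le> 1}"
proof -
  have "(\<integral>\<^sup>+x. ennreal (exp (- r x)) \<partial>lborel) =
      (\<integral>\<^sup>+x. \<integral>\<^sup>+t. ennreal (exp (- t)) * indicator {0..} t * indicator {x. r x \<le> t} x \<partial>lborel \<partial>lborel)"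
    unfolding exp_neg_layer[OF nonneg] by (simp add: indicator_def cong: if_cong)
  also have "\<dots> = (\<integral>\<^sup>+t. \<integral>\<^sup>+x. ennreal (exp (- t)) * indicator {0..} t * indicator {x. r x \<le> t} x \<partial>lborel \<partial>lborel)"
    by (rule lborel_pair.Fubini'[symmetric]) (unfold indicator_def, measurable)
  also have "\<dots> = (\<integral>\<^sup>+t. ennreal (exp (- t)) * indicator {0..} t * emeasure lborel {x. r x \<le> t} \<partial>lborel)"
    by (subst nn_integral_cmult) auto
  also have "\<dots> = ennreal (fact CARD('n)) * emeasure lborel {x. r x \<le> 1}"
  proof (rule layer_homogeneous)
    fix t :: real assume t: "t > 0"
    have "emeasure lborel {x. r x \<le> t} = (\<integral>\<^sup>+x. indicator {x. r x \<le> t} x \<partial>lborel)" by simp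
    also have "\<dots> = (\<integral>\<^sup>+x. indicator {x. r x \<le> t} x \<partial>density (distr lborel borel (\<lambda>x. 0 + t *\<^sub>R x)) (\<lambda>_. ennreal (\<bar>t\<bar> ^ DIM(real ^ 'n))))"
      by (subst lborel_affine[of t 0]) (use t in auto)
    also have "\<dots> = ennreal (t ^ CARD('n)) * (\<integral>\<^sup>+x. indicator {x. r x \<le> t} (t *\<^sub>R x) \<partial>lborel)"
      by (subst nn_integral_density, measurable, subst nn_integral_distr, measurable, subst nn_integral_cmult)
        (use t in auto)
    also have "(\<lambda>x. indicator {x. r x \<le> t} (t *\<^sub>R x) :: ennreal) = indicator {x. r x \<le> 1}"
      using t by (auto simp: fun_eq_iff indicator_def hom)
    finally show "emeasure lborel {x. r x \<le> t} = ennreal (t ^ CARD('n)) * emeasure lborel {x. r x \<le> 1}" by simp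
  qed
  finally show ?thesis .
qed

section \<open>Moments as iterated ray integrals\<close>

definition line_int :: "'n \<Rightarrow> (real ^ 'n \<Rightarrow> ennreal) \<Rightarrow> real ^ 'n \<Rightarrow> ennreal" where
  "line_int i f y = (\<integral>\<^sup>+s. f (y + s *\<^sub>R unit_vec i) \<partial>lborel)"

primrec line_ints :: "'n list \<Rightarrow> (real ^ 'n \<Rightarrow> ennreal) \<Rightarrow> real ^ 'n \<Rightarrow> ennreal" where
  "line_ints [] f = f"
| "line_ints (i # is) f = line_int i (line_ints is f)"

lemma line_ints_measurable [measurable (raw)]:
  fixes f :: "real ^ 'n \<Rightarrow> ennreal"
  assumes f: "f \<in> borel_measurable borel" and g: "g \<in> measurable M borel"
  shows "(\<lambda>x. line_ints cs f (g x)) \<in> borel_measurable M"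
proof -
  have "line_ints cs f \<in> borel_measurable borel"
  proof (induction cs)
    case (Cons c cs)
    note [measurable] = this
    show ?case unfolding line_ints.simps line_int_def[abs_def] by measurable
  qed (use f in auto)
  then show ?thesis using g by measurable
qed

lemma unit_vec_inj: "unit_vec i = (unit_vec j :: real ^ 'n) \<longleftrightarrow> i = j"
  by (simp add: axis_eq_axis)

lemma line_ints_PiM:
  fixes f :: "real ^ 'n \<Rightarrow> ennreal"
  assumes [measurable]: "f \<in> borel_measurable borel" and "distinct is"
  shows "line_ints is f y = (\<integral>\<^sup>+x. f (y + (\<Sum>i\<in>set is. x (unit_vec i) *\<^sub>R unit_vec i))
    \<partial>PiM (unit_vec ` set is :: (real ^ 'n) set) (\<lambda>_. lborel))"
  using assms(2)
proof (induction "is" arbitrary: y)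
  case Nil
  then show ?case by (simp add: nn_integral_count_space_finite PiM_empty)
next
  case (Cons k ks)
  interpret product_sigma_finite "\<lambda>_ :: real ^ 'n. lborel :: real measure" ..
  let ?B = "unit_vec ` set ks :: (real ^ 'n) set"
  have meas: "(\<lambda>x. f (y + (\<Sum>i\<in>set (k # ks). x (unit_vec i) *\<^sub>R unit_vec i)))
      \<in> borel_measurable (PiM (insert (unit_vec k) ?B) (\<lambda>_. lborel))"
  proof (intro measurable_compose[OF _ assms(1)] borel_measurable_add borel_measurable_const
      borel_measurable_sum borel_measurable_scaleR)
    fix i assume "i \<in> set (k # ks)"
    then have "(\<lambda>x. x (unit_vec i)) \<in> measurable (PiM (insert (unit_vec k) ?B) (\<lambda>_. lborel)) lborel"
      by (intro measurable_component_singleton) auto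
    then show "(\<lambda>x. x (unit_vec i)) \<in> borel_measurable (PiM (insert (unit_vec k) ?B) (\<lambda>_. lborel))"
      by simp
  qed
  have "line_ints (k # ks) f y =
      (\<integral>\<^sup>+s. \<integral>\<^sup>+x. f (y + s *\<^sub>R unit_vec k + (\<Sum>i\<in>set ks. x (unit_vec i) *\<^sub>R unit_vec i)) \<partial>PiM ?B (\<lambda>_. lborel) \<partial>lborel)"
    using Cons by (simp add: line_int_def)
  also have "\<dots> = (\<integral>\<^sup>+s. \<integral>\<^sup>+x. f (y + (\<Sum>i\<in>set (k # ks). (x(unit_vec k := s)) (unit_vec i) *\<^sub>R unit_vec i)) \<partial>PiM ?B (\<lambda>_. lborel) \<partial>lborel)"
  proof (intro nn_integral_cong arg_cong[where f = f])
    fix s and x :: "real ^ 'n \<Rightarrow> real"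
    have "(\<Sum>i\<in>set ks. (x(unit_vec k := s)) (unit_vec i) *\<^sub>R unit_vec i) = (\<Sum>i\<in>set ks. x (unit_vec i) *\<^sub>R (unit_vec i :: real ^ 'n))"
      using Cons.prems by (intro sum.cong) (auto simp: unit_vec_inj)
    then show "y + s *\<^sub>R unit_vec k + (\<Sum>i\<in>set ks. x (unit_vec i) *\<^sub>R unit_vec i) =
        y + (\<Sum>i\<in>set (k # ks). (x(unit_vec k := s)) (unit_vec i) *\<^sub>R unit_vec i)"
      using Cons.prems by (simp add: add.assoc)
  qed
  also have "\<dots> = (\<integral>\<^sup>+x. f (y + (\<Sum>i\<in>set (k # ks). x (unit_vec i) *\<^sub>R unit_vec i))
    \<partial>PiM (insert (unit_vec k) ?B) (\<lambda>_. lborel))"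
    by (rule product_nn_integral_insert_rev[symmetric, OF _ _ meas]) (use Cons.prems in \<open>auto simp: unit_vec_inj\<close>)
  finally show ?case by simp
qed

lemma nn_integral_line_ints:
  fixes f :: "real ^ 'n \<Rightarrow> ennreal"
  assumes [measurable]: "f \<in> borel_measurable borel" and "distinct is" "set is = UNIV"
  shows "(\<integral>\<^sup>+x. f x \<partial>lborel) = line_ints is f 0"
proof -
  have B: "range unit_vec = (Basis :: (real ^ 'n) set)"
    by (auto simp: Basis_vec_def)
  have "(\<integral>\<^sup>+x. f x \<partial>lborel) = (\<integral>\<^sup>+x. f (\<Sum>b\<in>Basis. x b *\<^sub>R b) \<partial>PiM Basis (\<lambda>_. lborel))"
    by (subst lborel_eq) (simp add: nn_integral_distr)
  also have "\<dots> = (\<integral>\<^sup>+x. f (0 + (\<Sum>i\<in>set is. x (unit_vec i) *\<^sub>R unit_vec i)) \<partial>PiM (unit_vec ` set is :: (real ^ 'n) set) (\<lambda>_. lborel))"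
    unfolding assms(3) B[symmetric] by (subst sum.reindex) (auto intro: injI simp: unit_vec_inj)
  also have "\<dots> = line_ints is f 0"
    by (rule line_ints_PiM[symmetric]) (use assms in auto)
  finally show ?thesis .
qed

lemma reflect_coord_add: "reflect_coord i (x + y) = reflect_coord i x + reflect_coord i y"
  by (simp add: vec_eq_iff)

lemma reflect_coord_unit: "reflect_coord i (s *\<^sub>R unit_vec j) = (if i = j then - s else s) *\<^sub>R unit_vec j"
  by (auto simp: vec_eq_iff axis_def)

lemma line_int_even:
  fixes f :: "real ^ 'n \<Rightarrow> ennreal"
  assumes [measurable]: "f \<in> borel_measurable borel"
    and even: "\<And>x. f (reflect_coord i x) = f x" and y: "y $ i = 0"
  shows "line_int i f y = 2 * ray_int i f y"
proof -
  let ?g = "\<lambda>s. f (y + s *\<^sub>R unit_vec i)"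
  have g: "?g (- s) = ?g s" for s
  proof -
    have "reflect_coord i y = y" using y by (auto simp: vec_eq_iff)
    then show ?thesis using even[of "y + s *\<^sub>R unit_vec i"] by (simp add: reflect_coord_add reflect_coord_unit)
  qed
  have "(\<integral>\<^sup>+s. ?g s * indicator {..0} s \<partial>lborel) = ennreal \<bar>- 1\<bar> * (\<integral>\<^sup>+s. ?g (0 + - 1 * s) * indicator {..0} (0 + - 1 * s) \<partial>lborel)"
    by (rule nn_integral_real_affine) auto
  also have "\<dots> = ray_int i f y"
    using g by (simp add: ray_int_def indicator_def cong: if_cong)
  finally have neg: "(\<integral>\<^sup>+s. ?g s * indicator {..0} s \<partial>lborel) = ray_int i f y" .
  have "line_int i f y = (\<integral>\<^sup>+s. ?g s * indicator {0..} s + ?g s * indicator {..0} s \<partial>lborel)"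
    unfolding line_int_def
  proof (rule nn_integral_cong_AE, use AE_lborel_singleton[of "0::real"] in eventually_elim)
    case (elim s)
    then show ?case by (auto simp: indicator_def)
  qed
  also have "\<dots> = ray_int i f y + ray_int i f y"
    by (subst nn_integral_add) (auto simp: neg, simp add: ray_int_def)
  finally show ?thesis by (simp add: mult_2)
qed

text \<open>
The induction keeps the base point on the hyperplanes of the coordinates still to be integrated;
there, reflection symmetry folds each line onto its positive half.
\<close>

lemma line_ints_even:
  fixes f :: "real ^ 'n \<Rightarrow> ennreal"
  assumes [measurable]: "f \<in> borel_measurable borel" and even: "\<And>i x. f (reflect_coord i x) = f x"
  shows "distinct is \<Longrightarrow> (\<And>i. i \<in> set is \<Longrightarrow> y $ i = 0) \<Longrightarrow> line_ints is f y = 2 ^ length is * ray_ints is f y"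
proof (induction "is" arbitrary: y)
  case (Cons i ks)
  have refl: "line_ints ks f (reflect_coord i x) = line_ints ks f x" if "i \<notin> set ks" for ks x
    using that
  proof (induction ks arbitrary: x)
    case (Cons k ks)
    have "reflect_coord i x + s *\<^sub>R unit_vec k = reflect_coord i (x + s *\<^sub>R unit_vec k)" for s
      using Cons.prems by (simp add: reflect_coord_add reflect_coord_unit)
    then show ?case using Cons by (simp add: line_int_def)
  qed (simp add: even)
  have "line_ints (i # ks) f y = 2 * ray_int i (line_ints ks f) y"
    using Cons.prems by (simp add: line_int_even refl)
  also have "ray_int i (line_ints ks f) y = (\<integral>\<^sup>+s. 2 ^ length ks * (ray_ints ks f (y + s *\<^sub>R unit_vec i) * indicator {0..} s) \<partial>lborel)"
    unfolding ray_int_def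
  proof (rule nn_integral_cong)
    fix s
    have "line_ints ks f (y + s *\<^sub>R unit_vec i) = 2 ^ length ks * ray_ints ks f (y + s *\<^sub>R unit_vec i)"
      using Cons.prems by (intro Cons.IH) (auto simp: axis_def)
    then show "line_ints ks f (y + s *\<^sub>R unit_vec i) * indicator {0..} s =
        2 ^ length ks * (ray_ints ks f (y + s *\<^sub>R unit_vec i) * indicator {0..} s)"
      by (simp add: mult.assoc)
  qed
  also have "\<dots> = 2 ^ length ks * ray_int i (ray_ints ks f) y"
    unfolding ray_int_def by (rule nn_integral_cmult) measurable
  finally show ?case by (simp add: mult.assoc)
qed simp

text \<open>
Cauchy's formula for repeated integration.
\<close>

lemma ray_ints_replicate:
  fixes f :: "real ^ 'n \<Rightarrow> ennreal"
  assumes [measurable]: "f \<in> borel_measurable borel"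
  shows "ray_ints (replicate (Suc k) i) f y =
    (\<integral>\<^sup>+s. ennreal (s ^ k / fact k) * f (y + s *\<^sub>R unit_vec i) * indicator {0..} s \<partial>lborel)"
proof (induction k arbitrary: y)
  case 0
  then show ?case by (simp add: ray_int_def)
next
  case (Suc k)
  let ?e = "unit_vec i :: real ^ 'n"
  let ?h = "\<lambda>t u. ennreal ((u - t) ^ k / fact k) * f (y + u *\<^sub>R ?e) * indicator {0..} t * indicator {t..} u"
  have "ray_ints (replicate (Suc (Suc k)) i) f y =
    (\<integral>\<^sup>+t. (\<integral>\<^sup>+s. ennreal (s ^ k / fact k) * f (y + t *\<^sub>R ?e + s *\<^sub>R ?e) * indicator {0..} s \<partial>lborel) * indicator {0..} t \<partial>lborel)"
    unfolding replicate_Suc[of "Suc k"] ray_ints.simps(2)[of i "replicate (Suc k) i"] ray_int_def[of i "ray_ints (replicate (Suc k) i) f"]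
    by (simp only: Suc.IH)
  also have "\<dots> = (\<integral>\<^sup>+t. (\<integral>\<^sup>+u. ?h t u \<partial>lborel) \<partial>lborel)"
  proof (rule nn_integral_cong)
    fix t :: real
    have "(\<integral>\<^sup>+u. ?h t u \<partial>lborel) = ennreal \<bar>1\<bar> * (\<integral>\<^sup>+s. ?h t (t + 1 * s) \<partial>lborel)"
      by (rule nn_integral_real_affine) auto
    also have "\<dots> = (\<integral>\<^sup>+s. ennreal (s ^ k / fact k) * f (y + t *\<^sub>R ?e + s *\<^sub>R ?e) * indicator {0..} s * indicator {0..} t \<partial>lborel)"
      by (simp, intro nn_integral_cong) (auto simp: indicator_def algebra_simps)
    also have "\<dots> = (\<integral>\<^sup>+s. ennreal (s ^ k / fact k) * f (y + t *\<^sub>R ?e + s *\<^sub>R ?e) * indicator {0..} s \<partial>lborel) * indicator {0..} t"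
      by (rule nn_integral_multc) measurable
    finally show "(\<integral>\<^sup>+s. ennreal (s ^ k / fact k) * f (y + t *\<^sub>R ?e + s *\<^sub>R ?e) * indicator {0..} s \<partial>lborel) * indicator {0..} t
      = (\<integral>\<^sup>+u. ?h t u \<partial>lborel)" by simp
  qed
  also have "\<dots> = (\<integral>\<^sup>+u. (\<integral>\<^sup>+t. ?h t u \<partial>lborel) \<partial>lborel)"
    by (rule lborel_pair.Fubini'[symmetric]) (unfold indicator_def atLeast_def mem_Collect_eq, measurable)
  also have "\<dots> = (\<integral>\<^sup>+u. ennreal (u ^ Suc k / fact (Suc k)) * f (y + u *\<^sub>R ?e) * indicator {0..} u \<partial>lborel)"
  proof (rule nn_integral_cong)
    fix u :: real
    have "(\<integral>\<^sup>+t. ?h t u \<partial>lborel) = (\<integral>\<^sup>+t. f (y + u *\<^sub>R ?e) * (ennreal ((u - t) ^ k / fact k) * indicator {0..u} t) \<partial>lborel)"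
      by (intro nn_integral_cong) (auto simp: indicator_def mult_ac)
    also have "\<dots> = f (y + u *\<^sub>R ?e) * (\<integral>\<^sup>+t. ennreal ((u - t) ^ k / fact k) * indicator {0..u} t \<partial>lborel)"
      by (rule nn_integral_cmult) measurable
    also have "(\<integral>\<^sup>+t. ennreal ((u - t) ^ k / fact k) * indicator {0..u} t \<partial>lborel) = ennreal (u ^ Suc k / fact (Suc k)) * indicator {0..} u"
    proof (cases "0 \<le> u")
      case True
      have "(\<integral>\<^sup>+t. ennreal ((u - t) ^ k / fact k) * indicator {0..u} t \<partial>lborel)
          = ennreal (- ((u - u) ^ Suc k / fact (Suc k)) - (- ((u - 0) ^ Suc k / fact (Suc k))))"
      proof (rule nn_integral_FTC_Icc)
        fix t :: real
        have "((\<lambda>t. (u - t) ^ Suc k) has_real_derivative real (Suc k) * (0 - 1) * (u - t) ^ k) (at t)"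
          by (auto intro!: derivative_eq_intros simp del: power_Suc simp: algebra_simps)
        from DERIV_minus[OF DERIV_cdivide[OF this, of "fact (Suc k)"]]
        have "((\<lambda>t. - ((u - t) ^ Suc k / fact (Suc k))) has_real_derivative
            - (real (Suc k) * (0 - 1) * (u - t) ^ k / fact (Suc k))) (at t)" .
        also have "- (real (Suc k) * (0 - 1) * (u - t) ^ k / fact (Suc k)) = (u - t) ^ k / fact k"
          by (simp add: field_simps del: of_nat_Suc)
        finally show "((\<lambda>t. - ((u - t) ^ Suc k / fact (Suc k))) has_real_derivative (u - t) ^ k / fact k) (at t)" .
      qed (use True in auto)
      then show ?thesis using True by simp
    next
      case False
      then show ?thesis by simp
    qed
    finally show "(\<integral>\<^sup>+t. ?h t u \<partial>lborel) = ennreal (u ^ Suc k / fact (Suc k)) * f (y + u *\<^sub>R ?e) * indicator {0..} u"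
      by (simp add: mult_ac)
  qed
  finally show ?case .
qed

lemma ray_ints_monomial:
  fixes f :: "real ^ 'n \<Rightarrow> ennreal" and m :: "'n \<Rightarrow> nat"
  assumes "f \<in> borel_measurable borel" "distinct is" "\<And>i. i \<in> set is \<Longrightarrow> y $ i = 0"
  shows "ray_ints is (\<lambda>y. f y * (\<Prod>i\<in>set is. ennreal (\<bar>y $ i\<bar> ^ m i))) y =
    ennreal (\<Prod>i\<in>set is. fact (m i)) * ray_ints (concat (map (\<lambda>i. replicate (Suc (m i)) i) is)) f y"
  using assms
proof (induction "is" arbitrary: y f)
  case Nil
  then show ?case by simp
next
  case (Cons k ks)
  note [measurable] = Cons.prems(1)
  let ?C = "concat (map (\<lambda>i. replicate (Suc (m i)) i) ks)"
  let ?F = "\<lambda>y. f y * ennreal (\<bar>y $ k\<bar> ^ m k)"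
  have meas: "?F \<in> borel_measurable borel" by measurable
  have const: "ray_ints cs ?F y = ennreal (\<bar>y $ k\<bar> ^ m k) * ray_ints cs f y" if "k \<notin> set cs" for cs y
  proof -
    have "ray_ints cs ?F y = ray_ints cs (\<lambda>z. ennreal (\<bar>y $ k\<bar> ^ m k) * f z) y"
      by (rule ray_ints_cong_on[where S = "{z. z $ k = y $ k}"]) (use that in \<open>auto simp: axis_def mult.commute\<close>)
    then show ?thesis by (simp add: ray_ints_cmult)
  qed
  have kC: "k \<notin> set ?C" using Cons.prems by auto
  have "ray_ints (k # ks) (\<lambda>y. f y * (\<Prod>i\<in>set (k # ks). ennreal (\<bar>y $ i\<bar> ^ m i))) y =
      ray_int k (ray_ints ks (\<lambda>y. ?F y * (\<Prod>i\<in>set ks. ennreal (\<bar>y $ i\<bar> ^ m i)))) y"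
    using Cons.prems by (simp add: mult.assoc)
  also have "\<dots> = (\<integral>\<^sup>+s. ennreal ((\<Prod>i\<in>set ks. fact (m i)) * fact (m k)) *
     (ennreal (s ^ m k / fact (m k)) * ray_ints ?C f (y + s *\<^sub>R unit_vec k) * indicator {0..} s) \<partial>lborel)"
    unfolding ray_int_def
  proof (rule nn_integral_cong)
    fix s :: real
    have "ray_ints ks (\<lambda>y. ?F y * (\<Prod>i\<in>set ks. ennreal (\<bar>y $ i\<bar> ^ m i))) (y + s *\<^sub>R unit_vec k) =
        ennreal (\<Prod>i\<in>set ks. fact (m i)) * ray_ints ?C ?F (y + s *\<^sub>R unit_vec k)"
      by (rule Cons.IH[OF meas]) (use Cons.prems in \<open>auto simp: axis_def\<close>)
    also have "ray_ints ?C ?F (y + s *\<^sub>R unit_vec k) = ennreal (\<bar>s\<bar> ^ m k) * ray_ints ?C f (y + s *\<^sub>R unit_vec k)"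
      using const[OF kC] Cons.prems by simp
    finally have eq: "ray_ints ks (\<lambda>y. ?F y * (\<Prod>i\<in>set ks. ennreal (\<bar>y $ i\<bar> ^ m i))) (y + s *\<^sub>R unit_vec k) =
        ennreal (\<Prod>i\<in>set ks. fact (m i)) * (ennreal (\<bar>s\<bar> ^ m k) * ray_ints ?C f (y + s *\<^sub>R unit_vec k))" .
    have "ennreal (\<Prod>i\<in>set ks. fact (m i)) * ennreal (s ^ m k) =
        ennreal ((\<Prod>i\<in>set ks. fact (m i)) * fact (m k)) * ennreal (s ^ m k / fact (m k))" if "0 \<le> s"
      using that by (simp add: ennreal_mult[symmetric] prod_nonneg)
    then show "ray_ints ks (\<lambda>y. ?F y * (\<Prod>i\<in>set ks. ennreal (\<bar>y $ i\<bar> ^ m i))) (y + s *\<^sub>R unit_vec k) * indicator {0..} s =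
        ennreal ((\<Prod>i\<in>set ks. fact (m i)) * fact (m k)) *
        (ennreal (s ^ m k / fact (m k)) * ray_ints ?C f (y + s *\<^sub>R unit_vec k) * indicator {0..} s)"
      unfolding eq by (auto simp: indicator_def mult.assoc[symmetric])
  qed
  also have "\<dots> = ennreal ((\<Prod>i\<in>set ks. fact (m i)) * fact (m k)) *
     ray_ints (replicate (Suc (m k)) k) (ray_ints ?C f) y"
    by (subst nn_integral_cmult) (auto simp: ray_ints_replicate simp del: replicate_Suc)
  also have "\<dots> = ennreal (\<Prod>i\<in>set (k # ks). fact (m i)) * ray_ints (concat (map (\<lambda>i. replicate (Suc (m i)) i) (k # ks))) f y"
    using Cons.prems by (simp add: ray_ints_append mult.commute)
  finally show ?case .
qed

section \<open>Expansion of the Funk volume into moments\<close>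

lemma nn_integral_reflect:
  fixes f :: "real ^ 'n \<Rightarrow> ennreal"
  assumes [measurable]: "f \<in> borel_measurable borel"
  shows "(\<integral>\<^sup>+x. f (reflect_coord k x) \<partial>lborel) = (\<integral>\<^sup>+x. f x \<partial>lborel)"
proof -
  let ?c = "\<lambda>b :: real ^ 'n. if b = unit_vec k then - 1 else 1 :: real"
  have T: "(\<lambda>x :: real ^ 'n. 0 + (\<Sum>j\<in>Basis. (?c j * (x \<bullet> j)) *\<^sub>R j)) = reflect_coord k"
  proof (rule ext, rule euclidean_eqI)
    fix x b :: "real ^ 'n" assume b: "b \<in> Basis"
    then obtain i where i: "b = unit_vec i" by (auto simp: Basis_vec_def)
    have "(0 + (\<Sum>j\<in>Basis. (?c j * (x \<bullet> j)) *\<^sub>R j)) \<bullet> b = ?c b * (x \<bullet> b)"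
      using b by (simp add: inner_sum_left_Basis)
    also have "\<dots> = reflect_coord k x \<bullet> b"
      by (simp add: i inner_axis unit_vec_inj)
    finally show "(0 + (\<Sum>j\<in>Basis. (?c j * (x \<bullet> j)) *\<^sub>R j)) \<bullet> b = reflect_coord k x \<bullet> b" .
  qed
  have "(\<lambda>x. 0 + (\<Sum>j\<in>Basis. (?c j * (x \<bullet> j)) *\<^sub>R j)) \<in> borel_measurable (borel :: (real ^ 'n) measure)"
    by measurable
  then have [measurable]: "reflect_coord k \<in> borel_measurable (borel :: (real ^ 'n) measure)"
    unfolding T .
  have "(lborel :: (real ^ 'n) measure) = density (distr lborel borel (reflect_coord k)) (\<lambda>_. ennreal (\<Prod>j\<in>(Basis :: (real ^ 'n) set). \<bar>?c j\<bar>))"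
    using lborel_affine_euclidean[of ?c 0] unfolding T by auto
  also have "(\<Prod>j\<in>(Basis :: (real ^ 'n) set). \<bar>?c j\<bar>) = 1" by (intro prod.neutral) auto
  finally have "(\<integral>\<^sup>+x. f x \<partial>lborel) = (\<integral>\<^sup>+x. f x \<partial>density (distr lborel borel (reflect_coord k)) (\<lambda>_. ennreal 1))"
    by simp
  also have "\<dots> = (\<integral>\<^sup>+x. f (reflect_coord k x) \<partial>lborel)"
    by (subst nn_integral_density, measurable, subst nn_integral_distr) auto
  finally show ?thesis by simp
qed

lemma cosh_measurable [measurable]: "(cosh :: real \<Rightarrow> real) \<in> borel_measurable borel"
  by (intro borel_measurable_continuous_onI continuous_intros)

text \<open>
One coordinate of \<open>\<xi>\<close> after the other is averaged with its reflection. What remains is even in each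
coordinate, so its power series has nonnegative terms and no signs occur afterwards.
\<close>

lemma nn_integral_exp_inner_cosh:
  fixes v :: "real ^ 'n \<Rightarrow> ennreal" and x :: "real ^ 'n"
  assumes [measurable]: "v \<in> borel_measurable borel" and even: "\<And>i \<xi>. v (reflect_coord i \<xi>) = v \<xi>"
  shows "(\<integral>\<^sup>+\<xi>. v \<xi> * ennreal (exp (x \<bullet> \<xi>)) \<partial>lborel) =
    (\<integral>\<^sup>+\<xi>. v \<xi> * (\<Prod>i\<in>UNIV. ennreal (cosh (x $ i * \<xi> $ i))) \<partial>lborel)"
proof -
  let ?w = "\<lambda>J (\<xi> :: real ^ 'n). v \<xi> * (\<Prod>i\<in>J. ennreal (cosh (x $ i * \<xi> $ i)))"
  let ?e = "\<lambda>J (\<xi> :: real ^ 'n). (\<Prod>i\<in>- J. ennreal (exp (x $ i * \<xi> $ i)))"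
  have "(\<integral>\<^sup>+\<xi>. ?w J \<xi> * ?e J \<xi> \<partial>lborel) = (\<integral>\<^sup>+\<xi>. v \<xi> * ennreal (exp (x \<bullet> \<xi>)) \<partial>lborel)" if "finite J" for J
    using that
  proof (induction J)
    case empty
    have "ennreal (exp (x \<bullet> \<xi>)) = (\<Prod>i\<in>UNIV. ennreal (exp (x $ i * \<xi> $ i)))" for \<xi>
      by (simp add: inner_vec_def exp_sum prod_ennreal)
    then show ?case by simp
  next
    case (insert k J)
    let ?g = "\<lambda>\<xi>. ?w J \<xi> * ?e (insert k J) \<xi>"
    have g_even: "?g (reflect_coord k \<xi>) = ?g \<xi>" for \<xi>
      using insert by (auto simp: even intro!: arg_cong2[where f = "(*)"] prod.cong)
    have split: "- J = insert k (- insert k J)" using insert by auto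
    have e: "?e J \<xi> = ennreal (exp (x $ k * \<xi> $ k)) * ?e (insert k J) \<xi>" for \<xi>
      unfolding split by (subst prod.insert) auto
    let ?I = "\<integral>\<^sup>+\<xi>. ?g \<xi> * ennreal (exp (x $ k * \<xi> $ k)) \<partial>lborel"
    have I1: "?I = (\<integral>\<^sup>+\<xi>. v \<xi> * ennreal (exp (x \<bullet> \<xi>)) \<partial>lborel)"
    proof -
      have "?g \<xi> * ennreal (exp (x $ k * \<xi> $ k)) = ?w J \<xi> * ?e J \<xi>" for \<xi>
        unfolding e by (simp add: mult_ac)
      then show ?thesis using insert.IH by simp
    qed
    have "?I = (\<integral>\<^sup>+\<xi>. ?g (reflect_coord k \<xi>) * ennreal (exp (x $ k * reflect_coord k \<xi> $ k)) \<partial>lborel)"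
      by (rule nn_integral_reflect[symmetric]) measurable
    also have "\<dots> = (\<integral>\<^sup>+\<xi>. ?g \<xi> * ennreal (exp (- (x $ k * \<xi> $ k))) \<partial>lborel)"
      unfolding g_even by simp
    finally have I2: "?I = (\<integral>\<^sup>+\<xi>. ?g \<xi> * ennreal (exp (- (x $ k * \<xi> $ k))) \<partial>lborel)" .
    have "(\<integral>\<^sup>+\<xi>. ?w (insert k J) \<xi> * ?e (insert k J) \<xi> \<partial>lborel) = (\<integral>\<^sup>+\<xi>. ennreal (1 / 2) *
        (?g \<xi> * ennreal (exp (x $ k * \<xi> $ k)) + ?g \<xi> * ennreal (exp (- (x $ k * \<xi> $ k)))) \<partial>lborel)"
    proof (rule nn_integral_cong)
      fix \<xi> :: "real ^ 'n"
      have "ennreal (cosh (x $ k * \<xi> $ k)) = ennreal (1 / 2) * (ennreal (exp (x $ k * \<xi> $ k)) + ennreal (exp (- (x $ k * \<xi> $ k))))"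
      proof -
        let ?t = "x $ k * \<xi> $ k"
        have "cosh ?t = 1 / 2 * (exp ?t + exp (- ?t))" by (simp add: cosh_def)
        then have "ennreal (cosh ?t) = ennreal (1 / 2 * (exp ?t + exp (- ?t)))" by (rule arg_cong)
        also have "\<dots> = ennreal (1 / 2) * ennreal (exp ?t + exp (- ?t))"
          by (rule ennreal_mult) (simp_all add: add_nonneg_nonneg)
        also have "ennreal (exp ?t + exp (- ?t)) = ennreal (exp ?t) + ennreal (exp (- ?t))"
          by (rule ennreal_plus) simp_all
        finally show ?thesis .
      qed
      then show "?w (insert k J) \<xi> * ?e (insert k J) \<xi> = ennreal (1 / 2) *
        (?g \<xi> * ennreal (exp (x $ k * \<xi> $ k)) + ?g \<xi> * ennreal (exp (- (x $ k * \<xi> $ k))))"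
        using insert by (simp add: distrib_left mult_ac)
    qed
    also have "\<dots> = ennreal (1 / 2) * (?I + ?I)"
      by (subst nn_integral_cmult, measurable, subst nn_integral_add, measurable) (simp add: I2[symmetric])
    also have "\<dots> = ?I"
    proof -
      have "ennreal (1 / 2) * ennreal 2 = ennreal (1 / 2 * 2)" by (rule ennreal_mult[symmetric]) simp_all
      then have "ennreal (1 / 2) * 2 = 1" by (simp only: ennreal_numeral) simp
      then show ?thesis by (simp only: mult_2[symmetric] mult.assoc[symmetric]) simp
    qed
    finally show ?case using I1 by simp
  qed
  from this[of UNIV] show ?thesis by simp
qed

text \<open>
Taylor coefficients of the product of the hyperbolic cosines.
\<close>

definition even_weight :: "('n::finite \<Rightarrow> nat) \<Rightarrow> real" where
  "even_weight m = (\<Prod>i\<in>UNIV. if even (m i) then 1 / fact (m i) else 0)"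

definition monom_abs :: "('n::finite \<Rightarrow> nat) \<Rightarrow> real ^ 'n \<Rightarrow> real" where
  "monom_abs m x = (\<Prod>i\<in>UNIV. \<bar>x $ i\<bar> ^ m i)"

definition all_indices :: "'n::finite list" where
  "all_indices = (SOME xs. set xs = UNIV \<and> distinct xs)"

text \<open>
The list whose iterated ray integral is, up to factorials, the moment with exponents \<open>m\<close>: the entry
\<open>i\<close> occurs once more than its exponent.
\<close>

definition index_list :: "('n::finite \<Rightarrow> nat) \<Rightarrow> 'n list" where
  "index_list m = concat (map (\<lambda>i. replicate (Suc (m i)) i) all_indices)"

lemma all_indices: "set (all_indices :: 'n::finite list) = UNIV" "distinct (all_indices :: 'n list)"
proof -
  have "\<exists>xs :: 'n list. set xs = UNIV \<and> distinct xs" using finite_distinct_list[of "UNIV :: 'n set"] by auto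
  from someI_ex[OF this] show "set (all_indices :: 'n list) = UNIV" "distinct (all_indices :: 'n list)"
    by (auto simp: all_indices_def)
qed

lemma count_index_list:
  fixes m :: "'n::finite \<Rightarrow> nat"
  shows "count_list (index_list m) i = Suc (m i)"
proof -
  have rep: "count_list (replicate k a) i = (if a = i then k else 0)" for k and a :: 'n
    by (induction k) auto
  have "count_list (concat (map (\<lambda>i. replicate (Suc (m i)) i) xs)) i = (if i \<in> set xs then Suc (m i) else 0)"
    if "distinct xs" for xs
    using that by (induction xs) (auto simp: rep simp del: replicate_Suc)
  from this[OF all_indices(2)] show ?thesis by (simp add: index_list_def all_indices(1))
qed

lemma monom_abs_nonneg: "0 \<le> monom_abs m x"
  by (simp add: monom_abs_def prod_nonneg)

lemma monom_abs_measurable [measurable]: "monom_abs m \<in> borel_measurable borel"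
  unfolding monom_abs_def[abs_def] by measurable

lemma cosh_product_expansion:
  fixes x \<xi> :: "real ^ 'n"
  shows "(\<Prod>i\<in>UNIV. ennreal (cosh (x $ i * \<xi> $ i))) =
    (\<integral>\<^sup>+m. ennreal (even_weight m * monom_abs m x * monom_abs m \<xi>) \<partial>count_space UNIV)"
proof -
  interpret product_sigma_finite "\<lambda>_ :: 'n. count_space (UNIV :: nat set)"
    by (simp add: product_sigma_finite_def sigma_finite_measure_count_space)
  let ?t = "\<lambda>s n. if even n then \<bar>s\<bar> ^ n / fact n else 0 :: real"
  have cosh: "ennreal (cosh s) = (\<integral>\<^sup>+n. ennreal (?t s n) \<partial>count_space UNIV)" for s :: real
  proof -
    have "(\<lambda>n. if even n then s ^ n /\<^sub>R fact n else 0) = ?t s"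
      by (auto simp: fun_eq_iff power_even_abs field_simps)
    then have "?t s sums cosh s" using cosh_converges[of s] by simp
    then have "(\<Sum>n. ennreal (?t s n)) = ennreal (cosh s)"
      by (intro suminf_ennreal_eq) auto
    then show ?thesis by (simp add: nn_integral_count_space_nat)
  qed
  have "(\<Prod>i\<in>UNIV. ennreal (cosh (x $ i * \<xi> $ i))) =
      (\<integral>\<^sup>+m. (\<Prod>i\<in>UNIV. ennreal (?t (x $ i * \<xi> $ i) (m i))) \<partial>PiM UNIV (\<lambda>_ :: 'n. count_space UNIV))"
    unfolding cosh by (rule product_nn_integral_prod[symmetric]) auto
  also have "PiM UNIV (\<lambda>_ :: 'n. count_space (UNIV :: nat set)) = count_space UNIV"
    by (subst count_space_PiM_finite) auto
  also have "(\<lambda>m. \<Prod>i\<in>UNIV. ennreal (?t (x $ i * \<xi> $ i) (m i))) =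
      (\<lambda>m. ennreal (even_weight m * monom_abs m x * monom_abs m \<xi>))"
  proof
    fix m :: "'n \<Rightarrow> nat"
    have "(\<Prod>i\<in>UNIV. ennreal (?t (x $ i * \<xi> $ i) (m i))) = ennreal (\<Prod>i\<in>UNIV. ?t (x $ i * \<xi> $ i) (m i))"
      by (rule prod_ennreal) auto
    also have "(\<Prod>i\<in>UNIV. ?t (x $ i * \<xi> $ i) (m i)) = even_weight m * monom_abs m x * monom_abs m \<xi>"
      unfolding even_weight_def monom_abs_def prod.distrib[symmetric]
      by (rule prod.cong) (auto simp: abs_mult power_mult_distrib)
    finally show "(\<Prod>i\<in>UNIV. ennreal (?t (x $ i * \<xi> $ i) (m i))) = ennreal (even_weight m * monom_abs m x * monom_abs m \<xi>)" .
  qed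
  finally show ?thesis .
qed

lemma nn_integral_monom_abs:
  fixes f :: "real ^ 'n \<Rightarrow> ennreal"
  assumes [measurable]: "f \<in> borel_measurable borel" and even: "\<And>i x. f (reflect_coord i x) = f x"
  shows "(\<integral>\<^sup>+x. f x * ennreal (monom_abs m x) \<partial>lborel) =
    ennreal (2 ^ CARD('n) * (\<Prod>i\<in>UNIV. fact (m i))) * ray_ints (index_list m) f 0"
proof -
  let ?F = "\<lambda>x. f x * (\<Prod>i\<in>set all_indices. ennreal (\<bar>x $ i\<bar> ^ m i))"
  have meas: "?F \<in> borel_measurable borel" by measurable
  have Fx: "?F x = f x * ennreal (monom_abs m x)" for x
    by (simp add: monom_abs_def all_indices prod_ennreal)
  have len: "length (all_indices :: 'n list) = CARD('n)"
    using distinct_card[OF all_indices(2)] all_indices(1) by metis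
  have "monom_abs m (reflect_coord i x) = monom_abs m x" for i x
    unfolding monom_abs_def by (rule prod.cong) auto
  then have F_even: "?F (reflect_coord i x) = ?F x" for i x
    unfolding Fx by (simp only: even)
  have "(\<integral>\<^sup>+x. ?F x \<partial>lborel) = line_ints all_indices ?F 0"
    by (rule nn_integral_line_ints[OF meas all_indices(2,1)])
  also have "\<dots> = 2 ^ CARD('n) * ray_ints all_indices ?F 0"
    using line_ints_even[OF meas F_even all_indices(2), of 0] by (simp add: len)
  also have "ray_ints all_indices ?F 0 = ennreal (\<Prod>i\<in>UNIV. fact (m i)) * ray_ints (index_list m) f 0"
    using ray_ints_monomial[of f all_indices 0 m] by (simp add: all_indices index_list_def)
  finally show ?thesis
    unfolding Fx by (simp add: ennreal_mult prod_nonneg mult.assoc ennreal_power[symmetric])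
qed

lemma nn_integral_count_space_swap:
  fixes f :: "'m::countable \<Rightarrow> real ^ 'n \<Rightarrow> ennreal"
  assumes "\<And>m. f m \<in> borel_measurable borel"
  shows "(\<integral>\<^sup>+x. (\<integral>\<^sup>+m. f m x \<partial>count_space UNIV) \<partial>lborel) = (\<integral>\<^sup>+m. (\<integral>\<^sup>+x. f m x \<partial>lborel) \<partial>count_space UNIV)"
proof -
  interpret C: sigma_finite_measure "count_space (UNIV :: 'm set)"
    by (rule sigma_finite_measure_count_space)
  interpret pair_sigma_finite "count_space (UNIV :: 'm set)" "lborel :: (real ^ 'n) measure" ..
  have "case_prod f \<in> borel_measurable (count_space UNIV \<Otimes>\<^sub>M lborel)"
    by (rule measurable_pair_measure_countable1) (use assms in auto)
  then show ?thesis by (rule Fubini')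
qed

definition funk_coeff :: "real \<Rightarrow> ('n::finite \<Rightarrow> nat) \<Rightarrow> real" where
  "funk_coeff \<rho> m = even_weight m * (2 ^ CARD('n) * (\<Prod>i\<in>UNIV. fact (m i)))\<^sup>2 *
     \<rho> ^ length (index_list m) / fact (length (index_list m))"

text \<open>
The volume of \<open>{\<xi>. q \<xi> - x \<bullet> \<xi> \<le> 1}\<close> is an integral of \<open>exp (- q \<xi>)\<close> against products of hyperbolic
cosines of \<open>x\<^sub>i \<xi>\<^sub>i\<close>. In the power series the variables \<open>x\<close> and \<open>\<xi>\<close> separate, and each of the two
resulting moments is a Laplace integral for the same list. The power of \<open>\<rho>\<close> comes from
scaling the domain of \<open>x\<close>.
\<close>

theorem funk_integral_expansion:
  fixes p q :: "real ^ 'n \<Rightarrow> real"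
  assumes pq: "dual_pair UNIV p q" and \<rho>: "0 < \<rho>" "\<rho> \<le> 1"
  shows "ennreal (fact CARD('n)) * (\<integral>\<^sup>+x. emeasure lborel {\<xi>. q \<xi> - x \<bullet> \<xi> \<le> 1} * indicator {x. p x \<le> \<rho>} x \<partial>lborel)
    = (\<integral>\<^sup>+m. ennreal (funk_coeff \<rho> m * (laplace0 p (index_list m) * laplace0 q (index_list m))) \<partial>count_space UNIV)"
proof -
  have qp: "dual_pair UNIV q p" using pq by (rule dual_pair_sym)
  note [measurable] = dual_pair_measurable[OF pq] dual_pair_measurable[OF qp]
  let ?B = "\<lambda>m :: 'n \<Rightarrow> nat. 2 ^ CARD('n) * (\<Prod>i\<in>UNIV. fact (m i)) :: real"
  let ?c = "\<lambda>m. even_weight m * ?B m * laplace0 q (index_list m)"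
  have B: "?B m \<ge> 0" for m by (simp add: prod_nonneg)
  have ew: "even_weight m \<ge> 0" for m :: "'n \<Rightarrow> nat" by (auto simp: even_weight_def intro!: prod_nonneg)
  have Lp: "laplace0 p cs \<ge> 0" and Lq: "laplace0 q cs \<ge> 0" for cs
    using laplace0_pos[OF pq] laplace0_pos[OF qp] by (auto intro: less_imp_le)
  have vol: "ennreal (fact CARD('n)) * emeasure lborel {\<xi>. q \<xi> - x \<bullet> \<xi> \<le> 1} =
      (\<integral>\<^sup>+m. ennreal (?c m) * ennreal (monom_abs m x) \<partial>count_space UNIV)"
    if x: "p x \<le> 1" for x
  proof -
    have "x \<bullet> \<xi> \<le> q \<xi>" for \<xi>
      using dual_pair_le[OF qp, of \<xi> x] x by (simp add: inner_commute)
    then have "ennreal (fact CARD('n)) * emeasure lborel {\<xi>. q \<xi> - x \<bullet> \<xi> \<le> 1} =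
        (\<integral>\<^sup>+\<xi>. ennreal (exp (- (q \<xi> - x \<bullet> \<xi>))) \<partial>lborel)"
      by (intro volume_layer[symmetric]) (auto simp: dual_pair_scale[OF qp] algebra_simps)
    also have "\<dots> = (\<integral>\<^sup>+\<xi>. ennreal (exp (- q \<xi>)) * ennreal (exp (x \<bullet> \<xi>)) \<partial>lborel)"
      by (simp add: ennreal_mult[symmetric] exp_add[symmetric])
    also have "\<dots> = (\<integral>\<^sup>+\<xi>. ennreal (exp (- q \<xi>)) * (\<Prod>i\<in>UNIV. ennreal (cosh (x $ i * \<xi> $ i))) \<partial>lborel)"
      by (rule nn_integral_exp_inner_cosh) (auto simp: dual_pairD(3)[OF qp])
    also have "\<dots> = (\<integral>\<^sup>+\<xi>. (\<integral>\<^sup>+m. ennreal (even_weight m * monom_abs m x) * (ennreal (exp (- q \<xi>)) * ennreal (monom_abs m \<xi>)) \<partial>count_space UNIV) \<partial>lborel)"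
      unfolding cosh_product_expansion
      by (subst nn_integral_cmult[symmetric])
        (auto simp: ennreal_mult[symmetric] ew monom_abs_nonneg mult_ac)
    also have "\<dots> = (\<integral>\<^sup>+m. (\<integral>\<^sup>+\<xi>. ennreal (even_weight m * monom_abs m x) * (ennreal (exp (- q \<xi>)) * ennreal (monom_abs m \<xi>)) \<partial>lborel) \<partial>count_space UNIV)"
      by (rule nn_integral_count_space_swap) measurable
    also have "\<dots> = (\<integral>\<^sup>+m. ennreal (?c m) * ennreal (monom_abs m x) \<partial>count_space UNIV)"
    proof (rule nn_integral_cong)
      fix m :: "'n \<Rightarrow> nat"
      have "(\<integral>\<^sup>+\<xi>. ennreal (exp (- q \<xi>)) * ennreal (monom_abs m \<xi>) \<partial>lborel) = ennreal (?B m) * laplace (index_list m) q 0"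
        unfolding laplace_def by (rule nn_integral_monom_abs) (auto simp: dual_pairD(3)[OF qp])
      also have "\<dots> = ennreal (?B m * laplace0 q (index_list m))"
        by (simp add: laplace0_eq[OF qp] ennreal_mult[symmetric] B Lq)
      finally show "(\<integral>\<^sup>+\<xi>. ennreal (even_weight m * monom_abs m x) * (ennreal (exp (- q \<xi>)) * ennreal (monom_abs m \<xi>)) \<partial>lborel)
        = ennreal (?c m) * ennreal (monom_abs m x)"
        by (subst nn_integral_cmult)
          (auto simp: ennreal_mult[symmetric] ew monom_abs_nonneg B Lq prod_nonneg mult_ac)
    qed
    finally show ?thesis .
  qed
  have mono: "(\<integral>\<^sup>+x. indicator {x. p x \<le> \<rho>} x * ennreal (monom_abs m x) \<partial>lborel) =
      ennreal (?B m * \<rho> ^ length (index_list m) / fact (length (index_list m)) * laplace0 p (index_list m))" for m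
  proof -
    let ?N = "length (index_list m)"
    have "(\<integral>\<^sup>+x. indicator {x. p x \<le> \<rho>} x * ennreal (monom_abs m x) \<partial>lborel) =
        ennreal (?B m) * ray_ints (index_list m) (indicator {x. p x \<le> \<rho>}) 0"
      by (rule nn_integral_monom_abs) (auto simp: dual_pairD(3)[OF pq] indicator_def)
    also have "ray_ints (index_list m) (indicator {x. p x \<le> \<rho>}) 0 =
        ennreal (\<rho> ^ ?N) * ray_ints (index_list m) (\<lambda>x. indicator {x. p x \<le> \<rho>} (\<rho> *\<^sub>R x)) 0"
      using ray_ints_scale[of "indicator {x. p x \<le> \<rho>}" \<rho> "index_list m" 0] \<rho> by simp
    also have "(\<lambda>x. indicator {x. p x \<le> \<rho>} (\<rho> *\<^sub>R x)) = (indicator {x. p x \<le> 1} :: real ^ 'n \<Rightarrow> ennreal)"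
      using \<rho> by (auto simp: fun_eq_iff indicator_def dual_pair_scale[OF pq])
    also have "ray_ints (index_list m) (indicator {x. p x \<le> 1}) 0 = ennreal (laplace0 p (index_list m) / fact ?N)"
    proof -
      let ?r = "ray_ints (index_list m) (indicator {x. p x \<le> 1}) 0"
      have "ennreal (1 / fact ?N) * (ennreal (fact ?N) * ?r) = ennreal (1 / fact ?N) * ennreal (laplace0 p (index_list m))"
        using laplace_eq_unit_ball[OF pq, of "index_list m"] by (simp add: laplace0_eq[OF pq])
      then show ?thesis by (simp add: mult.assoc[symmetric] ennreal_mult[symmetric] Lp)
    qed
    finally show ?thesis
      using \<rho> by (simp add: ennreal_mult[symmetric] B Lp mult_ac prod_nonneg)
  qed
  have "ennreal (fact CARD('n)) * (\<integral>\<^sup>+x. emeasure lborel {\<xi>. q \<xi> - x \<bullet> \<xi> \<le> 1} * indicator {x. p x \<le> \<rho>} x \<partial>lborel)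
      = (\<integral>\<^sup>+x. ennreal (fact CARD('n)) * emeasure lborel {\<xi>. q \<xi> - x \<bullet> \<xi> \<le> 1} * indicator {x. p x \<le> \<rho>} x \<partial>lborel)"
  proof -
    have "(\<lambda>x. emeasure lborel {\<xi>. q \<xi> - x \<bullet> \<xi> \<le> 1}) = (\<lambda>x. \<integral>\<^sup>+\<xi>. indicator {z. q (snd z) - fst z \<bullet> snd z \<le> 1} (x, \<xi>) \<partial>lborel)"
    proof
      fix x
      have "emeasure lborel {\<xi>. q \<xi> - x \<bullet> \<xi> \<le> 1} = (\<integral>\<^sup>+\<xi>. indicator {\<xi>. q \<xi> - x \<bullet> \<xi> \<le> 1} \<xi> \<partial>lborel)" by simp
      then show "emeasure lborel {\<xi>. q \<xi> - x \<bullet> \<xi> \<le> 1} = (\<integral>\<^sup>+\<xi>. indicator {z. q (snd z) - fst z \<bullet> snd z \<le> 1} (x, \<xi>) \<partial>lborel)"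
        by (simp add: indicator_def)
    qed
    also have "\<dots> \<in> borel_measurable borel"
      unfolding indicator_def mem_Collect_eq fst_conv snd_conv by measurable
    finally have [measurable]: "(\<lambda>x. emeasure lborel {\<xi>. q \<xi> - x \<bullet> \<xi> \<le> 1}) \<in> borel_measurable borel" .
    show ?thesis by (subst nn_integral_cmult[symmetric]) (auto simp: mult.assoc)
  qed
  also have "\<dots> = (\<integral>\<^sup>+x. (\<integral>\<^sup>+m. ennreal (?c m) *
      (indicator {x. p x \<le> \<rho>} x * ennreal (monom_abs m x)) \<partial>count_space UNIV) \<partial>lborel)"
  proof (rule nn_integral_cong)
    fix x
    show "ennreal (fact CARD('n)) * emeasure lborel {\<xi>. q \<xi> - x \<bullet> \<xi> \<le> 1} * indicator {x. p x \<le> \<rho>} x =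
      (\<integral>\<^sup>+m. ennreal (?c m) * (indicator {x. p x \<le> \<rho>} x * ennreal (monom_abs m x)) \<partial>count_space UNIV)"
      using vol[of x] \<rho> by (cases "p x \<le> \<rho>") auto
  qed
  also have "\<dots> = (\<integral>\<^sup>+m. (\<integral>\<^sup>+x. ennreal (?c m) *
      (indicator {x. p x \<le> \<rho>} x * ennreal (monom_abs m x)) \<partial>lborel) \<partial>count_space UNIV)"
    by (rule nn_integral_count_space_swap) measurable
  also have "\<dots> = (\<integral>\<^sup>+m. ennreal (funk_coeff \<rho> m * (laplace0 p (index_list m) * laplace0 q (index_list m))) \<partial>count_space UNIV)"
  proof (rule nn_integral_cong)
    fix m :: "'n \<Rightarrow> nat"
    let ?N = "length (index_list m)"
    have "(\<integral>\<^sup>+x. ennreal (?c m) * (indicator {x. p x \<le> \<rho>} x * ennreal (monom_abs m x)) \<partial>lborel)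
      = ennreal (?c m) * ennreal (?B m * \<rho> ^ ?N / fact ?N * laplace0 p (index_list m))"
      unfolding mono[symmetric] by (rule nn_integral_cmult) measurable
    also have "\<dots> = ennreal ((?c m) * (?B m * \<rho> ^ ?N / fact ?N * laplace0 p (index_list m)))"
      by (rule ennreal_mult[symmetric]) (use ew B Lq Lp \<rho> in \<open>auto intro!: mult_nonneg_nonneg divide_nonneg_nonneg simp: prod_nonneg\<close>)
    also have "(?c m) * (?B m * \<rho> ^ ?N / fact ?N * laplace0 p (index_list m)) =
        funk_coeff \<rho> m * (laplace0 p (index_list m) * laplace0 q (index_list m))"
      by (simp add: funk_coeff_def power2_eq_square)
    finally show "(\<integral>\<^sup>+x. ennreal (?c m) * (indicator {x. p x \<le> \<rho>} x * ennreal (monom_abs m x)) \<partial>lborel)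
      = ennreal (funk_coeff \<rho> m * (laplace0 p (index_list m) * laplace0 q (index_list m)))" .
  qed
  finally show ?thesis .
qed

section \<open>Hanner polytopes are extremal\<close>

text \<open>
Each ray moves only one of the two projections, so the integration variables separate.
\<close>

lemma ray_ints_proj_product:
  fixes F G :: "real ^ 'n \<Rightarrow> ennreal"
  assumes [measurable]: "F \<in> borel_measurable borel" "G \<in> borel_measurable borel"
    and disj: "I \<inter> J = {}" and "set cs \<subseteq> I \<union> J"
  shows "ray_ints cs (\<lambda>y. F (proj_on I y) * G (proj_on J y)) y =
    ray_ints (filter (\<lambda>i. i \<in> I) cs) F (proj_on I y) * ray_ints (filter (\<lambda>i. i \<in> J) cs) G (proj_on J y)"
  using assms(4)
proof (induction cs arbitrary: y)
  case (Cons c cs)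
  let ?f = "ray_ints (filter (\<lambda>i. i \<in> I) cs) F" and ?g = "ray_ints (filter (\<lambda>i. i \<in> J) cs) G"
  have step: "proj_on A (y + s *\<^sub>R unit_vec c) = proj_on A y + (if c \<in> A then s else 0) *\<^sub>R unit_vec c" for A s
    by (auto simp: vec_eq_iff axis_def)
  have "ray_ints (c # cs) (\<lambda>y. F (proj_on I y) * G (proj_on J y)) y =
     (\<integral>\<^sup>+s. ?f (proj_on I y + (if c \<in> I then s else 0) *\<^sub>R unit_vec c) * ?g (proj_on J y + (if c \<in> J then s else 0) *\<^sub>R unit_vec c) * indicator {0..} s \<partial>lborel)"
    using Cons by (simp add: ray_int_def step)
  also have "\<dots> = ray_ints (filter (\<lambda>i. i \<in> I) (c # cs)) F (proj_on I y) * ray_ints (filter (\<lambda>i. i \<in> J) (c # cs)) G (proj_on J y)"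
  proof (cases "c \<in> I")
    case True
    then have "c \<notin> J" using disj by auto
    have "(\<integral>\<^sup>+s. ?f (proj_on I y + s *\<^sub>R unit_vec c) * ?g (proj_on J y) * indicator {0..} s \<partial>lborel)
        = (\<integral>\<^sup>+s. ?f (proj_on I y + s *\<^sub>R unit_vec c) * indicator {0..} s * ?g (proj_on J y) \<partial>lborel)"
      by (simp add: mult_ac)
    also have "\<dots> = (\<integral>\<^sup>+s. ?f (proj_on I y + s *\<^sub>R unit_vec c) * indicator {0..} s \<partial>lborel) * ?g (proj_on J y)"
      by (rule nn_integral_multc) measurable
    finally show ?thesis using True \<open>c \<notin> J\<close> by (simp add: ray_int_def)
  next
    case False
    then have "c \<in> J" using Cons.prems by auto
    have "(\<integral>\<^sup>+s. ?f (proj_on I y) * ?g (proj_on J y + s *\<^sub>R unit_vec c) * indicator {0..} s \<partial>lborel)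
        = (\<integral>\<^sup>+s. ?f (proj_on I y) * (?g (proj_on J y + s *\<^sub>R unit_vec c) * indicator {0..} s) \<partial>lborel)"
      by (simp add: mult_ac)
    also have "\<dots> = ?f (proj_on I y) * (\<integral>\<^sup>+s. ?g (proj_on J y + s *\<^sub>R unit_vec c) * indicator {0..} s \<partial>lborel)"
      by (rule nn_integral_cmult) measurable
    finally show ?thesis using False \<open>c \<in> J\<close> by (simp add: ray_int_def)
  qed
  finally show ?case .
qed simp

lemma multinomial_split:
  assumes disj: "I \<inter> J = {}" and cs: "set cs \<subseteq> I \<union> J"
  defines "as \<equiv> filter (\<lambda>i. i \<in> I) cs" and "bs \<equiv> filter (\<lambda>i. i \<in> J) cs"
  shows "multinomial cs = fact (length cs) / (fact (length as) * fact (length bs)) * (multinomial as * multinomial bs)"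
proof -
  have cnt: "count_list (filter (\<lambda>i. i \<in> A) cs) i = (if i \<in> A then count_list cs i else 0)" for A i
    by (induction cs) auto
  have "(\<Prod>i\<in>UNIV. fact (count_list cs i) :: real) = (\<Prod>i\<in>UNIV. fact (count_list as i)) * (\<Prod>i\<in>UNIV. fact (count_list bs i))"
    unfolding prod.distrib[symmetric]
  proof (rule prod.cong)
    fix i
    have "i \<notin> I \<or> i \<notin> J" using disj by auto
    moreover have "count_list cs i = 0" if "i \<notin> I" "i \<notin> J"
      using that cs count_list_pos_iff[of cs i] by auto
    ultimately show "fact (count_list cs i) = (fact (count_list as i) * fact (count_list bs i) :: real)"
      by (auto simp: as_def bs_def cnt)
  qed simp
  then show ?thesis by (simp add: multinomial_def)
qed

text \<open>
The second condition is equality in \<open>laplace_product_ge\<close>, for the lists that live on the coordinate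
subspace of \<open>I\<close>.
\<close>

definition hanner_gauges :: "'n set \<Rightarrow> (real ^ 'n \<Rightarrow> real) \<Rightarrow> (real ^ 'n \<Rightarrow> real) \<Rightarrow> bool" where
  "hanner_gauges I p q \<longleftrightarrow> dual_pair I p q \<and>
     (\<forall>cs. set cs \<subseteq> I \<longrightarrow> laplace cs p 0 * laplace cs q 0 = ennreal (multinomial cs))"

lemma hanner_gauges_sym: "hanner_gauges I p q \<Longrightarrow> hanner_gauges I q p"
  by (auto simp: hanner_gauges_def dual_pair_sym mult.commute)

lemma ray_ints_exp_replicate:
  assumes "c > 0"
  shows "0 \<le> y $ i \<Longrightarrow> ray_ints (replicate k i) (\<lambda>y. ennreal (exp (- (c * \<bar>y $ i\<bar>)))) y =
    ennreal ((1 / c) ^ k * exp (- (c * (y $ i))))"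
proof (induction k arbitrary: y)
  case (Suc k)
  let ?f = "ray_ints (replicate k i) (\<lambda>y. ennreal (exp (- (c * \<bar>y $ i\<bar>))))"
  have "ray_ints (replicate (Suc k) i) (\<lambda>y. ennreal (exp (- (c * \<bar>y $ i\<bar>)))) y =
      (\<integral>\<^sup>+s. ennreal ((1 / c) ^ k * exp (- (c * (y $ i)))) * (ennreal (exp (- c * s)) * indicator {0..} s) \<partial>lborel)"
    unfolding replicate_Suc ray_ints.simps ray_int_def
  proof (rule nn_integral_cong)
    fix s :: real
    have "?f (y + s *\<^sub>R unit_vec i) = ennreal ((1 / c) ^ k * exp (- (c * (y $ i))) * exp (- c * s))" if "0 \<le> s"
      using Suc.IH[of "y + s *\<^sub>R unit_vec i"] Suc.prems that by (simp add: algebra_simps exp_add[symmetric])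
    then show "?f (y + s *\<^sub>R unit_vec i) * indicator {0..} s =
        ennreal ((1 / c) ^ k * exp (- (c * (y $ i)))) * (ennreal (exp (- c * s)) * indicator {0..} s)"
      using assms by (auto simp: indicator_def ennreal_mult[symmetric])
  qed
  also have "\<dots> = ennreal ((1 / c) ^ k * exp (- (c * (y $ i)))) * ennreal (1 / c)"
    by (subst nn_integral_cmult) (use nn_integral_exp_ray[OF assms] in auto)
  also have "\<dots> = ennreal ((1 / c) ^ Suc k * exp (- (c * (y $ i))))"
    using assms by (simp add: ennreal_mult[symmetric])
  finally show ?case .
qed simp

lemma hanner_gauges_segment:
  fixes i :: "'n::finite"
  assumes "a > 0"
  shows "hanner_gauges {i} (\<lambda>x :: real ^ 'n. (1 / a) * \<bar>x $ i\<bar>) (\<lambda>x. a * \<bar>x $ i\<bar>)"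
proof -
  have gauge: "gauge_of_polar {i} (\<lambda>x :: real ^ 'n. c * \<bar>x $ i\<bar>) (\<lambda>x. d * \<bar>x $ i\<bar>)"
    if cd: "c > 0" "d > 0" "c * d = 1" for c d :: real
    unfolding gauge_of_polar_def
  proof (intro conjI ballI allI)
    show "continuous_on UNIV (\<lambda>x :: real ^ 'n. c * \<bar>x $ i\<bar>)" by (intro continuous_intros)
    fix x \<xi> :: "real ^ 'n" assume x: "x \<in> coord_subspace {i}"
    have inner: "x \<bullet> \<xi> = x $ i * \<xi> $ i" for \<xi>
    proof -
      have "x \<bullet> \<xi> = (\<Sum>j\<in>{i}. x $ j * \<xi> $ j)"
        unfolding inner_vec_def inner_real_def
        by (rule sum.mono_neutral_right) (use x in \<open>auto simp: coord_subspace_def\<close>)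
      then show ?thesis by simp
    qed
    have "x $ i * \<xi> $ i \<le> \<bar>x $ i\<bar> * \<bar>\<xi> $ i\<bar>" by (metis abs_ge_self abs_mult)
    also have "\<dots> = (c * d) * (\<bar>x $ i\<bar> * \<bar>\<xi> $ i\<bar>)" using cd by simp
    finally show "x \<bullet> \<xi> \<le> c * \<bar>x $ i\<bar> * (d * \<bar>\<xi> $ i\<bar>)" by (simp add: inner mult_ac)
    have "d * c = 1" using cd by (simp add: mult.commute)
    then show "\<exists>\<xi>\<in>coord_subspace {i}. d * \<bar>\<xi> $ i\<bar> \<le> 1 \<and> x \<bullet> \<xi> = c * \<bar>x $ i\<bar>"
      using cd by (intro bexI[of _ "axis i (sgn (x $ i) * c)"])
        (auto simp: inner coord_subspace_closed abs_mult sgn_if)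
  qed (use cd in auto)
  have "laplace cs (\<lambda>x. (1 / a) * \<bar>x $ i\<bar>) 0 * laplace cs (\<lambda>x. a * \<bar>x $ i\<bar>) 0 = ennreal (multinomial cs)"
    if "set cs \<subseteq> {i}" for cs :: "'n list"
  proof -
    define k where "k = length cs"
    have cs: "cs = replicate k i" unfolding k_def by (rule replicate_eqI) (use that in auto)
    have "count_list cs j = (if j = i then k else 0)" for j
      unfolding cs by (induction k) auto
    then have "(\<Prod>j\<in>UNIV. fact (count_list cs j) :: real) = (\<Prod>j\<in>UNIV. if j = i then fact k else 1)"
      by (intro prod.cong) auto
    then have "multinomial cs = 1" by (simp add: multinomial_def k_def)
    moreover have "laplace cs (\<lambda>x. c * \<bar>x $ i\<bar>) 0 = ennreal ((1 / c) ^ k)" if "c > 0" for c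
      using ray_ints_exp_replicate[OF that, of 0 i k] by (simp add: laplace_def cs)
    from this[of "1 / a"] this[of a]
    have "laplace cs (\<lambda>x. (1 / a) * \<bar>x $ i\<bar>) 0 * laplace cs (\<lambda>x. a * \<bar>x $ i\<bar>) 0 = ennreal (a ^ k * (1 / a) ^ k)"
      using assms by (simp add: ennreal_mult)
    moreover have "a ^ k * (1 / a) ^ k = 1" using assms by (simp add: power_mult_distrib[symmetric])
    ultimately show ?thesis by simp
  qed
  then show ?thesis using gauge[of "1 / a" a] gauge[of a "1 / a"] assms
    by (simp add: hanner_gauges_def dual_pair_def)
qed

lemma proj_on_reflect: "proj_on I (reflect_coord i x) = (if i \<in> I then reflect_coord i (proj_on I x) else proj_on I x)"
  by (auto simp: vec_eq_iff)

lemma continuous_on_proj_on: "continuous_on UNIV (proj_on I :: real ^ 'n \<Rightarrow> real ^ 'n)"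
proof -
  have "continuous_on UNIV (\<lambda>x :: real ^ 'n. if i \<in> I then x $ i else 0)" for i
    by (cases "i \<in> I") (auto intro!: continuous_intros)
  then show ?thesis
    unfolding proj_on_def[abs_def] by (intro continuous_on_vec_lambda)
qed

text \<open>
The polar of a product is the \<open>\<ell>\<^sub>1\<close>-sum of the polars. For the sum of two gauges the exponentials
factorise; for the maximum the indicators of the unit balls do. Passing between the two forms
produces the factorials by which the multinomial coefficient of the whole list exceeds the product
of those of its two parts.
\<close>

lemma hanner_gauges_product:
  fixes pA qA pB qB :: "real ^ 'n \<Rightarrow> real"
  assumes A: "hanner_gauges I pA qA" and B: "hanner_gauges J pB qB" and disj: "I \<inter> J = {}"
  shows "hanner_gauges (I \<union> J) (\<lambda>x. max (pA (proj_on I x)) (pB (proj_on J x))) (\<lambda>x. qA (proj_on I x) + qB (proj_on J x))"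
    (is "hanner_gauges ?K ?p ?q")
proof -
  have dA: "dual_pair I pA qA" and dB: "dual_pair J pB qB" using A B by (auto simp: hanner_gauges_def)
  have dA': "dual_pair I qA pA" and dB': "dual_pair J qB pB" using dA dB by (auto intro: dual_pair_sym)
  note nn = dual_pairD(2)[OF dA] dual_pairD(2)[OF dB] dual_pairD(2)[OF dA'] dual_pairD(2)[OF dB']
  note cont = dual_pairD(1)[OF dA] dual_pairD(1)[OF dB] dual_pairD(1)[OF dA'] dual_pairD(1)[OF dB']
  note refl = dual_pairD(3)[OF dA] dual_pairD(3)[OF dB] dual_pairD(3)[OF dA'] dual_pairD(3)[OF dB']
  have c: "continuous_on UNIV (\<lambda>x. f (proj_on A x))" if "continuous_on UNIV f" for f :: "real ^ 'n \<Rightarrow> real" and A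
    using continuous_on_compose2[OF that continuous_on_proj_on] by simp
  note proj_sum = proj_on_add[OF disj]
  have sub: "x \<in> coord_subspace ?K" if "x \<in> coord_subspace I \<or> x \<in> coord_subspace J" for x :: "real ^ 'n"
    using that by (auto simp: coord_subspace_def)
  have le: "x \<bullet> \<xi> \<le> ?p x * ?q \<xi>" if x: "x \<in> coord_subspace ?K" for x \<xi>
  proof -
    have "x \<bullet> \<xi> = proj_on I x \<bullet> proj_on I \<xi> + proj_on J x \<bullet> proj_on J \<xi>"
      by (rule inner_proj_split[OF disj x])
    also have "\<dots> \<le> pA (proj_on I x) * qA (proj_on I \<xi>) + pB (proj_on J x) * qB (proj_on J \<xi>)"
      using dual_pairD(4)[OF dA] dual_pairD(4)[OF dB] by (intro add_mono) auto
    also have "\<dots> \<le> ?p x * qA (proj_on I \<xi>) + ?p x * qB (proj_on J \<xi>)"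
      using nn by (intro add_mono mult_right_mono) auto
    finally show ?thesis by (simp add: distrib_left)
  qed
  have pair: "dual_pair ?K ?p ?q"
    unfolding dual_pair_def
  proof
    show "gauge_of_polar ?K ?p ?q"
      unfolding gauge_of_polar_def
    proof (intro conjI allI ballI)
      show "continuous_on UNIV ?p" by (intro continuous_on_max c cont)
      show "0 \<le> ?p x" for x using nn by (auto simp: le_max_iff_disj)
      show "?p (reflect_coord i x) = ?p x" for i x by (auto simp: proj_on_reflect refl)
      fix x :: "real ^ 'n" assume x: "x \<in> coord_subspace ?K"
      show "x \<bullet> \<xi> \<le> ?p x * ?q \<xi>" for \<xi> by (rule le[OF x])
      show "\<exists>\<xi>\<in>coord_subspace ?K. ?q \<xi> \<le> 1 \<and> x \<bullet> \<xi> = ?p x"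
      proof (cases "pA (proj_on I x) \<ge> pB (proj_on J x)")
        case True
        obtain \<xi> where xi: "\<xi> \<in> coord_subspace I" "qA \<xi> \<le> 1" "proj_on I x \<bullet> \<xi> = pA (proj_on I x)"
          using dual_pairD(5)[OF dA, of "proj_on I x"] by auto
        have "proj_on I \<xi> = \<xi>" "proj_on J \<xi> = 0" using proj_sum[of \<xi> 0] xi(1) by (simp_all add: coord_subspace_closed)
        then show ?thesis
          using xi True sub dual_pair_zero[OF dB'] inner_proj_split[OF disj x, of \<xi>]
          by (intro bexI[of _ \<xi>]) auto
      next
        case False
        obtain \<xi> where xi: "\<xi> \<in> coord_subspace J" "qB \<xi> \<le> 1" "proj_on J x \<bullet> \<xi> = pB (proj_on J x)"
          using dual_pairD(5)[OF dB, of "proj_on J x"] by auto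
        have "proj_on I \<xi> = 0" "proj_on J \<xi> = \<xi>" using proj_sum[of 0 \<xi>] xi(1) by (simp_all add: coord_subspace_closed)
        then show ?thesis
          using xi False sub dual_pair_zero[OF dA'] inner_proj_split[OF disj x, of \<xi>]
          by (intro bexI[of _ \<xi>]) auto
      qed
    qed
    show "gauge_of_polar ?K ?q ?p"
      unfolding gauge_of_polar_def
    proof (intro conjI allI ballI)
      show "continuous_on UNIV ?q" by (intro continuous_on_add c cont)
      show "0 \<le> ?q x" for x using nn by (auto intro: add_nonneg_nonneg)
      show "?q (reflect_coord i x) = ?q x" for i x by (auto simp: proj_on_reflect refl)
      fix \<xi> :: "real ^ 'n" assume xi: "\<xi> \<in> coord_subspace ?K"
      show "\<xi> \<bullet> x \<le> ?q \<xi> * ?p x" if "x \<in> coord_subspace ?K" for x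
        using le[OF that, of \<xi>] by (simp add: inner_commute mult.commute)
      obtain x where x: "x \<in> coord_subspace I" "pA x \<le> 1" "proj_on I \<xi> \<bullet> x = qA (proj_on I \<xi>)"
        using dual_pairD(5)[OF dA', of "proj_on I \<xi>"] by auto
      obtain y where y: "y \<in> coord_subspace J" "pB y \<le> 1" "proj_on J \<xi> \<bullet> y = qB (proj_on J \<xi>)"
        using dual_pairD(5)[OF dB', of "proj_on J \<xi>"] by auto
      show "\<exists>x\<in>coord_subspace ?K. ?p x \<le> 1 \<and> \<xi> \<bullet> x = ?q \<xi>"
        using x y sub inner_proj_split[OF disj xi, of "x + y"]
        by (intro bexI[of _ "x + y"]) (auto simp: proj_sum coord_subspace_closed)
    qed
  qed
  have "laplace cs ?p 0 * laplace cs ?q 0 = ennreal (multinomial cs)" if cs: "set cs \<subseteq> ?K" for cs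
  proof -
    define as where "as = filter (\<lambda>i. i \<in> I) cs"
    define bs where "bs = filter (\<lambda>i. i \<in> J) cs"
    have as: "set as \<subseteq> I" and bs: "set bs \<subseteq> J" by (auto simp: as_def bs_def)
    note [measurable] = dual_pair_measurable[OF dA] dual_pair_measurable[OF dB] dual_pair_measurable[OF dA'] dual_pair_measurable[OF dB']
    have proj0: "proj_on A 0 = (0 :: real ^ 'n)" for A by (simp add: vec_eq_iff)
    have "laplace cs ?q 0 = ray_ints cs (\<lambda>y. ennreal (exp (- qA (proj_on I y))) * ennreal (exp (- qB (proj_on J y)))) 0"
      unfolding laplace_def by (simp add: ennreal_mult[symmetric] exp_add[symmetric])
    also have "\<dots> = laplace as qA 0 * laplace bs qB 0"
      unfolding laplace_def as_def bs_def
      by (subst ray_ints_proj_product[OF _ _ disj cs]) (auto simp: proj0)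
    finally have q: "laplace cs ?q 0 = laplace as qA 0 * laplace bs qB 0" .
    let ?a = "ray_ints as (indicator {y. pA y \<le> 1}) 0" and ?b = "ray_ints bs (indicator {y. pB y \<le> 1}) 0"
    let ?N = "fact (length cs) :: real" and ?NA = "fact (length as) :: real" and ?NB = "fact (length bs) :: real"
    have "ray_ints cs (indicator {y. ?p y \<le> 1}) 0 =
        ray_ints cs (\<lambda>y. indicator {y. pA y \<le> 1} (proj_on I y) * indicator {y. pB y \<le> 1} (proj_on J y)) 0"
      by (rule arg_cong[where f = "\<lambda>f. ray_ints cs f 0"]) (auto simp: fun_eq_iff indicator_def)
    also have "\<dots> = ?a * ?b"
      unfolding as_def bs_def
      by (subst ray_ints_proj_product[OF _ _ disj cs]) (auto simp: proj0)
    finally have "laplace cs ?p 0 = ennreal ?N * (?a * ?b)"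
      using laplace_eq_unit_ball[OF pair cs] by simp
    also have "\<dots> = ennreal (?N / (?NA * ?NB)) * ((ennreal ?NA * ?a) * (ennreal ?NB * ?b))"
    proof -
      have "ennreal ?N = ennreal (?N / (?NA * ?NB)) * (ennreal ?NA * ennreal ?NB)"
        by (simp add: ennreal_mult[symmetric])
      then show ?thesis by (simp add: mult_ac)
    qed
    also have "\<dots> = ennreal (?N / (?NA * ?NB)) * (laplace as pA 0 * laplace bs pB 0)"
      using laplace_eq_unit_ball[OF dA as] laplace_eq_unit_ball[OF dB bs] by simp
    finally have "laplace cs ?p 0 * laplace cs ?q 0 =
        ennreal (?N / (?NA * ?NB)) * ((laplace as pA 0 * laplace as qA 0) * (laplace bs pB 0 * laplace bs qB 0))"
      unfolding q by (simp add: mult_ac)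
    also have "\<dots> = ennreal (?N / (?NA * ?NB)) * (ennreal (multinomial as) * ennreal (multinomial bs))"
      using A B as bs by (simp add: hanner_gauges_def)
    also have "\<dots> = ennreal (multinomial cs)"
      using multinomial_split[OF disj cs] multinomial_pos[of as] multinomial_pos[of bs]
      by (simp add: as_def[symmetric] bs_def[symmetric] ennreal_mult[symmetric])
    finally show ?thesis .
  qed
  with pair show ?thesis by (simp add: hanner_gauges_def)
qed

theorem hanner_on_gauges:
  assumes "hanner_on I A"
  shows "\<exists>p q. hanner_gauges I p q \<and> A = {x \<in> coord_subspace I. p x \<le> 1}"
  using assms
proof induction
  case (segment a i)
  have "closed_segment (axis i (- a)) (axis i a) = {x \<in> coord_subspace {i}. (1 / a) * \<bar>x $ i\<bar> \<le> 1}"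
    unfolding closed_segment_axis[OF segment] using segment by (auto simp: field_simps)
  then show ?case using hanner_gauges_segment[OF segment] by blast
next
  case (product I A J B)
  then obtain pA qA pB qB where A: "hanner_gauges I pA qA" "A = {x \<in> coord_subspace I. pA x \<le> 1}"
    and B: "hanner_gauges J pB qB" "B = {x \<in> coord_subspace J. pB x \<le> 1}" by blast
  have "{x + y | x y. x \<in> A \<and> y \<in> B} = {x \<in> coord_subspace (I \<union> J). max (pA (proj_on I x)) (pB (proj_on J x)) \<le> 1}"
    unfolding A(2) B(2) using product by (intro product_unit_balls)
  then show ?case using hanner_gauges_product[OF A(1) B(1)] product by blast
next
  case (polar I A)
  then obtain p q where pq: "hanner_gauges I p q" "A = {x \<in> coord_subspace I. p x \<le> 1}" by blast
  then have "polar A \<inter> coord_subspace I = {x \<in> coord_subspace I. q x \<le> 1}"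
    using polar_unit_ball[of I p q] by (simp add: hanner_gauges_def)
  then show ?case using hanner_gauges_sym[OF pq(1)] by blast
qed

corollary hanner_polytope_extremal:
  fixes H :: "(real ^ 'n) set"
  assumes "hanner_polytope H"
  shows "\<exists>p q. laplace_extremal p q \<and> H = {x. p x \<le> 1}"
proof -
  obtain p q where h: "hanner_gauges UNIV p q" and H: "H = {x. p x \<le> 1}"
    using hanner_on_gauges[of UNIV H] assms by (auto simp: hanner_polytope_def)
  have pq: "dual_pair UNIV p q" using h by (simp add: hanner_gauges_def)
  have "laplace0 p cs * laplace0 q cs = multinomial cs" for cs
  proof -
    have "ennreal (laplace0 p cs * laplace0 q cs) = ennreal (multinomial cs)"
      using h laplace0_pos[OF pq, of cs] laplace0_pos[OF dual_pair_sym[OF pq], of cs]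
      by (simp add: hanner_gauges_def laplace0_eq[OF pq] laplace0_eq[OF dual_pair_sym[OF pq]] ennreal_mult)
    then show ?thesis
      using laplace0_pos[OF pq, of cs] laplace0_pos[OF dual_pair_sym[OF pq], of cs] multinomial_pos[of cs]
      by simp
  qed
  then show ?thesis using pq H by (auto simp: laplace_extremal_def)
qed

section \<open>Gauges of unconditional convex bodies\<close>

text \<open>
The gauge of a body is taken as the support function of its polar, whose suprema are attained by
compactness; the bipolar theorem identifies the unit ball.
\<close>

definition support_fun :: "(real ^ 'n) set \<Rightarrow> real ^ 'n \<Rightarrow> real" where
  "support_fun A x = (SUP a\<in>A. x \<bullet> a)"

lemma support_fun_attained:
  fixes A :: "(real ^ 'n) set"
  assumes "compact A" "A \<noteq> {}"
  shows "\<exists>a\<in>A. x \<bullet> a = support_fun A x" and "a \<in> A \<Longrightarrow> x \<bullet> a \<le> support_fun A x"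
proof -
  have "continuous_on A (\<lambda>a. x \<bullet> a)" by (intro continuous_intros)
  from continuous_attains_sup[OF assms this]
  obtain a where a: "a \<in> A" "\<And>b. b \<in> A \<Longrightarrow> x \<bullet> b \<le> x \<bullet> a" by blast
  then have "support_fun A x = x \<bullet> a"
    unfolding support_fun_def by (intro cSup_eq_maximum) auto
  with a show "\<exists>a\<in>A. x \<bullet> a = support_fun A x" "a \<in> A \<Longrightarrow> x \<bullet> a \<le> support_fun A x" for a by auto
qed

lemma support_fun_continuous:
  fixes A :: "(real ^ 'n) set"
  assumes "compact A" "A \<noteq> {}"
  shows "continuous_on UNIV (support_fun A)"
proof -
  obtain B where B: "B > 0" "\<And>a. a \<in> A \<Longrightarrow> norm a \<le> B"
    using compact_imp_bounded[OF assms(1)] by (auto simp: bounded_pos)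
  have le: "support_fun A x \<le> B * dist x y + support_fun A y" for x y
  proof -
    obtain a where a: "a \<in> A" "x \<bullet> a = support_fun A x" using support_fun_attained[OF assms] by blast
    have "x \<bullet> a = (x - y) \<bullet> a + y \<bullet> a" by (simp add: inner_diff_left)
    also have "\<dots> \<le> norm (x - y) * norm a + support_fun A y"
      by (intro add_mono norm_cauchy_schwarz support_fun_attained[OF assms] a)
    also have "\<dots> \<le> norm (x - y) * B + support_fun A y"
      using B(2)[OF a(1)] by (intro add_mono mult_left_mono) auto
    finally show ?thesis using a by (simp add: dist_norm mult.commute)
  qed
  have "dist (support_fun A x) (support_fun A y) \<le> B * dist x y" for x y
    using le[of x y] le[of y x] by (simp add: dist_real_def dist_commute abs_le_iff)
  then have "B-lipschitz_on UNIV (support_fun A)" using B(1) by (intro lipschitz_onI) auto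
  then show ?thesis by (rule lipschitz_on_continuous_on)
qed

lemma reflect_coord_reflect [simp]: "reflect_coord i (reflect_coord i x) = x"
  by (simp add: vec_eq_iff)

lemma inner_reflect: "reflect_coord i x \<bullet> y = x \<bullet> reflect_coord i y"
  by (auto simp: inner_vec_def intro!: sum.cong)

lemma unconditional_mem:
  assumes "unconditional K"
  shows "reflect_coord i x \<in> K \<longleftrightarrow> x \<in> K"
proof -
  have "reflect_coord i ` K = K" using assms by (simp add: unconditional_def)
  then show ?thesis by (metis image_eqI reflect_coord_reflect)
qed

lemma support_fun_reflect:
  assumes "\<And>i x. reflect_coord i x \<in> A \<longleftrightarrow> x \<in> A"
  shows "support_fun A (reflect_coord i x) = support_fun A x"
proof -
  have "(\<lambda>a. reflect_coord i x \<bullet> a) ` A = (\<lambda>a. x \<bullet> a) ` A"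
  proof (intro equalityI image_subsetI)
    fix a assume "a \<in> A"
    then have "reflect_coord i a \<in> A" using assms by simp
    then show "reflect_coord i x \<bullet> a \<in> (\<lambda>a. x \<bullet> a) ` A" "x \<bullet> a \<in> (\<lambda>a. reflect_coord i x \<bullet> a) ` A"
      using inner_reflect[of i x] by (auto intro!: image_eqI[of _ _ "reflect_coord i a"])
  qed
  then show ?thesis by (simp add: support_fun_def)
qed

text \<open>
The body is invariant under \<open>- 1\<close>, the product of all reflections, so averaging a ball in the body
with its negative produces a ball around the origin.
\<close>

lemma unconditional_ball_subset:
  fixes K :: "(real ^ 'n) set"
  assumes "convex_body K" "unconditional K"
  shows "\<exists>r>0. ball 0 r \<subseteq> K"
proof -
  obtain x r where r: "r > 0" "ball x r \<subseteq> K"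
    using assms(1) by (auto simp: convex_body_def mem_interior)
  have conv: "convex K" using assms(1) by (simp add: convex_body_def)
  have neg: "- y \<in> K" if "y \<in> K" for y
  proof -
    have inv: "(reflect_coord i x \<in> K) = (x \<in> K)" for i x by (rule unconditional_mem[OF assms(2)])
    have "abs_vec (- y) = abs_vec y" by (simp add: vec_eq_iff)
    then show ?thesis
      using invariant_abs_vec[of "\<lambda>x. x \<in> K" y, OF inv] invariant_abs_vec[of "\<lambda>x. x \<in> K" "- y", OF inv] that by simp
  qed
  have "ball 0 r \<subseteq> K"
  proof
    fix z :: "real ^ 'n" assume "z \<in> ball 0 r"
    then have "x + z \<in> ball x r" "x - z \<in> ball x r" by (auto simp: dist_norm)
    then have "x + z \<in> K" "- (x - z) \<in> K" using r(2) neg[of "x - z"] by blast+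
    then have "(1 / 2) *\<^sub>R (x + z) + (1 / 2) *\<^sub>R (- (x - z)) \<in> K"
      using conv by (intro convexD) auto
    moreover have "(1 / 2) *\<^sub>R (x + z) + (1 / 2) *\<^sub>R (- (x - z)) = z"
      by (simp add: vec_eq_iff field_simps)
    ultimately show "z \<in> K" by simp
  qed
  with r(1) show ?thesis by blast
qed

theorem convex_body_dual_pair:
  fixes K :: "(real ^ 'n) set"
  assumes K: "convex_body K" "unconditional K"
  shows "\<exists>p q. dual_pair UNIV p q \<and> K = {x. p x \<le> 1}"
proof -
  obtain r where r: "r > 0" "ball 0 r \<subseteq> K" using unconditional_ball_subset[OF K] by blast
  have Kc: "compact K" "convex K" using K by (auto simp: convex_body_def)
  have K0: "0 \<in> K" using r by auto
  define P where "P = polar K"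
  have P_mem: "\<xi> \<in> P \<longleftrightarrow> (\<forall>y\<in>K. \<xi> \<bullet> y \<le> 1)" for \<xi> by (simp add: P_def polar_def)
  have P0: "0 \<in> P" by (simp add: P_mem)
  have "P = (\<Inter>y\<in>K. {\<xi>. y \<bullet> \<xi> \<le> 1})" by (auto simp: P_mem inner_commute)
  then have "closed P" by (auto intro!: closed_INT closed_halfspace_le)
  moreover have "norm \<xi> \<le> 2 / r" if "\<xi> \<in> P" for \<xi>
  proof (cases "\<xi> = 0")
    case False
    let ?y = "(r / 2 / norm \<xi>) *\<^sub>R \<xi>"
    have "?y \<in> K" using r False by (intro subsetD[OF r(2)]) auto
    then have "\<xi> \<bullet> ?y \<le> 1" using that unfolding P_mem by blast
    moreover have "\<xi> \<bullet> ?y = r / 2 * norm \<xi>"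
      using False by (simp add: dot_square_norm power2_eq_square)
    ultimately have "r / 2 * norm \<xi> \<le> 1" by linarith
    then show ?thesis using r by (simp add: field_simps)
  qed (use r in auto)
  then have "bounded P" by (auto simp: bounded_iff)
  ultimately have Pc: "compact P" by (simp add: compact_eq_bounded_closed)
  let ?p = "support_fun P" and ?q = "support_fun K"
  have K_ne: "K \<noteq> {}" and P_ne: "P \<noteq> {}" using K0 P0 by auto
  note pat = support_fun_attained[OF Pc P_ne] and qat = support_fun_attained[OF Kc(1) K_ne]
  have P_q: "\<xi> \<in> P \<longleftrightarrow> ?q \<xi> \<le> 1" for \<xi>
    using qat[of \<xi>] qat(2)[of _ \<xi>] by (force simp: P_mem)
  have K_p: "x \<in> K \<longleftrightarrow> ?p x \<le> 1" for x
  proof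
    assume x: "x \<in> K"
    obtain \<xi> where "\<xi> \<in> P" "x \<bullet> \<xi> = ?p x" using pat(1)[of x] by blast
    then show "?p x \<le> 1" using x by (auto simp: P_mem inner_commute)
  next
    assume px: "?p x \<le> 1"
    show "x \<in> K"
    proof (rule ccontr)
      assume "x \<notin> K"
      then obtain a b where ab: "a \<bullet> x < b" "\<And>y. y \<in> K \<Longrightarrow> b < a \<bullet> y"
        using separating_hyperplane_closed_point[OF Kc(2) compact_imp_closed[OF Kc(1)], of x] by blast
      \<comment> \<open>As \<open>0\<close> is in the body, \<open>b\<close> is negative, and dividing by it turns the hyperplane into a functional in the polar.\<close>
      have b: "b < 0" using ab(2)[OF K0] by simp
      have "((1 / b) *\<^sub>R a) \<in> P"
        unfolding P_mem
      proof
        fix y assume "y \<in> K"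
        from ab(2)[OF this] show "((1 / b) *\<^sub>R a) \<bullet> y \<le> 1" using b by (simp add: field_simps)
      qed
      then have "x \<bullet> ((1 / b) *\<^sub>R a) \<le> 1" using pat(2) px by (meson order_trans)
      then show False using ab(1) b by (simp add: inner_commute field_simps)
    qed
  qed
  have p0: "0 \<le> ?p x" and q0: "0 \<le> ?q x" for x
    using pat(2)[OF P0, of x] qat(2)[OF K0, of x] by simp_all
  have le: "x \<bullet> \<xi> \<le> ?p x * ?q \<xi>" for x \<xi>
  proof (rule ccontr)
    assume neg: "\<not> x \<bullet> \<xi> \<le> ?p x * ?q \<xi>"
    have scaled: "t * (x \<bullet> \<xi>) \<le> ?q \<xi>" if t: "0 \<le> t" "t * ?p x \<le> 1" for t
    proof -
      obtain \<zeta> where z: "\<zeta> \<in> P" "(t *\<^sub>R x) \<bullet> \<zeta> = ?p (t *\<^sub>R x)" using pat(1)[of "t *\<^sub>R x"] by blast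
      have "x \<bullet> \<zeta> \<le> ?p x" using pat(2)[OF z(1)] .
      then have "?p (t *\<^sub>R x) \<le> t * ?p x" using z(2) t(1) by (metis inner_scaleR_left mult_left_mono)
      then have "t *\<^sub>R x \<in> K" using t(2) K_p by simp
      then show ?thesis using qat(2)[of "t *\<^sub>R x" \<xi>] by (simp add: inner_commute)
    qed
    show False
    \<comment> \<open>If \<open>?p x = 0\<close>, all positive multiples of \<open>x\<close> are in the body, and a large one contradicts \<open>scaled\<close>.\<close>
    proof (cases "?p x = 0")
      case True
      then have pos: "x \<bullet> \<xi> > 0" using neg by simp
      from scaled[of "(?q \<xi> + 1) / (x \<bullet> \<xi>)"] show False using True pos q0[of \<xi>] by simp
    next
      case False
      then have "?p x > 0" using p0[of x] by simp
      with scaled[of "1 / ?p x"] neg show False by (simp add: field_simps)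
    qed
  qed
  have Krefl: "reflect_coord i x \<in> K \<longleftrightarrow> x \<in> K" for i x by (rule unconditional_mem[OF K(2)])
  have Prefl: "reflect_coord i \<xi> \<in> P \<longleftrightarrow> \<xi> \<in> P" for i \<xi>
    unfolding P_mem inner_reflect using Krefl by (metis reflect_coord_reflect)
  have "dual_pair UNIV ?p ?q"
    unfolding dual_pair_def gauge_of_polar_def
  proof (intro conjI allI ballI)
    show "continuous_on UNIV ?p" "continuous_on UNIV ?q"
      by (intro support_fun_continuous Pc Kc P_ne K_ne)+
    show "?p (reflect_coord i x) = ?p x" "?q (reflect_coord i x) = ?q x" for i x
      by (intro support_fun_reflect Prefl Krefl)+
    show "x \<bullet> \<xi> \<le> ?p x * ?q \<xi>" "x \<bullet> \<xi> \<le> ?q x * ?p \<xi>" for x \<xi>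
      using le[of x \<xi>] le[of \<xi> x] by (simp_all add: inner_commute mult.commute)
    show "\<exists>\<xi>\<in>coord_subspace UNIV. ?q \<xi> \<le> 1 \<and> x \<bullet> \<xi> = ?p x" for x
      using pat(1)[of x] P_q by auto
    show "\<exists>\<xi>\<in>coord_subspace UNIV. ?p \<xi> \<le> 1 \<and> x \<bullet> \<xi> = ?q x" for x
      using qat(1)[of x] K_p by auto
  qed (use p0 q0 in auto)
  moreover have "K = {x. ?p x \<le> 1}" using K_p by auto
  ultimately show ?thesis by blast
qed

section \<open>Comparison of Funk volumes\<close>

lemma ray_ints_mset_eq:
  fixes f :: "real ^ 'n \<Rightarrow> ennreal"
  assumes [measurable]: "f \<in> borel_measurable borel"
  shows "mset cs = mset ds \<Longrightarrow> ray_ints cs f = ray_ints ds f"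
proof (induction cs arbitrary: ds)
  case (Cons c cs)
  then have c: "c \<in> set ds" by (metis list.set_intros(1) mset_eq_setD)
  have "mset cs = mset (remove1 c ds)" using Cons.prems by (simp add: Cons.prems[symmetric])
  then have "ray_ints cs f = ray_ints (remove1 c ds) f" by (rule Cons.IH)
  then show ?case using ray_ints_remove1[OF assms c] by simp
qed simp

text \<open>
Attainment of the bound passes from a list to any of its sublists, by removing surplus entries one by
one; only multiplicities matter, since the order of ray integrations does not.
\<close>

lemma laplace_product_eq_sub:
  fixes p q :: "real ^ 'n \<Rightarrow> real"
  assumes pq: "dual_pair UNIV p q"
  shows "laplace0 p ds * laplace0 q ds = multinomial ds \<Longrightarrow> (\<And>i. count_list cs i \<le> count_list ds i)
    \<Longrightarrow> laplace0 p cs * laplace0 q cs = multinomial cs"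
proof (induction "length ds" arbitrary: ds rule: less_induct)
  case less
  show ?case
  proof (cases "\<exists>j. count_list cs j < count_list ds j")
    case True
    then obtain j where j: "count_list cs j < count_list ds j" by blast
    then have "count_list ds j > 0" by linarith
    then have mem: "j \<in> set ds" by (simp add: count_list_pos_iff)
    show ?thesis
    proof (rule less.hyps[of "remove1 j ds"])
      show "length (remove1 j ds) < length ds" using mem by (simp add: length_remove1) (cases ds; simp)
      show "laplace0 p (remove1 j ds) * laplace0 q (remove1 j ds) = multinomial (remove1 j ds)"
        by (rule laplace_product_eq_remove1[OF pq]) (use mem less.prems in auto)
      show "count_list cs i \<le> count_list (remove1 j ds) i" for i
        using less.prems(2)[of i] j by (auto simp: count_list_remove1)
    qed
  next
    case False
    then have cnt: "count_list cs i = count_list ds i" for i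
      using less.prems(2)[of i] by (meson le_antisym not_less)
    then have mset: "mset cs = mset ds" by (auto intro: multiset_eqI simp: count_mset)
    note [measurable] = dual_pair_measurable[OF pq] dual_pair_measurable[OF dual_pair_sym[OF pq]]
    have "laplace0 p cs = laplace0 p ds" "laplace0 q cs = laplace0 q ds"
      unfolding laplace0_def laplace_def by (subst ray_ints_mset_eq[OF _ mset]; simp)+
    moreover have "multinomial cs = multinomial ds"
      unfolding multinomial_def cnt using mset_eq_length[OF mset] by simp
    ultimately show ?thesis using less.prems(1) by simp
  qed
qed

lemma unit_ball_bounded:
  fixes p q :: "real ^ 'n \<Rightarrow> real"
  assumes pq: "dual_pair UNIV p q"
  shows "bounded {x. p x \<le> c}"
proof -
  have "norm x \<le> (\<Sum>i\<in>UNIV. c * q (unit_vec i))" if x: "p x \<le> c" for x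
  proof -
    have "norm x \<le> (\<Sum>i\<in>UNIV. \<bar>x $ i\<bar>)" by (rule norm_le_l1_cart)
    also have "\<dots> \<le> (\<Sum>i\<in>UNIV. c * q (unit_vec i))"
    proof (rule sum_mono)
      fix i
      have "\<bar>x $ i\<bar> \<le> p (abs_vec x) * q (unit_vec i)"
        using dual_pairD(4)[OF pq, of "abs_vec x" "unit_vec i"] by (simp add: inner_axis)
      also have "\<dots> \<le> c * q (unit_vec i)"
        using x dual_pairD(2)[OF dual_pair_sym[OF pq]] dual_pairD(6)[OF pq] by (intro mult_right_mono) auto
      finally show "\<bar>x $ i\<bar> \<le> c * q (unit_vec i)" .
    qed
    finally show ?thesis .
  qed
  then show ?thesis by (auto simp: bounded_iff)
qed

text \<open>
The Funk volume of a ball, without the normalising constant, in terms of the two gauges.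
\<close>

definition funk_integral :: "real \<Rightarrow> (real ^ 'n \<Rightarrow> real) \<Rightarrow> (real ^ 'n \<Rightarrow> real) \<Rightarrow> ennreal" where
  "funk_integral \<rho> p q = (\<integral>\<^sup>+x. emeasure lborel {\<xi>. q \<xi> - x \<bullet> \<xi> \<le> 1} * indicator {x. p x \<le> \<rho>} x \<partial>lborel)"

text \<open>
For \<open>p x \<le> \<rho> < 1\<close> the polar body at \<open>x\<close> is contained in a fixed multiple of the polar at the origin.
Finiteness is what allows equality of two sums to be turned into equality of their terms.
\<close>

lemma funk_integral_finite:
  fixes p q :: "real ^ 'n \<Rightarrow> real"
  assumes pq: "dual_pair UNIV p q" and \<rho>: "0 < \<rho>" "\<rho> < 1"
  shows "funk_integral \<rho> p q < \<infinity>"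
proof -
  have qp: "dual_pair UNIV q p" using pq by (rule dual_pair_sym)
  note [measurable] = dual_pair_measurable[OF pq] dual_pair_measurable[OF qp]
  let ?c = "emeasure lborel {\<xi>. q \<xi> \<le> 1 / (1 - \<rho>)}"
  have "emeasure lborel {\<xi>. q \<xi> - x \<bullet> \<xi> \<le> 1} \<le> ?c" if x: "p x \<le> \<rho>" for x
  proof (rule emeasure_mono)
    show "{\<xi>. q \<xi> - x \<bullet> \<xi> \<le> 1} \<subseteq> {\<xi>. q \<xi> \<le> 1 / (1 - \<rho>)}"
    proof (intro subsetI CollectI)
      fix \<xi> assume "\<xi> \<in> {\<xi>. q \<xi> - x \<bullet> \<xi> \<le> 1}"
      moreover have "x \<bullet> \<xi> \<le> \<rho> * q \<xi>"
        using dual_pairD(4)[OF pq, of x \<xi>] mult_right_mono[OF x dual_pairD(2)[OF qp, of \<xi>]] by simp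
      ultimately have "(1 - \<rho>) * q \<xi> \<le> 1" by (simp add: algebra_simps)
      then show "q \<xi> \<le> 1 / (1 - \<rho>)" using \<rho> by (simp add: field_simps)
    qed
    show "{\<xi>. q \<xi> \<le> 1 / (1 - \<rho>)} \<in> sets lborel" by simp
  qed
  then have "funk_integral \<rho> p q \<le> (\<integral>\<^sup>+x. ?c * indicator {x. p x \<le> \<rho>} x \<partial>lborel)"
    unfolding funk_integral_def by (intro nn_integral_mono) (auto simp: indicator_def)
  also have "\<dots> = ?c * emeasure lborel {x. p x \<le> \<rho>}" by (subst nn_integral_cmult_indicator) auto
  also have "\<dots> < \<infinity>"
    using emeasure_bounded_finite[OF unit_ball_bounded[OF pq, of \<rho>]]
      emeasure_bounded_finite[OF unit_ball_bounded[OF qp, of "1 / (1 - \<rho>)"]]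
    by (simp add: ennreal_mult_less_top)
  finally show ?thesis .
qed

lemma funk_vol_eq:
  fixes p q :: "real ^ 'n \<Rightarrow> real" and K :: "(real ^ 'n) set"
  assumes pq: "dual_pair UNIV p q" and K: "K = {x. p x \<le> 1}" and "R > 0"
  shows "funk_vol K (funk_ball K 0 R) = funk_integral (1 - exp (- R)) p q / emeasure lborel (ball (0 :: real ^ 'n) 1)"
proof -
  have qp: "dual_pair UNIV q p" using pq by (rule dual_pair_sym)
  define \<rho> where "\<rho> = 1 - exp (- R)"
  have \<rho>: "0 < \<rho>" using \<open>R > 0\<close> by (simp add: \<rho>_def)
  have ball: "funk_ball K 0 R = {x. p x \<le> \<rho>}"
  proof (intro equalityI subsetI)
    fix x assume "x \<in> funk_ball K 0 R"
    then obtain y where "y \<in> K" "x = \<rho> *\<^sub>R y" by (auto simp: funk_ball_def \<rho>_def)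
    then show "x \<in> {x. p x \<le> \<rho>}" using \<rho> by (simp add: K dual_pair_scale[OF pq])
  next
    fix x assume x: "x \<in> {x. p x \<le> \<rho>}"
    then have "(1 / \<rho>) *\<^sub>R x \<in> K" using \<rho> by (simp add: K dual_pair_scale[OF pq] field_simps)
    moreover have "x = \<rho> *\<^sub>R ((1 / \<rho>) *\<^sub>R x)" using \<rho> by simp
    ultimately show "x \<in> funk_ball K 0 R" unfolding funk_ball_def \<rho>_def by (intro image_eqI) auto
  qed
  have "polar_at K x = {\<xi>. q \<xi> - x \<bullet> \<xi> \<le> 1}" for x
  proof (intro equalityI subsetI CollectI)
    fix \<xi> assume xi: "\<xi> \<in> polar_at K x"
    obtain y where "p y \<le> 1" "\<xi> \<bullet> y = q \<xi>" using dual_pairD(5)[OF qp, of \<xi>] by auto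
    then show "q \<xi> - x \<bullet> \<xi> \<le> 1"
      using xi by (auto simp: polar_at_def polar_def K inner_diff_right inner_commute)
  next
    fix \<xi> assume xi: "\<xi> \<in> {\<xi>. q \<xi> - x \<bullet> \<xi> \<le> 1}"
    show "\<xi> \<in> polar_at K x"
      unfolding polar_at_def polar_def
    proof (intro CollectI ballI)
      fix z assume "z \<in> (\<lambda>y. y - x) ` K"
      then obtain y where y: "p y \<le> 1" "z = y - x" by (auto simp: K)
      have "\<xi> \<bullet> y \<le> q \<xi>" using dual_pair_le[OF qp, of \<xi> y] y by simp
      then show "\<xi> \<bullet> z \<le> 1" using xi y by (simp add: inner_diff_right inner_commute)
    qed
  qed
  then show ?thesis
    unfolding funk_vol_def ball funk_integral_def \<rho>_def[symmetric] by simp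
qed

lemma funk_coeff_nonneg: "0 \<le> \<rho> \<Longrightarrow> 0 \<le> funk_coeff \<rho> m"
  by (auto simp: funk_coeff_def even_weight_def intro!: mult_nonneg_nonneg divide_nonneg_nonneg prod_nonneg)

lemma funk_coeff_pos:
  assumes "0 < \<rho>" "\<And>i. even (m i)"
  shows "0 < funk_coeff \<rho> m"
  using assms by (auto simp: funk_coeff_def even_weight_def intro!: mult_pos_pos divide_pos_pos prod_pos zero_less_power)

text \<open>
Both series have the same nonnegative coefficients, and those with only even exponents are positive.
Equality of the sums therefore gives equality in \<open>laplace_product_ge\<close> for all lists with odd
multiplicities, and every list is contained in one of these.
\<close>

lemma funk_integral_compare:
  fixes p q p' q' :: "real ^ 'n \<Rightarrow> real"
  assumes pq: "dual_pair UNIV p q" and ext: "laplace_extremal p' q'" and \<rho>: "0 < \<rho>" "\<rho> < 1"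
  shows "funk_integral \<rho> p' q' \<le> funk_integral \<rho> p q"
    and "funk_integral \<rho> p q = funk_integral \<rho> p' q' \<longleftrightarrow> laplace_extremal p q"
proof -
  have pq': "dual_pair UNIV p' q'" using ext by (simp add: laplace_extremal_def)
  let ?n = "ennreal (fact CARD('n))"
  let ?C = "\<lambda>m :: 'n \<Rightarrow> nat. funk_coeff \<rho> m * multinomial (index_list m)"
  let ?P = "\<lambda>m :: 'n \<Rightarrow> nat. funk_coeff \<rho> m * (laplace0 p (index_list m) * laplace0 q (index_list m))"
  have exp: "?n * funk_integral \<rho> p q = (\<integral>\<^sup>+m. ennreal (?P m) \<partial>count_space UNIV)"
    unfolding funk_integral_def by (rule funk_integral_expansion[OF pq]) (use \<rho> in auto)
  have ext_exp: "?n * funk_integral \<rho> p q = (\<integral>\<^sup>+m. ennreal (?C m) \<partial>count_space UNIV)"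
    if "laplace_extremal p q" for p q :: "real ^ 'n \<Rightarrow> real"
    using funk_integral_expansion[of p q \<rho>] that \<rho> by (simp add: funk_integral_def laplace_extremal_def)
  have n0: "?n \<noteq> 0" "?n \<noteq> top" by simp_all
  have cancel: "a = b" if "?n * a = ?n * b" for a b
    using that n0 by (simp add: ennreal_mult_cancel_left)
  have CP: "?C m \<le> ?P m" for m
    using laplace_product_ge[OF pq] funk_coeff_nonneg[of \<rho> m] \<rho> by (intro mult_left_mono) auto
  have C0: "0 \<le> ?C m" for m
    using funk_coeff_nonneg[of \<rho> m] \<rho> multinomial_pos[of "index_list m"] by simp
  have "?n * funk_integral \<rho> p' q' \<le> ?n * funk_integral \<rho> p q"
    unfolding ext_exp[OF ext] exp by (intro nn_integral_mono ennreal_leI CP)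
  then show "funk_integral \<rho> p' q' \<le> funk_integral \<rho> p q"
    using n0 by (simp add: ennreal_mult_le_mult_iff)
  show "funk_integral \<rho> p q = funk_integral \<rho> p' q' \<longleftrightarrow> laplace_extremal p q"
  proof
    assume "laplace_extremal p q"
    from ext_exp[OF this] ext_exp[OF ext] show "funk_integral \<rho> p q = funk_integral \<rho> p' q'"
      by (rule cancel[OF trans[OF _ sym]])
  next
    assume eq: "funk_integral \<rho> p q = funk_integral \<rho> p' q'"
    have split: "ennreal (?P m) = ennreal (?C m) + ennreal (?P m - ?C m)" for m
      using CP[of m] C0[of m] by (simp add: ennreal_plus[symmetric] del: ennreal_plus)
    have "(\<integral>\<^sup>+m. ennreal (?C m) \<partial>count_space UNIV) + (\<integral>\<^sup>+m. ennreal (?P m - ?C m) \<partial>count_space UNIV) = ?n * funk_integral \<rho> p q"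
      unfolding exp split by (rule nn_integral_add[symmetric]) auto
    also have "\<dots> = (\<integral>\<^sup>+m. ennreal (?C m) \<partial>count_space UNIV) + 0"
      unfolding eq ext_exp[OF ext] by simp
    finally have "(\<integral>\<^sup>+m. ennreal (?C m) \<partial>count_space UNIV) + (\<integral>\<^sup>+m. ennreal (?P m - ?C m) \<partial>count_space UNIV) =
        (\<integral>\<^sup>+m. ennreal (?C m) \<partial>count_space UNIV) + 0" .
    moreover have "(\<integral>\<^sup>+m. ennreal (?C m) \<partial>count_space UNIV) \<noteq> \<infinity>"
      using funk_integral_finite[OF pq' \<rho>] unfolding ext_exp[OF ext, symmetric]
      by (simp add: ennreal_mult_eq_top_iff less_top)
    ultimately have "(\<integral>\<^sup>+m. ennreal (?P m - ?C m) \<partial>count_space UNIV) = 0"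
      unfolding ennreal_add_left_cancel by simp
    then have zero: "ennreal (?P m - ?C m) = 0" for m
      by (subst (asm) nn_integral_0_iff_AE) (auto simp: AE_count_space)
    have "laplace0 p cs * laplace0 q cs = multinomial cs" for cs
    proof (rule laplace_product_eq_sub[OF pq])
      \<comment> \<open>Even exponents, large enough for the index list to contain \<open>cs\<close>.\<close>
      let ?m = "\<lambda>i. 2 * count_list cs i"
      have "?P ?m = ?C ?m" using zero[of ?m] CP[of ?m] by (simp add: ennreal_eq_0_iff)
      then show "laplace0 p (index_list ?m) * laplace0 q (index_list ?m) = multinomial (index_list ?m)"
        using funk_coeff_pos[of \<rho> ?m] \<rho> by simp
      show "count_list cs i \<le> count_list (index_list ?m) i" for i by (simp add: count_index_list)
    qed
    then show "laplace_extremal p q" using pq by (simp add: laplace_extremal_def)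
  qed
qed

theorem theorem1p3:
  fixes K H :: "(real ^ 'n) set" and R :: real
  assumes "convex_body K" and "unconditional K"
    and "hanner_polytope H"
    and "R > 0"
  shows "funk_vol K (funk_ball K 0 R) \<ge> funk_vol H (funk_ball H 0 R)
    \<and> (funk_vol K (funk_ball K 0 R) = funk_vol H (funk_ball H 0 R) \<longleftrightarrow> hanner_polytope K)"
proof -
  obtain p q where pq: "dual_pair UNIV p q" and K: "K = {x. p x \<le> 1}"
    using convex_body_dual_pair[OF assms(1,2)] by blast
  obtain p' q' where ext: "laplace_extremal p' q'" and H: "H = {x. p' x \<le> 1}"
    using hanner_polytope_extremal[OF assms(3)] by blast
  define \<rho> where "\<rho> = 1 - exp (- R)"
  have \<rho>: "0 < \<rho>" "\<rho> < 1" using \<open>R > 0\<close> by (auto simp: \<rho>_def)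
  let ?\<omega> = "emeasure lborel (ball (0 :: real ^ 'n) 1)"
  have \<omega>: "?\<omega> \<noteq> 0" "?\<omega> \<noteq> top"
    using less_imp_neq[OF unit_ball_vol_pos[OF of_nat_0_le_iff[of "CARD('n)"]]] by (auto simp: emeasure_ball)
  have volH: "funk_vol H (funk_ball H 0 R) = funk_integral \<rho> p' q' / ?\<omega>"
    unfolding \<rho>_def by (rule funk_vol_eq[OF laplace_extremal_dual_pair[OF ext] H \<open>R > 0\<close>])
  have volK: "funk_vol K (funk_ball K 0 R) = funk_integral \<rho> p q / ?\<omega>" if "dual_pair UNIV p q" "K = {x. p x \<le> 1}" for p q
    unfolding \<rho>_def by (rule funk_vol_eq[OF that \<open>R > 0\<close>])
  have cancel: "a / ?\<omega> = b / ?\<omega> \<longleftrightarrow> a = b" for a b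
    using \<omega> by (metis mult_divide_eq_ennreal ennreal_times_divide mult.commute)
  have "hanner_polytope K \<longleftrightarrow> funk_integral \<rho> p q = funk_integral \<rho> p' q'"
  proof
    assume "hanner_polytope K"
    then obtain p1 q1 where 1: "laplace_extremal p1 q1" "K = {x. p1 x \<le> 1}"
      using hanner_polytope_extremal by blast
    note d1 = laplace_extremal_dual_pair[OF 1(1)]
    have "funk_integral \<rho> p q / ?\<omega> = funk_integral \<rho> p1 q1 / ?\<omega>"
      using volK[OF pq K] volK[OF d1 1(2)] by simp
    then have "funk_integral \<rho> p q = funk_integral \<rho> p1 q1" unfolding cancel .
    also have "\<dots> = funk_integral \<rho> p' q'"
      using funk_integral_compare(2)[OF d1 ext \<rho>] 1(1) by simp
    finally show "funk_integral \<rho> p q = funk_integral \<rho> p' q'" .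
  next
    assume "funk_integral \<rho> p q = funk_integral \<rho> p' q'"
    then have "laplace_extremal p q" using funk_integral_compare(2)[OF pq ext \<rho>] by simp
    then show "hanner_polytope K" unfolding K by (rule extremal_unit_ball_hanner)
  qed
  moreover have "funk_integral \<rho> p' q' / ?\<omega> \<le> funk_integral \<rho> p q / ?\<omega>"
    by (intro divide_right_mono_ennreal funk_integral_compare(1)[OF pq ext \<rho>])
  ultimately show ?thesis unfolding volH volK[OF pq K] cancel by simp
qed

end
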